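(* Let $1\le k\le m<2n$. In $U_q^+(\mathfrak{sp}_{2n})$ the coproduct of $v[k,m]$ is $$\Delta(v[k,m])=v[k,m]\otimes 1+g_{km}\otimes v[k,m]+\sum_{i=k}^{m-1}\tau_i(1-q^{-1})\,g_{ki}\,v[i+1,m]\otimes v[k,i],$$ where $g_{ki}=g_kg_{k+1}\cdots g_i$, and $\tau_i=1$ for all $i$ with exactly two exceptions: $\tau_{n-1}=1+q^{-1}$ if $m=n$, and $\tau_n=1+q^{-1}$ if $k=n$.
   Context: Let $\mathbf{k}$ be a field, $G$ an abelian group, $n\ge 2$, and $X=\{x_1,\dots,x_n\}$. Fix $g_1,\dots,g_n\in G$ and characters $\chi^1,\dots,\chi^n:G\to\mathbf{k}^*$, and put $p_{ij}=\chi^i(g_j)$. For a word $u$ in $X$ let $g_u\in G$ and $\chi^u$ be obtained from $u$ by replacing each $x_i$ by $g_i$, resp. $\chi^i$ (products), and set $p(u,v)=\chi^u(g_v)$; this extends to polynomials homogeneous in each variable and is bimultiplicative. $G\langle X\rangle$ is the skew group algebra of $G$ and the free algebra $\mathbf{k}\langle X\rangle$ with $x_ig=\chi^i(g)gx_i$; it is a Hopf algebra with $\Delta(x_i)=x_i\otimes1+g_i\otimes x_i$, $\Delta(g)=g\otimes g$. For homogeneous $u,v$ the skew bracket is $[u,v]=uv-p(u,v)vu$. Fix $q\in\mathbf{k}^*$ with $q^3\ne1$, $q\ne-1$, and assume $p_{ii}=q$ ($1\le i<n$), $p_{nn}=q^2$, $p_{i,i-1}p_{i-1,i}=q^{-1}$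 ($1<i<n$), $p_{n-1,n}p_{n,n-1}=q^{-2}$, and $p_{ij}p_{ji}=1$ for $j>i+1$. The Hopf algebra $U_q^+(\mathfrak{sp}_{2n})$ is the quotient of $G\langle X\rangle$ by the (Hopf) ideal generated by $[x_i,[x_i,x_{i+1}]]$, $[[x_i,x_{i+1}],x_{i+1}]$ ($1\le i<n-1$), $[x_i,x_j]$ ($j>i+1$), $[[x_{n-1},x_n],x_n]$ and $[x_{n-1},[x_{n-1},[x_{n-1},x_n]]]$. Notation: for $n<i<2n$ put $x_i:=x_{2n-i}$ and $g_i:=g_{2n-i}$; let $\phi(i)=2n-i$. For $1\le k\le m<2n$, $v(k,m)$ is the word $x_kx_{k+1}\cdots x_m$, and $v[k,m]$ is defined by: $v[k,k]=x_k$; if $m<\phi(k)$, $v[k,m]=[[\dots[x_k,x_{k+1}],\dots,x_{m-1}],x_m]$; if $m>\phi(k)$, $v[k,m]=[x_k,[x_{k+1},[\dots,[x_{m-1},x_m]\dots]]]$; if $m=\phi(k)$ (and $k<m$), $v[k,m]=v[k,m-1]\,x_m-q^{-1}p(v(k,m-1),x_m)\,x_m\,v[k,m-1]$. *)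

theory Defs
  imports "HOL-Library.Poly_Mapping"
begin

(* The skew group algebra G<X>: k-linear combinations of basis elements  g * u,
   with g :: 'g (the abelian group G, written additively) and u a word in the
   letters 1..n (nat list).  Tensor square: linear combinations of pairs of basis elements. *)
type_synonym ('g,'k) alg = "('g \<times> nat list) \<Rightarrow>\<^sub>0 'k"
type_synonym ('g,'k) talg = "(('g \<times> nat list) \<times> ('g \<times> nat list)) \<Rightarrow>\<^sub>0 'k"

definition chiw :: "(nat \<Rightarrow> 'g \<Rightarrow> 'k::comm_monoid_mult) \<Rightarrow> nat list \<Rightarrow> 'g \<Rightarrow> 'k" where
  "chiw chi u h = prod_list (map (\<lambda>i. chi i h) u)"

definition gw :: "(nat \<Rightarrow> 'g::comm_monoid_add) \<Rightarrow> nat list \<Rightarrow> 'g" where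
  "gw gg u = sum_list (map gg u)"

definition pw :: "(nat \<Rightarrow> 'g::comm_monoid_add \<Rightarrow> 'k::comm_monoid_mult) \<Rightarrow> (nat \<Rightarrow> 'g) \<Rightarrow> nat list \<Rightarrow> nat list \<Rightarrow> 'k" where
  "pw chi gg u v = chiw chi u (gw gg v)"

definition smult :: "'k::semiring_0 \<Rightarrow> ('a \<Rightarrow>\<^sub>0 'k) \<Rightarrow> ('a \<Rightarrow>\<^sub>0 'k)" where
  "smult c f = Poly_Mapping.map (\<lambda>x. c * x) f"

definition amul :: "(nat \<Rightarrow> 'g::ab_group_add \<Rightarrow> 'k::field) \<Rightarrow> ('g,'k) alg \<Rightarrow> ('g,'k) alg \<Rightarrow> ('g,'k) alg" where
  "amul chi f h = (\<Sum>a\<in>Poly_Mapping.keys f. \<Sum>b\<in>Poly_Mapping.keys h.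
      Poly_Mapping.single (fst a + fst b, snd a @ snd b)
        (Poly_Mapping.lookup f a * Poly_Mapping.lookup h b * chiw chi (snd a) (fst b)))"

definition tmul :: "(nat \<Rightarrow> 'g::ab_group_add \<Rightarrow> 'k::field) \<Rightarrow> ('g,'k) talg \<Rightarrow> ('g,'k) talg \<Rightarrow> ('g,'k) talg" where
  "tmul chi F H = (\<Sum>a\<in>Poly_Mapping.keys F. \<Sum>b\<in>Poly_Mapping.keys H.
      Poly_Mapping.single
        ((fst (fst a) + fst (fst b), snd (fst a) @ snd (fst b)),
         (fst (snd a) + fst (snd b), snd (snd a) @ snd (snd b)))
        (Poly_Mapping.lookup F a * Poly_Mapping.lookup H b * chiw chi (snd (fst a)) (fst (fst b))
                                 * chiw chi (snd (snd a)) (fst (snd b))))"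

definition tens :: "('g,'k::field) alg \<Rightarrow> ('g,'k) alg \<Rightarrow> ('g,'k) talg" where
  "tens f h = (\<Sum>a\<in>Poly_Mapping.keys f. \<Sum>b\<in>Poly_Mapping.keys h. Poly_Mapping.single (a, b) (Poly_Mapping.lookup f a * Poly_Mapping.lookup h b))"

definition grp :: "'g \<Rightarrow> ('g::ab_group_add,'k::field) alg" where
  "grp g = Poly_Mapping.single (g, []) 1"

definition one :: "('g::ab_group_add,'k::field) alg" where
  "one = grp 0"

definition gen :: "nat \<Rightarrow> ('g::ab_group_add,'k::field) alg" where
  "gen i = Poly_Mapping.single (0, [i]) 1"

(* coproduct: algebra map with Delta(g) = g\<otimes>g, Delta(x_i) = x_i\<otimes>1 + g_i\<otimes>x_i *)
definition delta_basis :: "(nat \<Rightarrow> 'g::ab_group_add \<Rightarrow> 'k::field) \<Rightarrow> (nat \<Rightarrow> 'g) \<Rightarrow> 'g \<times> nat list \<Rightarrow> ('g,'k) talg" where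
  "delta_basis chi gg a = foldl (\<lambda>acc i. tmul chi acc (tens (gen i) one + tens (grp (gg i)) (gen i)))
       (tens (grp (fst a)) (grp (fst a))) (snd a)"

definition Delta :: "(nat \<Rightarrow> 'g::ab_group_add \<Rightarrow> 'k::field) \<Rightarrow> (nat \<Rightarrow> 'g) \<Rightarrow> ('g,'k) alg \<Rightarrow> ('g,'k) talg" where
  "Delta chi gg f = (\<Sum>a\<in>Poly_Mapping.keys f. smult (Poly_Mapping.lookup f a) (delta_basis chi gg a))"

(* skew bracket [u,v] = uv - p(u,v) vu for homogeneous u, v of the degrees of the words wu, wv *)
definition sbr :: "(nat \<Rightarrow> 'g::ab_group_add \<Rightarrow> 'k::field) \<Rightarrow> (nat \<Rightarrow> 'g) \<Rightarrow> nat list \<Rightarrow> ('g,'k) alg \<Rightarrow> nat list \<Rightarrow> ('g,'k) alg \<Rightarrow> ('g,'k) alg" where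
  "sbr chi gg wu u wv v = amul chi u v - smult (pw chi gg wu wv) (amul chi v u)"

(* the elements of G<X>: words only in the letters 1..n *)
definition inA :: "nat \<Rightarrow> ('g,'k::zero) alg \<Rightarrow> bool" where
  "inA n f \<longleftrightarrow> (\<forall>a\<in>Poly_Mapping.keys f. set (snd a) \<subseteq> {1..n})"

inductive_set ideal_gen :: "(nat \<Rightarrow> 'g::ab_group_add \<Rightarrow> 'k::field) \<Rightarrow> nat \<Rightarrow> ('g,'k) alg set \<Rightarrow> ('g,'k) alg set"
  for chi n R where
  zero: "0 \<in> ideal_gen chi n R"
| gen: "r \<in> R \<Longrightarrow> inA n a \<Longrightarrow> inA n b \<Longrightarrow> amul chi (amul chi a r) b \<in> ideal_gen chi n R"
| add: "x \<in> ideal_gen chi n R \<Longrightarrow> y \<in> ideal_gen chi n R \<Longrightarrow> x + y \<in> ideal_gen chi n R"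

(* the subspace I \<otimes> A + A \<otimes> I of A \<otimes> A, i.e. the kernel of A\<otimes>A \<rightarrow> (A/I)\<otimes>(A/I) *)
inductive_set tideal :: "nat \<Rightarrow> ('g,'k::field) alg set \<Rightarrow> ('g,'k) talg set"
  for n I where
  zero: "0 \<in> tideal n I"
| left: "x \<in> I \<Longrightarrow> inA n a \<Longrightarrow> tens x a \<in> tideal n I"
| right: "x \<in> I \<Longrightarrow> inA n a \<Longrightarrow> tens a x \<in> tideal n I"
| add: "x \<in> tideal n I \<Longrightarrow> y \<in> tideal n I \<Longrightarrow> x + y \<in> tideal n I"

definition rels :: "(nat \<Rightarrow> 'g::ab_group_add \<Rightarrow> 'k::field) \<Rightarrow> (nat \<Rightarrow> 'g) \<Rightarrow> nat \<Rightarrow> ('g,'k) alg set" where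
  "rels chi gg n =
     {sbr chi gg [i] (gen i) [i, i+1] (sbr chi gg [i] (gen i) [i+1] (gen (i+1))) | i. 1 \<le> i \<and> i < n - 1}
   \<union> {sbr chi gg [i, i+1] (sbr chi gg [i] (gen i) [i+1] (gen (i+1))) [i+1] (gen (i+1)) | i. 1 \<le> i \<and> i < n - 1}
   \<union> {sbr chi gg [i] (gen i) [j] (gen j) | i j. 1 \<le> i \<and> i + 1 < j \<and> j \<le> n}
   \<union> {sbr chi gg [n-1, n] (sbr chi gg [n-1] (gen (n-1)) [n] (gen n)) [n] (gen n)}
   \<union> {sbr chi gg [n-1] (gen (n-1)) [n-1, n-1, n]
        (sbr chi gg [n-1] (gen (n-1)) [n-1, n]
          (sbr chi gg [n-1] (gen (n-1)) [n] (gen n)))}"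

definition Iq :: "(nat \<Rightarrow> 'g::ab_group_add \<Rightarrow> 'k::field) \<Rightarrow> (nat \<Rightarrow> 'g) \<Rightarrow> nat \<Rightarrow> ('g,'k) alg set" where
  "Iq chi gg n = ideal_gen chi n (rels chi gg n)"

(* x_i := x_{2n-i} for n < i < 2n *)
definition idx :: "nat \<Rightarrow> nat \<Rightarrow> nat" where
  "idx n i = (if i \<le> n then i else 2 * n - i)"

definition vw :: "nat \<Rightarrow> nat \<Rightarrow> nat \<Rightarrow> nat list" where
  "vw n k m = map (idx n) [k..<Suc m]"

definition gkm :: "(nat \<Rightarrow> 'g::comm_monoid_add) \<Rightarrow> nat \<Rightarrow> nat \<Rightarrow> nat \<Rightarrow> 'g" where
  "gkm gg n k i = gw gg (vw n k i)"

fun lnorm :: "(nat \<Rightarrow> 'g::ab_group_add \<Rightarrow> 'k::field) \<Rightarrow> (nat \<Rightarrow> 'g) \<Rightarrow> nat \<Rightarrow> nat \<Rightarrow> nat \<Rightarrow> ('g,'k) alg" where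
  "lnorm chi gg n k m = (if m \<le> k then gen (idx n k)
     else sbr chi gg (vw n k (m - 1)) (lnorm chi gg n k (m - 1)) [idx n m] (gen (idx n m)))"

function rnorm :: "(nat \<Rightarrow> 'g::ab_group_add \<Rightarrow> 'k::field) \<Rightarrow> (nat \<Rightarrow> 'g) \<Rightarrow> nat \<Rightarrow> nat \<Rightarrow> nat \<Rightarrow> ('g,'k) alg" where
  "rnorm chi gg n k m = (if m \<le> k then gen (idx n m)
     else sbr chi gg [idx n k] (gen (idx n k)) (vw n (k + 1) m) (rnorm chi gg n (k + 1) m))"
  by pat_completeness auto
termination by (relation "measure (\<lambda>(chi, gg, n, k, m). m - k)") auto

definition vb :: "(nat \<Rightarrow> 'g::ab_group_add \<Rightarrow> 'k::field) \<Rightarrow> (nat \<Rightarrow> 'g) \<Rightarrow> nat \<Rightarrow> 'k \<Rightarrow> nat \<Rightarrow> nat \<Rightarrow> ('g,'k) alg" where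
  "vb chi gg n q k m =
     (if m = k then gen (idx n k)
      else if m < 2 * n - k then lnorm chi gg n k m
      else if m > 2 * n - k then rnorm chi gg n k m
      else amul chi (lnorm chi gg n k (m - 1)) (gen (idx n m))
           - smult (inverse q * pw chi gg (vw n k (m - 1)) [idx n m])
                   (amul chi (gen (idx n m)) (lnorm chi gg n k (m - 1))))"

definition tau :: "nat \<Rightarrow> 'k::field \<Rightarrow> nat \<Rightarrow> nat \<Rightarrow> nat \<Rightarrow> 'k" where
  "tau n q k m i = (if (i = n - 1 \<and> m = n) \<or> (i = n \<and> k = n) then 1 + inverse q else 1)"

end

(* The quotient A by the ideal I is realised as a ring of operators, so that relations modulo I
become equations.  Write phi(k) = 2n - k, u_k = v[k, phi(k)], L_k = v[k, phi(k) - 1] and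
R_k = v[k + 1, phi(k)].  Bracketing the coproduct of v[k, m] with the next letter x (on the right
if m < phi(k), on the left if m > phi(k)) turns each summand a tensor b into
(bracket of a with x) tensor b plus a multiple of a tensor (bracket of b with x).
Nearly all of these brackets either vanish by the type A Serre relations (this is where q is not -1 is used) or give the
expected summand.  The exception occurs where x meets its mirror image; there the surplus term is
absorbed by the identity
  R_k - q N L_k = kappa (u_{k+1} x_k - q N x_k u_{k+1}),   N = p(u_{k+1}, x_k),
with kappa = 1 + 1/q for k = n - 1 and kappa = 1 otherwise, which is proved by descending induction
on k together with the symmetry u_k = L_k x_k - N x_k L_k = x_k R_k - N' R_k x_k. *)

theory Submission
  imports Defs HOL.Vector_Spaces
begin

section \<open>Skew brackets\<close>

text \<open>The ideal depends on \<open>chi\<close>, \<open>gg\<close> and \<open>n\<close>, so the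
  quotient cannot be a type of its own. Linear endomorphisms of one fixed space do form a type of
  class \<open>ring\<close>, where an identity between words is checked by expanding both sides.
  Hence each vanishing lemma rests on an explicit identity of the free algebra in which the
  relations occur as factors. On the tensor square a congruence is enough: only linear combinations
  and products with coproducts of letters occur there. The factors 1 + 1/q have one source. Adding a
  letter x_j creates a new summand with coefficient 1 - P, where P is a product of scalars p_ij
  p_ji. In general P = 1/q, but at the doubled bond between x_{n-1} and x_n it is 1/q^2, and 1 -
  1/q^2 = (1 + 1/q)(1 - 1/q). When the next letter x_{n-1} arrives, the exceptional summand is the
  one to which the identity for k = n - 1 applies, and its kappa uses up the factor; so the factor
  never spreads. The scalar 1/q in the definition of v[k, phi(k)] plays the same part: it restores P
  = 1/q where the word begins and ends with the same letter.\<close>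

locale skew_algebra =
  fixes sc :: "'k::field \<Rightarrow> 'a::ring \<Rightarrow> 'a"  (infixr "\<cdot>" 72)
  assumes sc_add_right: "c \<cdot> (x + y) = c \<cdot> x + c \<cdot> y"
    and sc_add_left: "(c + d) \<cdot> x = c \<cdot> x + d \<cdot> x"
    and sc_sc: "c \<cdot> (d \<cdot> x) = (c * d) \<cdot> x"
    and sc_one: "1 \<cdot> x = x"
    and sc_mult_left: "(c \<cdot> x) * y = c \<cdot> (x * y)"
    and sc_mult_right: "x * (c \<cdot> y) = c \<cdot> (x * y)"
begin

lemma sc_zero_right [simp]: "c \<cdot> 0 = 0"
  using sc_add_right[of c 0 0] by simp

lemma sc_zero_left [simp]: "0 \<cdot> x = 0"
  using sc_add_left[of 0 0 x] by simp

lemma sc_minus_right: "c \<cdot> (- x) = - (c \<cdot> x)"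
  by (rule minus_unique[symmetric]) (simp flip: sc_add_right)

lemma sc_minus_left: "(- c) \<cdot> x = - (c \<cdot> x)"
  by (rule minus_unique[symmetric]) (simp flip: sc_add_left)

lemma sc_diff_right: "c \<cdot> (x - y) = c \<cdot> x - c \<cdot> y"
  using sc_add_right[of c x "- y"] by (simp add: sc_minus_right)

lemma sc_diff_left: "(c - d) \<cdot> x = c \<cdot> x - d \<cdot> x"
  using sc_add_left[of c "- d" x] by (simp add: sc_minus_left)

lemma sc_cancel: "c \<noteq> 0 \<Longrightarrow> c \<cdot> x = 0 \<Longrightarrow> x = 0"
  by (metis left_inverse sc_one sc_sc sc_zero_right)

lemmas sc_simps = sc_add_right sc_add_left sc_diff_right sc_diff_left sc_minus_right sc_minus_left
  sc_sc sc_mult_left sc_mult_right sc_one algebra_simps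

text \<open>The scalar is an explicit argument because an element of the quotient ring carries no
  degree from which p(u,v) could be read off.\<close>

definition br :: "'k \<Rightarrow> 'a \<Rightarrow> 'a \<Rightarrow> 'a" where
  "br c u v = u * v - c \<cdot> (v * u)"

lemma br_zero_iff: "br c u v = 0 \<longleftrightarrow> u * v = c \<cdot> (v * u)"
  by (simp add: br_def)

text \<open>The two iterated brackets differ only by multiples of the bracket of the outer factors
  \<open>u\<close> and \<open>w\<close>. This is the passage between left-normed and right-normed
  brackets.\<close>

lemma br_assoc:
  assumes "br \<gamma> u w = 0"
  shows "br (\<gamma> * \<beta>) (br \<alpha> u v) w = br (\<alpha> * \<gamma>) u (br \<beta> v w)"
proof -
  have "br (\<gamma> * \<beta>) (br \<alpha> u v) w - br (\<alpha> * \<gamma>) u (br \<beta> v w)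
      = \<beta> \<cdot> (br \<gamma> u w * v) - \<alpha> \<cdot> (v * br \<gamma> u w)"
    by (simp add: br_def sc_simps)
  then show ?thesis by (simp add: assms)
qed

lemma br_commute_left:
  assumes "br c u y = 0" "br d v y = 0"
  shows "br (c * d) (br e u v) y = 0"
proof -
  have "br (c * d) (br e u v) y = u * br d v y + d \<cdot> (br c u y * v)
      - e \<cdot> (v * br c u y) - (e * c) \<cdot> (br d v y * u)"
    by (simp add: br_def sc_simps)
  then show ?thesis by (simp add: assms)
qed

lemma br_commute_right:
  assumes "br c y u = 0" "br d y v = 0"
  shows "br (c * d) y (br e u v) = 0"
proof -
  have "br (c * d) y (br e u v) = br c y u * v + c \<cdot> (u * br d y v)
      - e \<cdot> (br d y v * u) - (e * d) \<cdot> (v * br c y u)"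
    by (simp add: br_def sc_simps)
  then show ?thesis by (simp add: assms)
qed

lemma br_flip:
  assumes "br c u v = 0" "c * d = 1"
  shows "br d v u = 0"
proof -
  have "br d v u = - (d \<cdot> br c u v) - (c * d - 1) \<cdot> (v * u)"
    by (simp add: br_def sc_simps)
  then show ?thesis by (simp add: assms)
qed

section \<open>Consequences of the Serre relations of type A\<close>

text \<open>Both cubics are combinations of abb, bab and bba; under q s t = 1 they are proportional
  with factor q t t. Thus a Serre relation may be read from either end.\<close>

lemma serre_flip:
  assumes "br (q * s) (br s a b) b = 0" "q * s * t = 1"
  shows "br (q * t) b (br t b a) = 0"
proof -
  have "(q * t * t) \<cdot> br (q * s) (br s a b) b
      = br (q * t) b (br t b a) - ((q + 1) * t * (q * s * t - 1)) \<cdot> (b * a * b)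
        + ((q * s * t + 1) * (q * s * t - 1)) \<cdot> (b * b * a)"
    by (simp add: br_def sc_simps)
  then show ?thesis by (simp add: assms)
qed

lemma serre_flip':
  assumes "br (q * t) b (br t b a) = 0" "q * s * t = 1"
  shows "br (q * s) (br s a b) b = 0"
proof -
  have "(q * s * s) \<cdot> br (q * t) b (br t b a)
      = br (q * s) (br s a b) b - ((q + 1) * s * (q * s * t - 1)) \<cdot> (b * a * b)
        + ((q * s * t + 1) * (q * s * t - 1)) \<cdot> (a * b * b)"
    by (simp add: br_def sc_simps)
  then show ?thesis by (simp add: assms)
qed

text \<open>Bracketing with \<open>b\<close> is a skew derivation that kills [b,a] and [b,c].
  Applied twice to [a,c] = 0 (\<open>s\<close> is the result of the first application) it leaves
  only the two mixed products, each with the factor 1 + q, which can be cancelled.\<close>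

lemma serre_brackets_commute:
  assumes ba: "br (q * \<alpha>) b (br \<alpha> b a) = 0" and bc: "br (q * \<gamma>) b (br \<gamma> b c) = 0"
    and ac: "br \<rho> a c = 0" and q: "q \<noteq> - 1"
  shows "\<alpha> \<cdot> (br \<alpha> b a * br \<gamma> b c) = (\<gamma> * \<rho>) \<cdot> (br \<gamma> b c * br \<alpha> b a)"
proof -
  define d g where "d = br \<alpha> b a" and "g = br \<gamma> b c"
  define s where "s = d * c + \<alpha> \<cdot> (a * g) - \<rho> \<cdot> (g * a) - (\<rho> * \<gamma>) \<cdot> (c * d)"
  have "s = b * br \<rho> a c - (\<alpha> * \<gamma>) \<cdot> (br \<rho> a c * b)"
    by (simp add: s_def d_def g_def br_def sc_simps)
  then have s: "s = 0" by (simp add: ac)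
  have "(1 + q) \<cdot> (\<alpha> \<cdot> (d * g) - (\<gamma> * \<rho>) \<cdot> (g * d)) = b * s - (q * \<alpha> * \<gamma>) \<cdot> (s * b)
     - br (q * \<alpha>) b d * c - (\<alpha> * \<alpha>) \<cdot> (a * br (q * \<gamma>) b g)
     + \<rho> \<cdot> (br (q * \<gamma>) b g * a) + (\<rho> * \<gamma> * \<gamma>) \<cdot> (c * br (q * \<alpha>) b d)
     + \<alpha> \<cdot> ((d - br \<alpha> b a) * g) + (q * \<alpha>) \<cdot> (d * (g - br \<gamma> b c))
     - (\<rho> * \<gamma>) \<cdot> ((g - br \<gamma> b c) * d) - (q * \<rho> * \<gamma>) \<cdot> (g * (d - br \<alpha> b a))"
    unfolding s_def by (simp add: br_def sc_simps)
  then have "(1 + q) \<cdot> (\<alpha> \<cdot> (d * g) - (\<gamma> * \<rho>) \<cdot> (g * d)) = 0"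
    using s ba bc by (simp add: d_def g_def)
  moreover have "1 + q \<noteq> 0" using q by (metis add_eq_0_iff)
  ultimately have "\<alpha> \<cdot> (d * g) - (\<gamma> * \<rho>) \<cdot> (g * d) = 0" by (blast intro: sc_cancel)
  then show ?thesis by (simp add: d_def g_def)
qed

text \<open>The element E = [[f,b],c] = [f,[b,c]] has two forms. Bracketing each with
  \<open>b\<close> gives a linear relation between Eb, bE and the two products of [f,b] and [b,c];
  the weights 1 and q eliminate these products and leave 1 + q times the claim.\<close>

lemma serre_chain_left:
  assumes fb: "br (q * \<phi>) (br \<phi> f b) b = 0" and bc: "br (q * \<gamma>) b (br \<gamma> b c) = 0"
    and fc: "br \<rho> f c = 0" and g': "q * \<gamma> * \<gamma>' = 1" and q: "q \<noteq> - 1"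
  shows "br (\<phi> * q * \<gamma>') (br (\<rho> * \<gamma>) (br \<phi> f b) c) b = 0"
proof -
  define d g E where "d = br \<phi> f b" and "g = br \<gamma> b c" and "E = br (\<rho> * \<gamma>) d c"
  have E2: "E = br (\<phi> * \<rho>) f g"
    unfolding E_def d_def g_def by (rule br_assoc[OF fc])
  have "E * b - (q * q * \<gamma>' * \<phi>) \<cdot> (b * E) + (q * \<gamma>') \<cdot> (d * g) - (q * \<rho> * \<phi>) \<cdot> (g * d)
     = (q * \<gamma>') \<cdot> (br (q * \<phi>) d b * c) - (\<rho> * \<gamma>) \<cdot> (c * br (q * \<phi>) d b)
       + (1 - q * \<gamma> * \<gamma>') \<cdot> (d * c * b - (q * \<rho> * \<phi>) \<cdot> (b * c * d))"
    by (simp add: E_def g_def br_def sc_simps)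
  also have "\<dots> = 0" using fb g' by (simp add: d_def)
  finally have 1: "E * b - (q * q * \<gamma>' * \<phi>) \<cdot> (b * E) + (q * \<gamma>') \<cdot> (d * g) - (q * \<rho> * \<phi>) \<cdot> (g * d) = 0" .
  have "E * b - (\<gamma>' * \<phi>) \<cdot> (b * E) - \<gamma>' \<cdot> (d * g) + (\<phi> * \<rho>) \<cdot> (g * d)
     = (\<gamma>' * \<phi> * \<phi> * \<rho>) \<cdot> (br (q * \<gamma>) b g * f) - \<gamma>' \<cdot> (f * br (q * \<gamma>) b g)
       + (1 - q * \<gamma> * \<gamma>') \<cdot> (f * g * b - (\<phi> * \<phi> * \<rho>) \<cdot> (g * b * f))"
    by (simp add: E2 d_def br_def sc_simps)
  also have "\<dots> = 0" using bc g' by (simp add: g_def)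
  finally have 2: "E * b - (\<gamma>' * \<phi>) \<cdot> (b * E) - \<gamma>' \<cdot> (d * g) + (\<phi> * \<rho>) \<cdot> (g * d) = 0" .
  have "(1 + q) \<cdot> br (\<phi> * q * \<gamma>') E b
     = (E * b - (q * q * \<gamma>' * \<phi>) \<cdot> (b * E) + (q * \<gamma>') \<cdot> (d * g) - (q * \<rho> * \<phi>) \<cdot> (g * d))
     + q \<cdot> (E * b - (\<gamma>' * \<phi>) \<cdot> (b * E) - \<gamma>' \<cdot> (d * g) + (\<phi> * \<rho>) \<cdot> (g * d))"
    by (simp add: br_def sc_simps)
  then have "(1 + q) \<cdot> br (\<phi> * q * \<gamma>') E b = 0" by (simp only: 1 2) simp
  moreover have "1 + q \<noteq> 0" using q by (metis add_eq_0_iff)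
  ultimately show ?thesis unfolding E_def d_def by (blast intro: sc_cancel)
qed

text \<open>Mirror image of \<open>serre_chain_left\<close>, with the order of all factors reversed;
  it serves the second half of the words, where the letters descend.\<close>

lemma serre_chain_right:
  assumes bf: "br (q * \<phi>) b (br \<phi> b f) = 0" and cb: "br (q * \<gamma>) (br \<gamma> c b) b = 0"
    and cf: "br \<rho> c f = 0" and g': "q * \<gamma> * \<gamma>' = 1" and q: "q \<noteq> - 1"
  shows "br (\<phi> * q * \<gamma>') b (br (\<rho> * \<gamma>) c (br \<phi> b f)) = 0"
proof -
  define d g E where "d = br \<phi> b f" and "g = br \<gamma> c b" and "E = br (\<rho> * \<gamma>) c d"
  have E2: "E = br (\<rho> * \<phi>) g f"
    unfolding E_def d_def g_def using br_assoc[OF cf, of \<phi> \<gamma> b] by (simp add: mult.commute)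
  have "b * E - (q * q * \<gamma>' * \<phi>) \<cdot> (E * b) + (q * \<gamma>') \<cdot> (g * d) - (q * \<rho> * \<phi>) \<cdot> (d * g)
     = (q * \<gamma>') \<cdot> (c * br (q * \<phi>) b d) - (\<rho> * \<gamma>) \<cdot> (br (q * \<phi>) b d * c)
       + (1 - q * \<gamma> * \<gamma>') \<cdot> (b * c * d - (q * \<rho> * \<phi>) \<cdot> (d * c * b))"
    by (simp add: E_def g_def br_def sc_simps)
  also have "\<dots> = 0" using bf g' by (simp add: d_def)
  finally have 1: "b * E - (q * q * \<gamma>' * \<phi>) \<cdot> (E * b) + (q * \<gamma>') \<cdot> (g * d) - (q * \<rho> * \<phi>) \<cdot> (d * g) = 0" .
  have "b * E - (\<gamma>' * \<phi>) \<cdot> (E * b) - \<gamma>' \<cdot> (g * d) + (\<phi> * \<rho>) \<cdot> (d * g)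
     = (\<gamma>' * \<phi> * \<phi> * \<rho>) \<cdot> (f * br (q * \<gamma>) g b) - \<gamma>' \<cdot> (br (q * \<gamma>) g b * f)
       + (1 - q * \<gamma> * \<gamma>') \<cdot> (b * g * f - (\<phi> * \<phi> * \<rho>) \<cdot> (f * b * g))"
    by (simp add: E2 d_def br_def sc_simps)
  also have "\<dots> = 0" using cb g' by (simp add: g_def)
  finally have 2: "b * E - (\<gamma>' * \<phi>) \<cdot> (E * b) - \<gamma>' \<cdot> (g * d) + (\<phi> * \<rho>) \<cdot> (d * g) = 0" .
  have "(1 + q) \<cdot> br (\<phi> * q * \<gamma>') b E
     = (b * E - (q * q * \<gamma>' * \<phi>) \<cdot> (E * b) + (q * \<gamma>') \<cdot> (g * d) - (q * \<rho> * \<phi>) \<cdot> (d * g))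
     + q \<cdot> (b * E - (\<gamma>' * \<phi>) \<cdot> (E * b) - \<gamma>' \<cdot> (g * d) + (\<phi> * \<rho>) \<cdot> (d * g))"
    by (simp add: br_def sc_simps)
  then have "(1 + q) \<cdot> br (\<phi> * q * \<gamma>') b E = 0" by (simp only: 1 2) simp
  moreover have "1 + q \<noteq> 0" using q by (metis add_eq_0_iff)
  ultimately show ?thesis unfolding E_def d_def by (blast intro: sc_cancel)
qed

section \<open>Word identities behind the fold identity and the symmetry of u_k\<close>

text \<open>Meant for a = x_k, b = x_{k+1}, y = x_n with k + 2 = n. Put d = [b,a]. Since
  \<open>y\<close> and \<open>a\<close> skew commute, [[y,b],a] is a skew commutator of
  \<open>y\<close> with \<open>d\<close>; since \<open>b\<close> passes \<open>d\<close> by a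
  scalar, the outer bracket with \<open>b\<close> acts on \<open>y\<close> alone and turns it into
  [b,y].\<close>

lemma fold_core_base:
  assumes ya: "y * a = r \<cdot> (a * y)" and bd: "br (q * t) b (br t b a) = 0"
    and e: "e = q * c" and \<theta>: "\<theta> = q * t * r * P"
  shows "br c b y * br t b a - \<theta> \<cdot> (br t b a * br c b y) = br (e * t) b (br (t * r) (br P y b) a)"
proof -
  define d where "d = br t b a"
  have 1: "br (t * r) (br P y b) a = y * d - (P * r) \<cdot> (d * y) - P \<cdot> (b * (y * a - r \<cdot> (a * y)))
      + t \<cdot> ((y * a - r \<cdot> (a * y)) * b)"
    by (simp add: d_def br_def sc_simps)
  have "br (e * t) b (y * d - (P * r) \<cdot> (d * y)) - (br c b y * d - \<theta> \<cdot> (d * br c b y))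
      = c \<cdot> (y * br (q * t) b d) - (P * r) \<cdot> (br (q * t) b d * y)"
    unfolding d_def[symmetric] e \<theta>
    by (simp add: br_def sc_simps)
  then show ?thesis using 1 ya bd by (simp add: d_def)
qed

text \<open>Meant for a, b, c = x_k, x_{k+1}, x_{k+2}, with \<open>y\<close> = u_{k+2},
  \<open>w\<close> = L_{k+1} and \<open>w'\<close> = R_{k+1}; the last hypothesis is the fold
  identity for k + 1, rescaled by \<open>e\<close>. After expansion the two sides differ by
  multiples of the skew commutators of [b,a] with [b,c] and with [b,z], which vanish by
  \<open>dg\<close> and \<open>dh\<close>.\<close>

lemma fold_core_step:
  assumes za: "z * a = r1 \<cdot> (a * z)" and ca: "c * a = r2 \<cdot> (a * c)"
    and bd: "br (q * t) b (br t b a) = 0"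
    and dg: "(r2 * t) \<cdot> (br t b a * br \<beta>c b c) = \<beta>c \<cdot> (br \<beta>c b c * br t b a)"
    and dh: "(r1 * t) \<cdot> (br t b a * br \<beta>z b z) = \<beta>z \<cdot> (br \<beta>z b z * br t b a)"
    and e: "e = q * \<beta>z * \<beta>c"
    and y: "y = z * c - \<nu> \<cdot> (c * z)"
    and w: "w = br (\<beta>c * (q * \<nu>)) (br \<beta>z b z) c"
    and w': "e \<cdot> w' = w + e \<cdot> (y * b) - b * y"
  shows "e \<cdot> (w * br t b a) - (t * (r1 * r2)) \<cdot> (br t b a * w)
     = br (e * t) b (br (t * (r1 * r2)) (e \<cdot> w') a)"
proof -
  define d where "d = br t b a"
  \<comment> \<open>As \<open>a\<close> passes \<open>z\<close> and \<open>c\<close> by scalars,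
    bracketing \<open>w\<close> with \<open>a\<close> affects only the letter \<open>b\<close> in
    each word: it becomes d = [b,a], and the scalars come from the letters to the right of
    it.\<close>
  define W where "W = (r1 * r2) \<cdot> (d * z * c) - (\<beta>z * r2) \<cdot> (z * d * c)
     - (\<beta>c * (q * \<nu>) * r1) \<cdot> (c * d * z) + (\<beta>c * (q * \<nu>) * \<beta>z) \<cdot> (c * z * d)"
  have za': "z * (a * x) = r1 \<cdot> (a * (z * x))" and ca': "c * (a * x) = r2 \<cdot> (a * (c * x))" for x
    using za ca by (metis mult.assoc sc_mult_left)+
  have 1: "br (t * (r1 * r2)) w a = W"
    unfolding w W_def by (simp add: d_def br_def sc_simps za ca za' ca')
  have 2: "br (t * (r1 * r2)) (y * b) a = y * d"
    unfolding y by (simp add: d_def br_def sc_simps za ca za' ca')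
  have 3: "br (t * (r1 * r2)) (b * y) a = (r1 * r2) \<cdot> (d * y)"
    unfolding y by (simp add: d_def br_def sc_simps za ca za' ca')
  have 4: "br (t * (r1 * r2)) (e \<cdot> w') a = W + e \<cdot> (y * d) - (r1 * r2) \<cdot> (d * y)"
    unfolding w' 1[symmetric] 2[symmetric] 3[symmetric] by (simp add: br_def sc_simps)
  define Kg where "Kg = (r2 * t) \<cdot> (d * br \<beta>c b c) - \<beta>c \<cdot> (br \<beta>c b c * d)"
  define Kh where "Kh = (r1 * t) \<cdot> (d * br \<beta>z b z) - \<beta>z \<cdot> (br \<beta>z b z * d)"
  have K: "Kg = 0" "Kh = 0" using dg dh by (simp_all add: Kg_def Kh_def d_def)
  have bd: "b * d = (q * t) \<cdot> (d * b)" using bd by (simp add: br_zero_iff d_def)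
  then have bd': "b * (d * x) = (q * t) \<cdot> (d * (b * x))" for x
    by (metis mult.assoc sc_mult_left)
  have "br (e * t) b (W + e \<cdot> (y * d) - (r1 * r2) \<cdot> (d * y)) - (e \<cdot> (w * d) - (t * (r1 * r2)) \<cdot> (d * w))
     = (r1 * (q * \<nu>)) \<cdot> (Kg * z) + r2 \<cdot> (Kh * c)
       - (q * \<beta>z * \<beta>z) \<cdot> (z * Kg) - (q * \<beta>c * \<beta>c * (q * \<nu>)) \<cdot> (c * Kh)"
    unfolding W_def y w Kg_def Kh_def e by (simp add: br_def sc_simps bd bd')
  then show ?thesis using K 4 by (simp add: d_def)
qed

text \<open>With \<open>w\<close> = L_{k+1} and \<open>u\<close> = u_{k+1}, this trades the terms of
  the fold identity in u_{k+1} and L_k for a skew commutator of L_{k+1} with [x_{k+1}, x_k]. Each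
  scalar equation matches the coefficient of one of the words wab, bwa, baw, abw.\<close>

lemma fold_reduction:
  fixes a b w :: 'a and P :: 'k
  assumes "q * N * c1 = t" "q * N * (c1 * c2) = P" "q * N * c2 = \<theta>" "q * N * P = \<theta> * t"
  defines "u \<equiv> w * b - P \<cdot> (b * w)"
  shows "u * a - (q * N) \<cdot> (a * u) + (q * N) \<cdot> br c2 (br c1 a w) b
    = w * br t b a - \<theta> \<cdot> (br t b a * w)"
proof -
  have "u * a - (q * N) \<cdot> (a * u) + (q * N) \<cdot> br c2 (br c1 a w) b
     = (w * br t b a - \<theta> \<cdot> (br t b a * w)) - (q * N * c1 - t) \<cdot> (w * a * b)
      + (q * N * (c1 * c2) - P) \<cdot> (b * w * a) - (q * N * c2 - \<theta>) \<cdot> (b * a * w)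
      + (q * N * P - \<theta> * t) \<cdot> (a * b * w)"
    unfolding u_def by (simp add: br_def sc_simps)
  then show ?thesis using assms(1-4) by simp
qed

text \<open>Here \<open>W\<close> = L_k, \<open>W'\<close> = R_k and \<open>u\<close> = u_{k+1}, and
  the hypothesis on \<open>W'\<close> is the fold identity. After inserting it, the difference of
  the two sides is D a - q N a D with D = (1 + 1/q) W - (a u - N2 u a), so it suffices that
  \<open>a\<close> skew commutes with \<open>D\<close>.\<close>

lemma middle_step:
  fixes q P c1 c2 :: 'k and a b w :: 'a
  assumes ad: "br (q * s) a (br s a b) = 0" and ae: "br (q * c1) a (br c1 a w) = 0"
    and N2: "N2 = c1 * s" and c2: "c2 = s * q * P" and N: "q * q * N * N2 = 1" and q': "q * q' = 1"
  defines "u \<equiv> w * b - P \<cdot> (b * w)"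
  defines "W \<equiv> br c2 (br c1 a w) b"
  assumes W': "W' = (q * N) \<cdot> W + u * a - (q * N) \<cdot> (a * u)"
  shows "W * a - N \<cdot> (a * W) = a * W' - N2 \<cdot> (W' * a)"
proof -
  define d x where "d = br s a b" and "x = br c1 a w"
  \<comment> \<open>In this form every term of \<open>D\<close> contains [a,w] or [a,b]. The bracket
    of \<open>D\<close> with \<open>a\<close> is then a combination of the two Serre-type relations
    \<open>ad\<close> and \<open>ae\<close>.\<close>
  define D where "D = q' \<cdot> (x * b) - c2 \<cdot> (b * x) - c1 \<cdot> (w * d) + P \<cdot> (d * w)"
  have "(1 + q') \<cdot> W - (a * u - N2 \<cdot> (u * a)) = D
     + (s * P * (1 - q * q')) \<cdot> (b * a * w - c1 \<cdot> (b * w * a))"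
    unfolding D_def W_def u_def N2 c2 d_def x_def by (simp add: br_def sc_simps)
  then have D: "D = (1 + q') \<cdot> W - (a * u - N2 \<cdot> (u * a))" by (simp add: q')
  have "a * D - (q * s * c1) \<cdot> (D * a)
      = q' \<cdot> (br (q * c1) a x * b) - (c2 * s) \<cdot> (b * br (q * c1) a x)
        - (c1 * c1) \<cdot> (w * br (q * s) a d) + P \<cdot> (br (q * s) a d * w)
        + (q * q' - 1) \<cdot> (c1 \<cdot> (x * a * b) - (c1 * s) \<cdot> (x * b * a))"
    unfolding D_def c2 d_def x_def by (simp add: br_def sc_simps)
  then have aD: "a * D = (q * N2) \<cdot> (D * a)"
    using ad ae by (simp add: q' d_def x_def N2 mult.assoc mult.left_commute mult.commute)
  have "(q * N) \<cdot> (a * D) = D * a"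
    unfolding aD sc_sc using N by (simp add: sc_one mult.assoc mult.left_commute mult.commute)
  then have 1: "D * a - (q * N) \<cdot> (a * D) = 0" by simp
  have "q * (q * N * N2) = q * q'" using N q' by (simp add: mult.assoc)
  then have N': "q * N * N2 = q'" using q' by (metis mult_cancel_left mult_zero_left zero_neq_one)
  have "W * a - N \<cdot> (a * W) - (a * W' - N2 \<cdot> (W' * a)) = D * a - (q * N) \<cdot> (a * D)
      + (q * N * N2 - q') \<cdot> (W * a) + (N * (q * q' - 1)) \<cdot> (a * W)"
    unfolding D W' by (simp add: sc_simps)
  then show ?thesis using 1 N' q' by simp
qed

end

section \<open>Products of finitely supported functions\<close>

lemma lookup_smult: "Poly_Mapping.lookup (smult c f) a = c * Poly_Mapping.lookup f a"
  unfolding smult_def by (simp add: Poly_Mapping.map.rep_eq when_def)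

lemma smult_single: "smult c (Poly_Mapping.single a d) = Poly_Mapping.single a (c * d)"
  by (rule poly_mapping_eqI) (simp add: lookup_smult lookup_single when_def)

lemma smult_add_right: "smult c (f + g) = smult c f + smult c g"
  by (rule poly_mapping_eqI) (simp add: lookup_smult lookup_add distrib_left)

lemma smult_add_left: "smult (c + d) f = smult c f + smult d f"
  by (rule poly_mapping_eqI) (simp add: lookup_smult lookup_add distrib_right)

lemma smult_smult: "smult c (smult d f) = smult (c * d) f"
  by (rule poly_mapping_eqI) (simp add: lookup_smult mult.assoc)

lemma smult_one: "smult (1::'k::semiring_1) f = f"
  by (rule poly_mapping_eqI) (simp add: lookup_smult)

lemma smult_zero_right [simp]: "smult c 0 = 0"
  by (rule poly_mapping_eqI) (simp add: lookup_smult)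

lemma smult_zero_left [simp]: "smult 0 f = 0"
  by (rule poly_mapping_eqI) (simp add: lookup_smult)

lemma keys_smult: "Poly_Mapping.keys (smult c f) \<subseteq> Poly_Mapping.keys f"
  by (auto simp: in_keys_iff lookup_smult)

interpretation smult: vector_space "smult :: 'k::field \<Rightarrow> ('a \<Rightarrow>\<^sub>0 'k) \<Rightarrow> ('a \<Rightarrow>\<^sub>0 'k)"
  by unfold_locales (simp_all add: smult_add_right smult_add_left smult_smult smult_one)

lemma smult_sum: "smult (c::'k::field) (sum f S) = (\<Sum>x\<in>S. smult c (f x))"
  by (rule smult.scale_sum_right)

lemma poly_mapping_expand:
  "f = (\<Sum>a\<in>Poly_Mapping.keys f. Poly_Mapping.single a (Poly_Mapping.lookup f a))"
  by (rule poly_mapping_eqI)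
    (auto simp: lookup_sum lookup_single when_def in_keys_iff sum.delta' intro!: sym)

text \<open>The monomials are restricted to the support of \<open>f\<close>, so that conditions such
  as \<open>inA\<close> are available in the monomial case.\<close>

lemma poly_mapping_additive_induct:
  fixes f :: "'a \<Rightarrow>\<^sub>0 'b::comm_monoid_add"
  assumes "P 0" "\<And>a c. a \<in> Poly_Mapping.keys f \<Longrightarrow> P (Poly_Mapping.single a c)"
    and "\<And>g h. P g \<Longrightarrow> P h \<Longrightarrow> P (g + h)"
  shows "P f"
proof -
  have "P (\<Sum>a\<in>S. Poly_Mapping.single a (Poly_Mapping.lookup f a))" if "S \<subseteq> Poly_Mapping.keys f" for S
    using finite_subset[OF that finite_keys] that by (induction S rule: finite_induct) (auto intro: assms)
  then show ?thesis using poly_mapping_expand[of f] by (metis subset_refl)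
qed

lemma sum_keys_superset:
  assumes "finite S" "Poly_Mapping.keys f \<subseteq> S" "\<And>a. F a 0 = 0"
  shows "(\<Sum>a\<in>Poly_Mapping.keys f. F a (Poly_Mapping.lookup f a)) = (\<Sum>a\<in>S. F a (Poly_Mapping.lookup f a))"
  by (rule sum.mono_neutral_left) (use assms in \<open>auto simp: in_keys_iff\<close>)

text \<open>Common form of \<open>amul\<close>, \<open>tens\<close> and \<open>tmul\<close>: a
  product \<open>m\<close> of basis elements, twisted by a scalar \<open>w\<close>. Bilinearity and
  the bound on the support are proved once for all three.\<close>

definition bilin :: "('a \<Rightarrow> 'b \<Rightarrow> 'c) \<Rightarrow> ('a \<Rightarrow> 'b \<Rightarrow> 'k) \<Rightarrow> ('a \<Rightarrow>\<^sub>0 'k::field) \<Rightarrow> ('b \<Rightarrow>\<^sub>0 'k) \<Rightarrow> ('c \<Rightarrow>\<^sub>0 'k)" where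
  "bilin m w f h = (\<Sum>a\<in>Poly_Mapping.keys f. \<Sum>b\<in>Poly_Mapping.keys h.
      Poly_Mapping.single (m a b) (Poly_Mapping.lookup f a * Poly_Mapping.lookup h b * w a b))"

lemma bilin_superset:
  assumes "finite S" "Poly_Mapping.keys f \<subseteq> S" "finite T" "Poly_Mapping.keys h \<subseteq> T"
  shows "bilin m w f h = (\<Sum>a\<in>S. \<Sum>b\<in>T.
      Poly_Mapping.single (m a b) (Poly_Mapping.lookup f a * Poly_Mapping.lookup h b * w a b))"
proof -
  have "bilin m w f h = (\<Sum>a\<in>S. \<Sum>b\<in>Poly_Mapping.keys h.
      Poly_Mapping.single (m a b) (Poly_Mapping.lookup f a * Poly_Mapping.lookup h b * w a b))"
    unfolding bilin_def
    by (rule sum_keys_superset[OF assms(1,2),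
          of "\<lambda>a c. \<Sum>b\<in>Poly_Mapping.keys h. Poly_Mapping.single (m a b) (c * Poly_Mapping.lookup h b * w a b)"]) simp
  also have "\<dots> = (\<Sum>a\<in>S. \<Sum>b\<in>T.
      Poly_Mapping.single (m a b) (Poly_Mapping.lookup f a * Poly_Mapping.lookup h b * w a b))"
    by (intro sum.cong refl sum_keys_superset[OF assms(3,4),
          of "\<lambda>b c. Poly_Mapping.single (m _ b) (Poly_Mapping.lookup f _ * c * w _ b)"]) simp
  finally show ?thesis .
qed

lemma bilin_add_left: "bilin m w (f + g) h = bilin m w f h + bilin m w g h"
proof -
  let ?S = "Poly_Mapping.keys f \<union> Poly_Mapping.keys g"
  have "bilin m w x h = (\<Sum>a\<in>?S. \<Sum>b\<in>Poly_Mapping.keys h.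
      Poly_Mapping.single (m a b) (Poly_Mapping.lookup x a * Poly_Mapping.lookup h b * w a b))"
    if "x \<in> {f, g, f + g}" for x
    by (rule bilin_superset) (use that keys_add[of f g] in auto)
  then show ?thesis
    by (simp add: lookup_add distrib_right single_add sum.distrib)
qed

lemma bilin_add_right: "bilin m w h (f + g) = bilin m w h f + bilin m w h g"
proof -
  let ?S = "Poly_Mapping.keys f \<union> Poly_Mapping.keys g"
  have "bilin m w h x = (\<Sum>a\<in>Poly_Mapping.keys h. \<Sum>b\<in>?S.
      Poly_Mapping.single (m a b) (Poly_Mapping.lookup h a * Poly_Mapping.lookup x b * w a b))"
    if "x \<in> {f, g, f + g}" for x
    by (rule bilin_superset) (use that keys_add[of f g] in auto)
  then show ?thesis
    by (simp add: lookup_add distrib_left distrib_right single_add sum.distrib)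
qed

lemma bilin_smult_left: "bilin m w (smult c f) h = smult c (bilin m w f h)"
  by (subst bilin_superset[where S = "Poly_Mapping.keys f" and T = "Poly_Mapping.keys h"])
    (use keys_smult[of c f] in \<open>auto simp: bilin_def smult_sum smult_single lookup_smult mult_ac\<close>)

lemma bilin_smult_right: "bilin m w f (smult c h) = smult c (bilin m w f h)"
  by (subst bilin_superset[where S = "Poly_Mapping.keys f" and T = "Poly_Mapping.keys h"])
    (use keys_smult[of c h] in \<open>auto simp: bilin_def smult_sum smult_single lookup_smult mult_ac\<close>)

lemma bilin_zero [simp]: "bilin m w 0 h = 0" "bilin m w f 0 = 0"
  by (simp_all add: bilin_def)

lemma bilin_single:
  "bilin m w (Poly_Mapping.single a c) (Poly_Mapping.single b d) = Poly_Mapping.single (m a b) (c * d * w a b)"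
  by (subst bilin_superset[of "{a}" _ "{b}"]) auto

lemma keys_bilin:
  "Poly_Mapping.keys (bilin m w f h) \<subseteq> {m a b | a b. a \<in> Poly_Mapping.keys f \<and> b \<in> Poly_Mapping.keys h}"
proof -
  have "x \<in> {m a b | a b. a \<in> Poly_Mapping.keys f \<and> b \<in> Poly_Mapping.keys h}"
    if "Poly_Mapping.lookup (bilin m w f h) x \<noteq> 0" for x
    using that unfolding bilin_def lookup_sum
    by (auto simp: lookup_single when_def elim!: sum.not_neutral_contains_not_neutral split: if_splits) blast
  then show ?thesis by (auto simp: in_keys_iff)
qed

text \<open>The condition on the twists is demanded on the supports only, because the characters are
  multiplicative for the letters 1..n and arbitrary elsewhere.\<close>

lemma bilin_assoc:
  assumes "\<And>a b c. a \<in> Poly_Mapping.keys f \<Longrightarrow> b \<in> Poly_Mapping.keys g \<Longrightarrow> c \<in> Poly_Mapping.keys h \<Longrightarrow>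
      m1 (m2 a b) c = m3 a (m4 b c) \<and> w2 a b * w1 (m2 a b) c = w4 b c * w3 a (m4 b c)"
  shows "bilin m1 w1 (bilin m2 w2 f g) h = bilin m3 w3 f (bilin m4 w4 g h)"
proof (induction f rule: poly_mapping_additive_induct)
  case fa: (2 a x)
  show ?case
  proof (induction g rule: poly_mapping_additive_induct)
    case gb: (2 b y)
    show ?case
    proof (induction h rule: poly_mapping_additive_induct)
      case (2 c z)
      with fa gb have *: "m1 (m2 a b) c = m3 a (m4 b c)" "w2 a b * w1 (m2 a b) c = w4 b c * w3 a (m4 b c)"
        using assms by blast+
      have "x * y * w2 a b * z * w1 (m2 a b) c = x * y * z * (w2 a b * w1 (m2 a b) c)"
        by (simp add: mult_ac)
      also have "\<dots> = x * (y * z * w4 b c) * w3 a (m4 b c)"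
        unfolding * by (simp add: mult_ac)
      finally show ?case by (simp only: bilin_single *(1))
    qed (simp_all add: bilin_add_right)
  qed (simp_all add: bilin_add_right bilin_add_left)
qed (simp_all add: bilin_add_left)

section \<open>The skew group algebra, its tensor square and the coproduct\<close>

lemma amul_bilin: "amul chi = bilin (\<lambda>a b. (fst a + fst b, snd a @ snd b)) (\<lambda>a b. chiw chi (snd a) (fst b))"
  unfolding amul_def bilin_def by (intro ext) simp

lemma tens_bilin: "tens = bilin Pair (\<lambda>a b. 1)"
  unfolding tens_def bilin_def by (intro ext) simp

lemma tmul_bilin: "tmul chi = bilin
    (\<lambda>a b. ((fst (fst a) + fst (fst b), snd (fst a) @ snd (fst b)), (fst (snd a) + fst (snd b), snd (snd a) @ snd (snd b))))
    (\<lambda>a b. chiw chi (snd (fst a)) (fst (fst b)) * chiw chi (snd (snd a)) (fst (snd b)))"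
  unfolding tmul_def bilin_def by (intro ext) (simp add: mult.assoc)

lemma product_add:
  "amul chi (f + g) h = amul chi f h + amul chi g h" "amul chi h (f + g) = amul chi h f + amul chi h g"
  "tens (f + g) h = tens f h + tens g h" "tens h (f + g) = tens h f + tens h g"
  "tmul chi (F + G) H = tmul chi F H + tmul chi G H" "tmul chi H (F + G) = tmul chi H F + tmul chi H G"
  by (simp_all only: amul_bilin tens_bilin tmul_bilin bilin_add_left bilin_add_right)

lemma product_smult:
  "amul chi (smult c f) h = smult c (amul chi f h)" "amul chi f (smult c h) = smult c (amul chi f h)"
  "tens (smult c f) h = smult c (tens f h)" "tens f (smult c h) = smult c (tens f h)"
  "tmul chi (smult c F) H = smult c (tmul chi F H)" "tmul chi F (smult c H) = smult c (tmul chi F H)"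
  by (simp_all only: amul_bilin tens_bilin tmul_bilin bilin_smult_left bilin_smult_right)

lemma product_zero [simp]:
  "amul chi 0 h = 0" "amul chi h 0 = 0" "tens 0 h = 0" "tens h 0 = 0" "tmul chi 0 H = 0" "tmul chi H 0 = 0"
  by (simp_all only: amul_bilin tens_bilin tmul_bilin bilin_zero)

lemma product_diff:
  "amul chi (f - g) h = amul chi f h - amul chi g h" "amul chi h (f - g) = amul chi h f - amul chi h g"
  "tens (f - g) h = tens f h - tens g h" "tens h (f - g) = tens h f - tens h g"
  "tmul chi (F - G) H = tmul chi F H - tmul chi G H" "tmul chi H (F - G) = tmul chi H F - tmul chi H G"
  by (rule eq_diff_eq[THEN iffD2], simp flip: product_add)+

lemma tmul_sum:
  "tmul chi (sum F S) H = (\<Sum>i\<in>S. tmul chi (F i) H)" "tmul chi H (sum F S) = (\<Sum>i\<in>S. tmul chi H (F i))"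
  by (induction S rule: infinite_finite_induct) (simp_all add: product_add)

lemma product_single:
  "amul chi (Poly_Mapping.single a c) (Poly_Mapping.single b d)
     = Poly_Mapping.single (fst a + fst b, snd a @ snd b) (c * d * chiw chi (snd a) (fst b))"
  "tens (Poly_Mapping.single a c) (Poly_Mapping.single b d) = Poly_Mapping.single (a, b) (c * d)"
  by (simp_all add: amul_bilin tens_bilin bilin_single)

lemma tmul_single:
  "tmul chi (Poly_Mapping.single (a, b) c) (Poly_Mapping.single (a', b') d)
     = Poly_Mapping.single ((fst a + fst a', snd a @ snd a'), (fst b + fst b', snd b @ snd b'))
         (c * d * (chiw chi (snd a) (fst a') * chiw chi (snd b) (fst b')))"
  by (simp add: tmul_bilin bilin_single)

lemma tmul_tens: "tmul chi (tens a b) (tens c d) = tens (amul chi a c) (amul chi b d)"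
proof (induction a rule: poly_mapping_additive_induct)
  case (2 a x)
  show ?case
  proof (induction b rule: poly_mapping_additive_induct)
    case (2 b y)
    show ?case
    proof (induction c rule: poly_mapping_additive_induct)
      case (2 c z)
      show ?case
        by (induction d rule: poly_mapping_additive_induct)
          (simp_all add: product_single tmul_single mult_ac product_add)
    qed (simp_all add: product_add)
  qed (simp_all add: product_add)
qed (simp_all add: product_add)

lemma Delta_add: "Delta chi gg (f + g) = Delta chi gg f + Delta chi gg g"
  unfolding Delta_def by (rule setsum_keys_plus_distrib) (simp_all add: smult_add_left)

lemma Delta_smult: "Delta chi gg (smult c f) = smult c (Delta chi gg f)"
proof -
  have "Delta chi gg (smult c f) = (\<Sum>a\<in>Poly_Mapping.keys f.
      smult (Poly_Mapping.lookup (smult c f) a) (delta_basis chi gg a))"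
    unfolding Delta_def
    by (rule sum_keys_superset[of _ _ "\<lambda>a x. smult x (delta_basis chi gg a)"]) (simp_all add: keys_smult)
  then show ?thesis by (simp add: Delta_def lookup_smult smult_sum smult_smult)
qed

lemma Delta_zero [simp]: "Delta chi gg 0 = 0"
  by (simp add: Delta_def)

lemma Delta_diff: "Delta chi gg (f - g) = Delta chi gg f - Delta chi gg g"
  by (rule eq_diff_eq[THEN iffD2]) (simp flip: Delta_add)

lemma Delta_single: "Delta chi gg (Poly_Mapping.single a c) = smult c (delta_basis chi gg a)"
  by (simp add: Delta_def)

lemma chiw_Nil [simp]: "chiw chi [] g = 1" and chiw_append: "chiw chi (u @ v) g = chiw chi u g * chiw chi v g"
  and chiw_single [simp]: "chiw chi [i] g = chi i g"
  by (simp_all add: chiw_def)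

lemma gw_Nil [simp]: "gw gg [] = 0" and gw_append: "gw gg (u @ v) = gw gg u + gw gg v"
  and gw_single [simp]: "gw gg [i] = gg i"
  by (simp_all add: gw_def)

lemma amul_one_left [simp]: "amul chi one f = f"
  by (induction f rule: poly_mapping_additive_induct) (simp_all add: one_def grp_def product_single product_add)

lemma inA_zero [simp]: "inA n 0" and inA_one [simp]: "inA n one" and inA_grp [simp]: "inA n (grp g)"
  and inA_gen: "i \<in> {1..n} \<Longrightarrow> inA n (gen i)"
  by (simp_all add: inA_def one_def grp_def gen_def)

lemma inA_add: "inA n f \<Longrightarrow> inA n g \<Longrightarrow> inA n (f + g)"
  unfolding inA_def using keys_add[of f g] by blast

lemma inA_smult: "inA n f \<Longrightarrow> inA n (smult c f)"
  unfolding inA_def using keys_smult[of c f] by blast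

lemma inA_diff: "inA n f \<Longrightarrow> inA n g \<Longrightarrow> inA n (f - (g :: ('g, 'k::field) alg))"
  unfolding inA_def using keys_diff[of f g] by blast

lemma inA_amul: "inA n f \<Longrightarrow> inA n g \<Longrightarrow> inA n (amul chi f g)"
  unfolding inA_def amul_bilin
  using keys_bilin[of "\<lambda>a b. (fst a + fst b, snd a @ snd b)" "\<lambda>a b. chiw chi (snd a) (fst b)" f g]
  by fastforce

lemma inA_sbr: "inA n f \<Longrightarrow> inA n g \<Longrightarrow> inA n (sbr chi gg u f v g)"
  by (simp add: sbr_def inA_diff inA_smult inA_amul)

text \<open>Elements of the free algebra itself, without group part. For them a letter may be
  multiplied on the left without first being moved past a group element, which keeps the coproduct
  of such a product simple.\<close>

definition wordy :: "nat \<Rightarrow> ('g::ab_group_add, 'k::zero) alg \<Rightarrow> bool" where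
  "wordy n f \<longleftrightarrow> (\<forall>a\<in>Poly_Mapping.keys f. fst a = 0 \<and> set (snd a) \<subseteq> {1..n})"

lemma wordy_inA: "wordy n f \<Longrightarrow> inA n f"
  by (auto simp: wordy_def inA_def)

lemma wordy_gen: "i \<in> {1..n} \<Longrightarrow> wordy n (gen i)"
  by (simp add: wordy_def gen_def)

lemma wordy_smult: "wordy n f \<Longrightarrow> wordy n (smult c f)"
  unfolding wordy_def using keys_smult[of c f] by blast

lemma wordy_diff: "wordy n f \<Longrightarrow> wordy n g \<Longrightarrow> wordy n (f - (g :: ('g::ab_group_add, 'k::field) alg))"
  unfolding wordy_def using keys_diff[of f g] by blast

lemma wordy_amul: "wordy n f \<Longrightarrow> wordy n g \<Longrightarrow> wordy n (amul chi f g)"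
  unfolding wordy_def amul_bilin
  using keys_bilin[of "\<lambda>a b. (fst a + fst b, snd a @ snd b)" "\<lambda>a b. chiw chi (snd a) (fst b)" f g]
  by fastforce

lemma wordy_sbr: "wordy n f \<Longrightarrow> wordy n g \<Longrightarrow> wordy n (sbr chi gg u f v g)"
  by (simp add: sbr_def wordy_diff wordy_smult wordy_amul)

section \<open>Linear endomorphisms as a ring, and linear projections\<close>

typedef (overloaded) ('a, 'k) endo =
  "{F :: ('a \<Rightarrow>\<^sub>0 'k::field) \<Rightarrow> ('a \<Rightarrow>\<^sub>0 'k).
     (\<forall>x y. F (x + y) = F x + F y) \<and> (\<forall>c x. F (smult c x) = smult c (F x))}"
  by (rule exI[of _ "\<lambda>_. 0"]) simp

setup_lifting type_definition_endo

instantiation endo :: (type, field) ring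
begin

lift_definition zero_endo :: "('a, 'b) endo" is "\<lambda>_. 0" by simp
lift_definition plus_endo :: "('a, 'b) endo \<Rightarrow> ('a, 'b) endo \<Rightarrow> ('a, 'b) endo" is "\<lambda>F G x. F x + G x"
  by (simp add: smult_add_right)
lift_definition minus_endo :: "('a, 'b) endo \<Rightarrow> ('a, 'b) endo \<Rightarrow> ('a, 'b) endo" is "\<lambda>F G x. F x - G x"
  by (simp add: smult.scale_right_diff_distrib)
lift_definition uminus_endo :: "('a, 'b) endo \<Rightarrow> ('a, 'b) endo" is "\<lambda>F x. - F x"
  by simp
lift_definition times_endo :: "('a, 'b) endo \<Rightarrow> ('a, 'b) endo \<Rightarrow> ('a, 'b) endo" is "\<lambda>F G x. F (G x)"
  by simp

instance
  by standard (transfer; force simp: algebra_simps)+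

end

lift_definition endo_scale :: "'k::field \<Rightarrow> ('a, 'k) endo \<Rightarrow> ('a, 'k) endo" is "\<lambda>c F x. smult c (F x)"
  by (simp add: smult_add_right smult_smult mult.commute)

interpretation endo: skew_algebra "endo_scale :: 'k::field \<Rightarrow> ('a, 'k) endo \<Rightarrow> ('a, 'k) endo"
  by unfold_locales (transfer; simp add: smult_add_right smult_add_left smult_smult smult_one fun_eq_iff)+

definition is_projection :: "('a \<Rightarrow>\<^sub>0 'k::field) set \<Rightarrow> (('a \<Rightarrow>\<^sub>0 'k) \<Rightarrow> ('a \<Rightarrow>\<^sub>0 'k)) \<Rightarrow> bool" where
  "is_projection V F \<longleftrightarrow> Vector_Spaces.linear smult smult F \<and> (\<forall>x. F x \<in> V) \<and> (\<forall>x\<in>V. F x = x)"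

definition projection :: "('a \<Rightarrow>\<^sub>0 'k::field) set \<Rightarrow> ('a \<Rightarrow>\<^sub>0 'k) \<Rightarrow> ('a \<Rightarrow>\<^sub>0 'k)" where
  "projection V = (SOME F. is_projection V F)"

lemma is_projection_projection:
  fixes V :: "('a \<Rightarrow>\<^sub>0 'b::field) set"
  assumes "smult.subspace V"
  shows "is_projection V (projection V)"
proof -
  interpret vector_space_pair "smult :: 'b \<Rightarrow> ('a \<Rightarrow>\<^sub>0 'b) \<Rightarrow> _" "smult :: 'b \<Rightarrow> ('a \<Rightarrow>\<^sub>0 'b) \<Rightarrow> _"
    by unfold_locales
  have "Vector_Spaces.linear smult smult (\<lambda>x :: 'a \<Rightarrow>\<^sub>0 'b. x)" by unfold_locales simp_all
  from linear_exists_left_inverse_on[OF this assms] have "\<exists>F. is_projection V F"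
    by (auto simp: is_projection_def)
  then show ?thesis unfolding projection_def by (rule someI_ex)
qed

section \<open>The quotient algebra\<close>

locale uq_sp =
  fixes chi :: "nat \<Rightarrow> 'g::ab_group_add \<Rightarrow> 'k::field"
    and gg :: "nat \<Rightarrow> 'g"
    and n :: nat
    and q :: 'k
  assumes n2: "n \<ge> 2"
    and chi_hom: "\<forall>i\<in>{1..n}. \<forall>a b. chi i (a + b) = chi i a * chi i b"
    and chi_nz: "\<forall>i\<in>{1..n}. \<forall>a. chi i a \<noteq> 0"
    and q_nz: "q \<noteq> 0" and qm1: "q \<noteq> - 1"
    and p_ii: "\<forall>i. 1 \<le> i \<and> i < n \<longrightarrow> chi i (gg i) = q"
    and p_nn: "chi n (gg n) = q ^ 2"
    and p_adj: "\<forall>i. 1 < i \<and> i < n \<longrightarrow> chi i (gg (i - 1)) * chi (i - 1) (gg i) = inverse q"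
    and p_last: "chi (n - 1) (gg n) * chi n (gg (n - 1)) = inverse (q ^ 2)"
    and p_far: "\<forall>i j. 1 \<le> i \<and> i + 1 < j \<and> j \<le> n \<longrightarrow> chi i (gg j) * chi j (gg i) = 1"
begin

abbreviation mul (infixl "\<star>" 70) where "mul \<equiv> amul chi"
abbreviation p where "p \<equiv> pw chi gg"
abbreviation I where "I \<equiv> Iq chi gg n"
abbreviation T where "T \<equiv> tideal n I"

lemma chi_zero:
  assumes "i \<in> {1..n}"
  shows "chi i 0 = 1"
proof -
  have "chi i 0 * chi i 0 = chi i (0 + 0)" by (simp only: chi_hom[rule_format, OF assms])
  moreover have "chi i 0 \<noteq> 0" using chi_nz assms by blast
  ultimately show ?thesis by simp
qed

lemma chiw_add: "set u \<subseteq> {1..n} \<Longrightarrow> chiw chi u (a + b) = chiw chi u a * chiw chi u b"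
  using chi_hom by (induction u) (auto simp: chiw_def mult_ac)

lemma chiw_zero: "set u \<subseteq> {1..n} \<Longrightarrow> chiw chi u 0 = 1"
  using chi_zero by (induction u) (auto simp: chiw_def)

lemma p_append_left: "p (u @ v) w = p u w * p v w"
  by (simp add: pw_def chiw_append)

lemma p_append_right: "set u \<subseteq> {1..n} \<Longrightarrow> p u (v @ w) = p u v * p u w"
  by (simp add: pw_def gw_append chiw_add)

lemma amul_assoc: "inA n f \<Longrightarrow> (f \<star> g) \<star> h = f \<star> (g \<star> h)"
  unfolding amul_bilin by (rule bilin_assoc) (auto simp: inA_def chiw_add chiw_append add.assoc mult_ac)

lemma amul_one_right:
  assumes "inA n f"
  shows "f \<star> one = f"
  by (induction f rule: poly_mapping_additive_induct)
    (use assms in \<open>auto simp: one_def grp_def product_single product_add inA_def chiw_zero\<close>)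

lemma rels_inA: "r \<in> rels chi gg n \<Longrightarrow> inA n r"
  unfolding rels_def using n2 by (auto intro!: inA_sbr inA_gen)

lemma I_inA: "x \<in> I \<Longrightarrow> inA n x"
  unfolding Iq_def by (induction rule: ideal_gen.induct) (auto intro: inA_amul rels_inA inA_add)

lemma I_zero: "0 \<in> I" and I_add: "x \<in> I \<Longrightarrow> y \<in> I \<Longrightarrow> x + y \<in> I"
  unfolding Iq_def by (auto intro: ideal_gen.intros)

lemma I_smult: "x \<in> I \<Longrightarrow> smult c x \<in> I"
  unfolding Iq_def
proof (induction rule: ideal_gen.induct)
  case (gen r a b)
  then show ?case
    using ideal_gen.gen[of r _ n "smult c a" b chi] by (simp add: product_smult inA_smult)
qed (auto intro: ideal_gen.intros simp: smult_add_right)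

lemma I_left: "x \<in> I \<Longrightarrow> inA n a \<Longrightarrow> a \<star> x \<in> I"
  unfolding Iq_def
proof (induction rule: ideal_gen.induct)
  case (gen r b c)
  then have "a \<star> ((b \<star> r) \<star> c) = ((a \<star> b) \<star> r) \<star> c"
    by (simp add: amul_assoc inA_amul rels_inA)
  with gen show ?case by (auto intro: ideal_gen.gen inA_amul)
qed (auto intro: ideal_gen.intros simp: product_add)

lemma I_right: "x \<in> I \<Longrightarrow> inA n a \<Longrightarrow> x \<star> a \<in> I"
  unfolding Iq_def
proof (induction rule: ideal_gen.induct)
  case (gen r b c)
  then have "((b \<star> r) \<star> c) \<star> a = (b \<star> r) \<star> (c \<star> a)"
    by (simp add: amul_assoc inA_amul rels_inA)
  with gen show ?case by (auto intro: ideal_gen.gen inA_amul)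
qed (auto intro: ideal_gen.intros simp: product_add)

lemma rels_I: "r \<in> rels chi gg n \<Longrightarrow> r \<in> I"
  unfolding Iq_def using ideal_gen.gen[of r _ n one one chi] by (simp add: amul_one_right rels_inA)

text \<open>The quotient by \<open>I\<close> is realised inside the ring of linear endomorphisms: \<open>a\<close> acts on a
  linear complement of \<open>I\<close> in \<open>inA n\<close> by multiplication followed by projection along \<open>I\<close>.\<close>

abbreviation pr_A where "pr_A \<equiv> projection {x :: ('g, 'k) alg. inA n x}"

abbreviation pr_I where "pr_I \<equiv> projection I"

lemma pr_A: "Vector_Spaces.linear smult smult pr_A" "inA n (pr_A x)" "inA n x \<Longrightarrow> pr_A x = x"
proof -
  have "smult.subspace {x :: ('g, 'k) alg. inA n x}"
    by (auto simp: smult.subspace_def inA_add inA_smult)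
  from is_projection_projection[OF this]
  show "Vector_Spaces.linear smult smult pr_A" "inA n (pr_A x)" "inA n x \<Longrightarrow> pr_A x = x"
    by (auto simp: is_projection_def)
qed

lemma pr_I: "Vector_Spaces.linear smult smult pr_I" "pr_I x \<in> I" "x \<in> I \<Longrightarrow> pr_I x = x"
proof -
  have "smult.subspace I"
    by (auto simp: smult.subspace_def I_zero I_add I_smult)
  from is_projection_projection[OF this]
  show "Vector_Spaces.linear smult smult pr_I" "pr_I x \<in> I" "x \<in> I \<Longrightarrow> pr_I x = x"
    by (auto simp: is_projection_def)
qed

interpretation pr_A: Vector_Spaces.linear smult smult pr_A by (rule pr_A)
interpretation pr_I: Vector_Spaces.linear smult smult pr_I by (rule pr_I)

lift_definition quot :: "('g, 'k) alg \<Rightarrow> ('g \<times> nat list, 'k) endo" is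
  "\<lambda>f x. f \<star> pr_A x - pr_I (f \<star> pr_A x)"
  by (auto simp: pr_A.add pr_I.add pr_A.scale pr_I.scale product_add product_smult smult.scale_right_diff_distrib)

lemma quot_diff: "quot (f - g) = quot f - quot g"
  by transfer (auto simp: product_diff pr_I.diff)

lemma quot_smult: "quot (smult c f) = endo_scale c (quot f)"
  by transfer (auto simp: product_smult pr_I.scale smult.scale_right_diff_distrib)

lemma quot_amul:
  assumes f: "inA n f" and g: "inA n g"
  shows "quot (f \<star> g) = quot f * quot g"
proof -
  have "f \<star> g \<star> pr_A x - pr_I (f \<star> g \<star> pr_A x) =
     f \<star> pr_A (g \<star> pr_A x - pr_I (g \<star> pr_A x)) - pr_I (f \<star> pr_A (g \<star> pr_A x - pr_I (g \<star> pr_A x)))" for x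
  proof -
    define z where "z = g \<star> pr_A x"
    have z: "inA n z" using pr_A g by (simp add: z_def inA_amul)
    have 1: "pr_A (z - pr_I z) = z - pr_I z" using pr_A pr_I I_inA z by (simp add: inA_diff)
    \<comment> \<open>The part of \<open>z\<close> removed by the inner projection stays in the
      ideal after multiplication by \<open>f\<close>; \<open>pr_I\<close> fixes it, so it drops out
      of the outer difference.\<close>
    have "f \<star> pr_I z \<in> I" using pr_I f by (simp add: I_left)
    then have 2: "pr_I (f \<star> pr_I z) = f \<star> pr_I z" using pr_I by blast
    show ?thesis using 1 2 f by (simp add: product_diff pr_I.diff amul_assoc flip: z_def)
  qed
  then show ?thesis by transfer auto
qed

text \<open>The representation has kernel exactly \<open>I\<close>: evaluation at \<open>one\<close>
  recovers \<open>f\<close> modulo the ideal. Hence equations between operators can be turned back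
  into membership in \<open>I\<close>.\<close>

lemma quot_eq_0_iff:
  assumes f: "inA n f"
  shows "quot f = 0 \<longleftrightarrow> f \<in> I"
proof
  assume "quot f = 0"
  then have "Rep_endo (quot f) one = 0" by (simp add: zero_endo.rep_eq)
  then have "f \<star> pr_A one - pr_I (f \<star> pr_A one) = 0" by (simp add: quot.rep_eq)
  moreover have "pr_A one = one" using pr_A by simp
  ultimately have "f = pr_I f" using f by (simp add: amul_one_right)
  then show "f \<in> I" using pr_I by metis
next
  assume "f \<in> I"
  then have "f \<star> pr_A x - pr_I (f \<star> pr_A x) = 0" for x
    using pr_A pr_I I_right by simp
  then show "quot f = 0" by transfer auto
qed

lemma quot_eq_iff: "inA n f \<Longrightarrow> inA n g \<Longrightarrow> quot f = quot g \<longleftrightarrow> f - g \<in> I"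
  using quot_eq_0_iff[of "f - g"] by (simp add: inA_diff quot_diff)

section \<open>Congruence in the tensor square\<close>

lemma T_zero: "0 \<in> T" and T_add: "X \<in> T \<Longrightarrow> Y \<in> T \<Longrightarrow> X + Y \<in> T"
  by (auto intro: tideal.intros)

lemma T_smult: "X \<in> T \<Longrightarrow> smult c X \<in> T"
proof (induction rule: tideal.induct)
  case (left x a)
  then show ?case using tideal.left[of "smult c x" I n a] by (simp add: product_smult I_smult)
next
  case (right x a)
  then show ?case using tideal.right[of "smult c x" I n a] by (simp add: product_smult I_smult)
qed (auto intro: tideal.intros simp: smult_add_right)

lemma T_diff: "X \<in> T \<Longrightarrow> Y \<in> T \<Longrightarrow> X - Y \<in> T"
  using T_add[of X "smult (- 1) Y"] T_smult[of Y "- 1"] by simp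

lemma T_tmul_left: "X \<in> T \<Longrightarrow> inA n a \<Longrightarrow> inA n b \<Longrightarrow> tmul chi (tens a b) X \<in> T"
  by (induction rule: tideal.induct)
    (auto intro: tideal.intros simp: product_add tmul_tens I_left inA_amul)

lemma T_tmul_right: "X \<in> T \<Longrightarrow> inA n a \<Longrightarrow> inA n b \<Longrightarrow> tmul chi X (tens a b) \<in> T"
  by (induction rule: tideal.induct)
    (auto intro: tideal.intros simp: product_add tmul_tens I_right inA_amul)

definition teq (infix "\<approx>" 50) where "X \<approx> Y \<longleftrightarrow> X - Y \<in> T"

lemma teq_refl [simp]: "X \<approx> X" by (simp add: teq_def T_zero)

lemma teq_trans [trans]: "X \<approx> Y \<Longrightarrow> Y \<approx> Z \<Longrightarrow> X \<approx> Z"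
  unfolding teq_def using T_add[of "X - Y" "Y - Z"] by simp

lemma teq_add: "X \<approx> X' \<Longrightarrow> Y \<approx> Y' \<Longrightarrow> X + Y \<approx> X' + Y'"
  unfolding teq_def using T_add[of "X - X'" "Y - Y'"] by (simp add: algebra_simps)

lemma teq_diff: "X \<approx> X' \<Longrightarrow> Y \<approx> Y' \<Longrightarrow> X - Y \<approx> X' - Y'"
  unfolding teq_def using T_diff[of "X - X'" "Y - Y'"] by (simp add: algebra_simps)

lemma teq_smult: "X \<approx> Y \<Longrightarrow> smult c X \<approx> smult c Y"
  unfolding teq_def using T_smult[of "X - Y" c] by (simp add: smult.scale_right_diff_distrib)

lemma teq_sum: "(\<And>i. i \<in> S \<Longrightarrow> X i \<approx> Y i) \<Longrightarrow> sum X S \<approx> sum Y S"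
  by (induction S rule: infinite_finite_induct) (auto intro: teq_add)

text \<open>The bridge from the operator ring to the tensor square: every bracket computed in the
  quotient enters the coproduct through this congruence.\<close>

lemma teq_tens:
  assumes "quot a = quot a'" "quot b = quot b'" "inA n a" "inA n a'" "inA n b" "inA n b'"
  shows "tens a b \<approx> tens a' b'"
proof -
  have "tens a b - tens a' b' = tens (a - a') b + tens a' (b - b')"
    by (simp add: product_diff)
  then show ?thesis
    using assms unfolding teq_def by (auto simp: quot_eq_iff intro: tideal.intros)
qed

lemma teq_tmul:
  assumes "X \<approx> Y" "inA n a" "inA n b"
  shows "tmul chi X (tens a b) \<approx> tmul chi Y (tens a b)" "tmul chi (tens a b) X \<approx> tmul chi (tens a b) Y"
  using assms unfolding teq_def by (simp_all add: T_tmul_left T_tmul_right flip: product_diff)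

end

section \<open>Brackets of the elements $v[k,m]$ with letters\<close>

lemma vw_Nil: "m < k \<Longrightarrow> vw n k m = []"
  by (simp add: vw_def)

lemma vw_single: "vw n k k = [idx n k]"
  by (simp add: vw_def)

lemma vw_append: "k \<le> Suc i \<Longrightarrow> i \<le> m \<Longrightarrow> vw n k m = vw n k i @ vw n (Suc i) m"
  unfolding vw_def map_append[symmetric] using upt_add_eq_append[of k "Suc i" "m - i"] by simp

lemma vw_snoc: "k \<le> m \<Longrightarrow> 0 < m \<Longrightarrow> vw n k m = vw n k (m - 1) @ [idx n m]"
  using vw_append[of k "m - 1" m n] by (simp add: vw_single)

lemma vw_Cons: "k \<le> m \<Longrightarrow> vw n k m = [idx n k] @ vw n (Suc k) m"
  using vw_append[of k k m n] by (simp add: vw_single)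

lemma vw_pair: "vw n k (Suc k) = [idx n k, idx n (Suc k)]"
  using vw_Cons[of k "Suc k" n] by (simp add: vw_single)

lemma idx_range: "1 \<le> i \<Longrightarrow> i < 2 * n \<Longrightarrow> idx n i \<in> {1..n}"
  by (auto simp: idx_def)

lemma set_vw: "1 \<le> k \<Longrightarrow> m < 2 * n \<Longrightarrow> set (vw n k m) \<subseteq> {1..n}"
  by (auto simp: vw_def idx_def)

lemma vb_single: "vb chi gg n q k k = gen (idx n k)"
  by (simp add: vb_def)

declare lnorm.simps [simp del] rnorm.simps [simp del]

lemma vb_left:
  assumes "k < m" "m < 2 * n - k"
  shows "vb chi gg n q k m = sbr chi gg (vw n k (m - 1)) (vb chi gg n q k (m - 1)) [idx n m] (gen (idx n m))"
proof -
  have "lnorm chi gg n k (m - 1) = vb chi gg n q k (m - 1)"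
    using assms by (auto simp: vb_def lnorm.simps[of chi gg n k k])
  then show ?thesis using assms by (simp add: vb_def lnorm.simps[of chi gg n k m])
qed

lemma vb_right:
  assumes "k < m" "2 * n - k < m"
  shows "vb chi gg n q k m = sbr chi gg [idx n k] (gen (idx n k)) (vw n (Suc k) m) (vb chi gg n q (Suc k) m)"
proof -
  have "rnorm chi gg n (Suc k) m = vb chi gg n q (Suc k) m"
    using assms by (auto simp: vb_def rnorm.simps[of chi gg n "Suc k" "Suc k"])
  then show ?thesis using assms by (simp add: vb_def rnorm.simps[of chi gg n k m])
qed

lemma vb_middle:
  assumes "k < m" "m = 2 * n - k"
  shows "vb chi gg n q k m = amul chi (vb chi gg n q k (m - 1)) (gen (idx n m))
     - smult (inverse q * pw chi gg (vw n k (m - 1)) [idx n m]) (amul chi (gen (idx n m)) (vb chi gg n q k (m - 1)))"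
proof -
  have "lnorm chi gg n k (m - 1) = vb chi gg n q k (m - 1)"
    using assms by (auto simp: vb_def lnorm.simps[of chi gg n k k])
  then show ?thesis using assms by (simp add: vb_def )
qed

lemma wordy_vb:
  fixes chi :: "nat \<Rightarrow> 'g::ab_group_add \<Rightarrow> 'k::field"
  assumes "1 \<le> k" "k \<le> m" "m < 2 * n"
  shows "wordy n (vb chi gg n q k m)"
  using assms
proof (induction "m - k" arbitrary: k m rule: less_induct)
  case less
  consider "k = m" | "k < m" "m < 2 * n - k" | "k < m" "m = 2 * n - k" | "k < m" "2 * n - k < m"
    using less.prems by linarith
  then show ?case
  proof cases
    case 1
    then show ?thesis using less.prems wordy_gen[OF idx_range[of k n]] by (simp add: vb_single)
  next
    case 2
    then show ?thesis using less by (auto simp: vb_left intro!: wordy_sbr wordy_gen idx_range)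
  next
    case 3
    have "wordy n (vb chi gg n q k (m - 1))" using less 3 by auto
    then show ?thesis using less.prems 3(1)
      by (subst vb_middle[OF 3]) (intro wordy_diff wordy_smult wordy_amul wordy_gen idx_range; simp)
  next
    case 4
    then show ?thesis using less by (auto simp: vb_right intro!: wordy_sbr wordy_gen idx_range)
  qed
qed

context uq_sp
begin

notation endo_scale (infixr "\<cdot>" 72)

abbreviation br where "br \<equiv> endo.br"
abbreviation v where "v \<equiv> vb chi gg n q"
abbreviation w where "w \<equiv> vw n"
abbreviation V where "V k m \<equiv> quot (v k m)"
abbreviation x where "x i \<equiv> quot (gen i)"

lemma inA_v: "1 \<le> k \<Longrightarrow> k \<le> m \<Longrightarrow> m < 2 * n \<Longrightarrow> inA n (v k m)"
  by (intro wordy_inA wordy_vb)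

lemma quot_sbr: "inA n f \<Longrightarrow> inA n g \<Longrightarrow> quot (sbr chi gg u f u' g) = br (p u u') (quot f) (quot g)"
  by (simp add: sbr_def endo.br_def quot_diff quot_smult quot_amul)

lemma V_single: "V k k = x (idx n k)"
  by (simp add: vb_single)

lemma V_left:
  assumes "1 \<le> k" "k < m" "m < 2 * n - k"
  shows "V k m = br (p (w k (m - 1)) [idx n m]) (V k (m - 1)) (x (idx n m))"
  using assms by (subst vb_left) (auto intro!: quot_sbr inA_v inA_gen idx_range)

lemma V_right:
  assumes "1 \<le> k" "k < m" "2 * n - k < m" "m < 2 * n"
  shows "V k m = br (p [idx n k] (w (Suc k) m)) (x (idx n k)) (V (Suc k) m)"
  using assms by (subst vb_right) (auto intro!: quot_sbr inA_v inA_gen idx_range)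

lemma V_middle:
  assumes "1 \<le> k" "k < m" "m = 2 * n - k"
  shows "V k m = br (inverse q * p (w k (m - 1)) [idx n m]) (V k (m - 1)) (x (idx n m))"
proof -
  have "inA n (v k (m - 1))" "inA n (gen (idx n m) :: ('g, 'k) alg)"
    using assms by (auto intro!: inA_v inA_gen idx_range)
  then show ?thesis
    by (subst vb_middle[OF assms(2,3)]) (simp add: endo.br_def quot_diff quot_smult quot_amul)
qed

text \<open>The scalar \<open>e\<close> of the bracket is left arbitrary, so the exceptional middle
  elements are treated together with the left-normed ones. This suits statements such as
  \<open>V_far\<close>, whose proof works for every scalar.\<close>

lemma V_induct [consumes 3, case_names single snoc Cons]:
  assumes "1 \<le> k" "k \<le> m" "m < 2 * n"
    and "\<And>k. 1 \<le> k \<Longrightarrow> k < 2 * n \<Longrightarrow> P k k"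
    and "\<And>k m e. 1 \<le> k \<Longrightarrow> k < m \<Longrightarrow> m < 2 * n \<Longrightarrow> V k m = br e (V k (m - 1)) (x (idx n m)) \<Longrightarrow> P k (m - 1) \<Longrightarrow> P k m"
    and "\<And>k m e. 1 \<le> k \<Longrightarrow> k < m \<Longrightarrow> m < 2 * n \<Longrightarrow> V k m = br e (x (idx n k)) (V (Suc k) m) \<Longrightarrow> P (Suc k) m \<Longrightarrow> P k m"
  shows "P k m"
  using assms(1-3)
proof (induction "m - k" arbitrary: k m rule: less_induct)
  case less
  consider "k = m" | "k < m" "m < 2 * n - k" | "k < m" "m = 2 * n - k" | "k < m" "2 * n - k < m"
    using less.prems by linarith
  then show ?case
  proof cases
    case 1
    then show ?thesis using less.prems assms(4) by simp
  next
    case 2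
    have "P k (m - 1)" using less.prems 2 by (intro less.hyps) auto
    then show ?thesis using less.prems 2 by - (rule assms(5)[OF _ _ _ V_left]; (assumption | linarith))
  next
    case 3
    have "P k (m - 1)" using less.prems 3 by (intro less.hyps) auto
    then show ?thesis using less.prems 3 by - (rule assms(5)[OF _ _ _ V_middle]; (assumption | linarith))
  next
    case 4
    have "P (Suc k) m" using less.prems 4 by (intro less.hyps) auto
    then show ?thesis using less.prems 4 by - (rule assms(6)[OF _ _ _ V_right]; (assumption | linarith))
  qed
qed

lemma x_far:
  assumes "a \<in> {1..n}" "b \<in> {1..n}" "a + 1 < b \<or> b + 1 < a"
  shows "br (p [a] [b]) (x a) (x b) = 0"
proof -
  have *: "br (p [a] [b]) (x a) (x b) = 0" if "1 \<le> a" "a + 1 < b" "b \<le> n" for a b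
  proof -
    have "sbr chi gg [a] (gen a) [b] (gen b) \<in> rels chi gg n"
      using that unfolding rels_def by blast
    then have "quot (sbr chi gg [a] (gen a) [b] (gen b)) = 0"
      by (subst quot_eq_0_iff) (auto intro: rels_I rels_inA)
    then show ?thesis using that by (simp add: quot_sbr inA_gen)
  qed
  have "br (p [a] [b]) (x a) (x b) = 0" if "b + 1 < a"
  proof (rule endo.br_flip)
    show "br (p [b] [a]) (x b) (x a) = 0" using * that assms by simp
    show "p [b] [a] * p [a] [b] = 1" using p_far that assms by (simp add: pw_def)
  qed
  then show ?thesis using * assms by auto
qed

definition far :: "nat \<Rightarrow> nat \<Rightarrow> nat \<Rightarrow> bool" where
  "far j k m \<longleftrightarrow> (\<forall>i\<in>{k..m}. idx n i + 1 < j \<or> j + 1 < idx n i)"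

lemma V_far:
  assumes "1 \<le> k" "k \<le> m" "m < 2 * n" "far j k m" "j \<in> {1..n}"
  shows "br (p (w k m) [j]) (V k m) (x j) = 0 \<and> br (p [j] (w k m)) (x j) (V k m) = 0"
  using assms
proof (induction rule: V_induct)
  case (single k)
  then show ?case
    by (auto simp: V_single vw_single far_def intro!: x_far idx_range)
next
  case (snoc k m e)
  have far: "far j k (m - 1)" "idx n m + 1 < j \<or> j + 1 < idx n m"
    using snoc.prems snoc.hyps by (auto simp: far_def)
  have m: "idx n m \<in> {1..n}" using snoc.hyps by (intro idx_range) auto
  have w: "w k m = w k (m - 1) @ [idx n m]" using snoc.hyps by (intro vw_snoc) auto
  show ?case
    unfolding w snoc.hyps(4) p_append_left using snoc far m
    by (subst p_append_right) (auto intro!: endo.br_commute_left endo.br_commute_right x_far)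
next
  case (Cons k m e)
  have far: "far j (Suc k) m" "idx n k + 1 < j \<or> j + 1 < idx n k"
    using Cons.prems Cons.hyps by (auto simp: far_def)
  have m: "idx n k \<in> {1..n}" using Cons.hyps by (intro idx_range) auto
  have w: "w k m = [idx n k] @ w (Suc k) m" using Cons.hyps by (intro vw_Cons) auto
  show ?case
    unfolding w Cons.hyps(4) p_append_left using Cons far m
    by (subst p_append_right) (auto intro!: endo.br_commute_left endo.br_commute_right x_far)
qed

text \<open>The left-normed bracket can also be opened at its first letter: x_k skew commutes with
  each letter after x_{k+1}, so \<open>br_assoc\<close> moves it outwards. The bound on
  \<open>m\<close> stops just before position 2n - k - 1, where x_{k+1} occurs again.\<close>

lemma V_Cons:
  assumes "1 \<le> k" "k < m" "m + 1 < 2 * n - k"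
  shows "V k m = br (p [idx n k] (w (Suc k) m)) (x (idx n k)) (V (Suc k) m)"
  using assms(2,3)
proof (induction m)
  case (Suc m)
  have k: "idx n k \<in> {1..n}" using Suc.prems assms(1) by (intro idx_range) auto
  show ?case
  proof (cases "k = m")
    case True
    then show ?thesis using Suc.prems assms(1) V_left[of k "Suc m"] by (simp add: vw_single V_single)
  next
    case False
    have far: "br (p [idx n k] [idx n (Suc m)]) (x (idx n k)) (x (idx n (Suc m))) = 0"
      using Suc.prems assms(1) False by (intro x_far idx_range) (auto simp: idx_def)
    have "V k (Suc m) = br (p (w k m) [idx n (Suc m)]) (V k m) (x (idx n (Suc m)))"
      using Suc.prems assms(1) V_left[of k "Suc m"] by simp
    also have "p (w k m) [idx n (Suc m)] = p [idx n k] [idx n (Suc m)] * p (w (Suc k) m) [idx n (Suc m)]"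
      using Suc.prems False by (simp add: vw_Cons[of k m] flip: p_append_left)
    also have "V k m = br (p [idx n k] (w (Suc k) m)) (x (idx n k)) (V (Suc k) m)"
      using Suc False by auto
    also note endo.br_assoc[OF far]
    also have "p [idx n k] (w (Suc k) m) * p [idx n k] [idx n (Suc m)] = p [idx n k] (w (Suc k) (Suc m))"
      using Suc.prems k False by (simp add: vw_snoc[of "Suc k" "Suc m"] flip: p_append_right)
    also have "br (p (w (Suc k) m) [idx n (Suc m)]) (V (Suc k) m) (x (idx n (Suc m))) = V (Suc k) (Suc m)"
      using Suc.prems assms(1) False V_left[of "Suc k" "Suc m"] by simp
    finally show ?thesis .
  qed
qed simp

text \<open>Counterpart of \<open>V_Cons\<close> for the right-normed brackets: the last letter is
  moved outwards past first letters that are not its neighbours. Two-letter words in the descending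
  half are the base case.\<close>

lemma V_snoc:
  assumes "1 \<le> k" "k < m" "2 * n - k + 1 < m \<or> m = k + 1 \<and> n \<le> k" "m < 2 * n"
  shows "V k m = br (p (w k (m - 1)) [idx n m]) (V k (m - 1)) (x (idx n m))"
  using assms
proof (induction "m - k" arbitrary: k rule: less_induct)
  case less
  show ?case
  proof (cases "m = k + 1")
    case True
    then show ?thesis using less.prems V_right[of k m] by (auto simp: vw_single V_single)
  next
    case False
    have k: "idx n k \<in> {1..n}" using less.prems by (intro idx_range) auto
    have far: "br (p [idx n k] [idx n m]) (x (idx n k)) (x (idx n m)) = 0"
      using less.prems False by (intro x_far idx_range) (auto simp: idx_def)
    have "V k m = br (p [idx n k] (w (Suc k) m)) (x (idx n k)) (V (Suc k) m)"
      using less.prems by (intro V_right) auto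
    also have "V (Suc k) m = br (p (w (Suc k) (m - 1)) [idx n m]) (V (Suc k) (m - 1)) (x (idx n m))"
      using less.prems False by (intro less.hyps) auto
    also have "p [idx n k] (w (Suc k) m) = p [idx n k] (w (Suc k) (m - 1)) * p [idx n k] [idx n m]"
      using less.prems k by (simp add: vw_snoc[of "Suc k" m] flip: p_append_right)
    also note endo.br_assoc[OF far, symmetric]
    also have "p [idx n k] [idx n m] * p (w (Suc k) (m - 1)) [idx n m] = p (w k (m - 1)) [idx n m]"
      using less.prems by (simp add: vw_Cons[of k "m - Suc 0"] flip: p_append_left)
    also have "br (p [idx n k] (w (Suc k) (m - 1))) (x (idx n k)) (V (Suc k) (m - 1)) = V k (m - 1)"
      using less.prems False V_right[of k "m - 1"] by auto
    finally show ?thesis .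
  qed
qed


text \<open>\<open>F j\<close> is the running product of \<open>p\<^sub>i\<^sub>j p\<^sub>j\<^sub>i\<close> along the letters of positions \<open>1, 2, \<dots>\<close>, normalised so that
  it is 1 away from the neighbours of \<open>j\<close>.\<close>
definition F :: "nat \<Rightarrow> nat \<Rightarrow> 'k" where
  "F j m = (if j = n then (if m + 1 = n then inverse (q ^ 2) else if m = n then q ^ 2 else 1)
     else if m + 1 = j \<or> m + j + 1 = 2 * n then inverse q
     else if m = j \<or> m + j = 2 * n then q else 1)"

section \<open>Scalars collected when a letter passes a word\<close>

lemma F_nz: "F j m \<noteq> 0"
  using q_nz by (auto simp: F_def)

lemma pp_letters:
  assumes "a \<in> {1..n}" "b \<in> {1..n}"
  shows "p [a] [b] * p [b] [a] =
    (if a = b then (if a = n then q ^ 4 else q ^ 2)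
     else if a + 1 = b \<or> b + 1 = a then (if a = n \<or> b = n then inverse (q ^ 2) else inverse q) else 1)"
proof -
  have adj: "chi (Suc i) (gg i) * chi i (gg (Suc i)) = (if Suc i = n then inverse (q ^ 2) else inverse q)"
    if "1 \<le> i" "Suc i \<le> n" for i
    using that p_adj[rule_format, of "Suc i"] p_last by (auto simp: mult.commute)
  consider "a = b" | "a + 1 = b" | "b + 1 = a" | "a + 1 < b" | "b + 1 < a" by linarith
  then show ?thesis
  proof cases
    case 1
    then show ?thesis using p_ii p_nn assms by (auto simp: pw_def power2_eq_square power4_eq_xxxx)
  next
    case 2
    then show ?thesis using adj[of a] assms by (auto simp: pw_def mult.commute)
  next
    case 3
    then show ?thesis using adj[of b] assms by (auto simp: pw_def mult.commute)
  next
    case 4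
    then show ?thesis using p_far assms by (auto simp: pw_def)
  next
    case 5
    then show ?thesis using p_far[rule_format, of b a] assms by (auto simp: pw_def mult.commute)
  qed
qed

lemma pp_letter:
  assumes "1 \<le> m" "m < 2 * n" "j \<in> {1..n}"
  shows "p [idx n m] [j] * p [j] [idx n m] * F j (m - 1) = F j m"
proof (cases "j = n")
  case True
  consider "m + 1 < n" | "m + 1 = n" | "m = n" | "m = n + 1" | "n + 1 < m" by linarith
  then show ?thesis
    unfolding pp_letters[OF idx_range[OF assms(1,2)] assms(3)]
    using assms q_nz n2 True
    by cases (auto simp: F_def idx_def power2_eq_square power4_eq_xxxx, (simp add: field_simps)+)
next
  case False
  then have j: "j < n" "1 \<le> j" using assms(3) by auto
  \<comment> \<open>The positions that matter are j, its mirror image 2n - j and their neighbours.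
    For m = j + 1 there are two cases: if m = n, then x_n is next to both copies of x_j, and its
    factor 1/q^2 takes the running product from q straight to 1/q.\<close>
  consider "m + 1 < j" | "m + 1 = j" | "m = j" | "m = j + 1" "m < n" | "m = j + 1" "m = n"
    | "j + 1 < m" "m + j + 1 < 2 * n" | "j + 1 < m" "m + j + 1 = 2 * n" | "m + j = 2 * n"
    | "m + j = 2 * n + 1" | "2 * n + 1 < m + j"
    using j by linarith
  then show ?thesis
  proof cases
    case 6
    then have "idx n m + 1 < j \<or> j + 1 < idx n m" "F j (m - 1) = 1" "F j m = 1"
      using j by (auto simp: idx_def F_def)
    then show ?thesis unfolding pp_letters[OF idx_range[OF assms(1,2)] assms(3)] by auto
  next
    case 10
    then have "idx n m + 1 < j" "F j (m - 1) = 1" "F j m = 1"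
      using j assms by (auto simp: idx_def F_def)
    then show ?thesis unfolding pp_letters[OF idx_range[OF assms(1,2)] assms(3)] by auto
  next
    case 9
    then have "idx n m + 1 = j" "F j (m - 1) = q" "F j m = 1"
      using j assms by (auto simp: idx_def F_def)
    then show ?thesis unfolding pp_letters[OF idx_range[OF assms(1,2)] assms(3)] using j q_nz by auto
  next
    case 8
    then have "idx n m = j" "F j (m - 1) = inverse q" "F j m = q"
      using j assms by (auto simp: idx_def F_def)
    then show ?thesis unfolding pp_letters[OF idx_range[OF assms(1,2)] assms(3)]
      using j q_nz by (simp add: power2_eq_square)
  next
    case 7
    then have "j + 1 = idx n m" "idx n m \<noteq> n" "F j (m - 1) = 1" "F j m = inverse q"
      using j assms by (auto simp: idx_def F_def)
    then show ?thesis unfolding pp_letters[OF idx_range[OF assms(1,2)] assms(3)] using j by simp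
  next
    case 5
    then have "idx n m = j + 1" "idx n m = n" "F j (m - 1) = q" "F j m = inverse q"
      unfolding F_def using j assms by (auto simp: idx_def)
    then show ?thesis unfolding pp_letters[OF idx_range[OF assms(1,2)] assms(3)]
      using j q_nz by (simp add: power2_eq_square)
  next
    case 4
    then have "idx n m = j + 1" "idx n m \<noteq> n" "F j (m - 1) = q" "F j m = 1"
      using j assms by (auto simp: idx_def F_def)
    then show ?thesis unfolding pp_letters[OF idx_range[OF assms(1,2)] assms(3)]
      using j q_nz by simp
  next
    case 3
    then have "idx n m = j" "F j (m - 1) = inverse q" "F j m = q"
      using j assms by (auto simp: idx_def F_def)
    then show ?thesis unfolding pp_letters[OF idx_range[OF assms(1,2)] assms(3)]
      using j q_nz by (simp add: power2_eq_square)
  next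
    case 2
    then have "idx n m + 1 = j" "F j (m - 1) = 1" "F j m = inverse q"
      using j assms by (auto simp: idx_def F_def)
    then show ?thesis unfolding pp_letters[OF idx_range[OF assms(1,2)] assms(3)] using j by auto
  next
    case 1
    then have "idx n m + 1 < j" "F j (m - 1) = 1" "F j m = 1"
      using j assms by (auto simp: idx_def F_def)
    then show ?thesis unfolding pp_letters[OF idx_range[OF assms(1,2)] assms(3)] by auto
  qed
qed

text \<open>The one-letter factors telescope, so the scalar of a long word depends only on the
  positions of its two ends.\<close>

lemma pp:
  assumes "1 \<le> k" "k \<le> m + 1" "m < 2 * n" "j \<in> {1..n}"
  shows "p (w k m) [j] * p [j] (w k m) * F j (k - 1) = F j m"
  using assms(2,3)
proof (induction m)
  case 0
  then show ?case using assms(1,4) by (simp add: vw_Nil pw_def chi_zero)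
next
  case (Suc m)
  show ?case
  proof (cases "k = Suc (Suc m)")
    case True
    then show ?thesis using assms(4) by (simp add: vw_Nil pw_def chi_zero)
  next
    case False
    have w: "w k (Suc m) = w k m @ [idx n (Suc m)]" using Suc.prems False vw_snoc[of k "Suc m"] by simp
    have "p (w k (Suc m)) [j] * p [j] (w k (Suc m)) * F j (k - 1)
      = (p (w k m) [j] * p [j] (w k m) * F j (k - 1)) * (p [idx n (Suc m)] [j] * p [j] [idx n (Suc m)])"
      using assms(4) by (simp add: w p_append_left p_append_right)
    also have "\<dots> = F j (Suc m)"
      using Suc False assms pp_letter[of "Suc m" j] by (simp add: mult_ac)
    finally show ?thesis .
  qed
qed

lemma pp':
  assumes "1 \<le> k" "k \<le> m + 1" "m < 2 * n" "j \<in> {1..n}"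
  shows "p (w k m) [j] * p [j] (w k m) = F j m / F j (k - 1)"
  using pp[OF assms] F_nz by (simp add: field_simps)

section \<open>Letters that skew commute with v[k,m] by the Serre relations\<close>

lemma quot_rel: "r \<in> rels chi gg n \<Longrightarrow> quot r = 0"
  by (subst quot_eq_0_iff) (auto intro: rels_I rels_inA)

lemma p_self: "1 \<le> i \<Longrightarrow> i < n \<Longrightarrow> p [i] [i] = q"
  using p_ii by (simp add: pw_def)

lemma p_cons_left: "p (a # u) z = p [a] z * p u z"
  using p_append_left[of "[a]" u] by simp

lemma p_cons_right: "set u \<subseteq> {1..n} \<Longrightarrow> p u (b # z) = p u [b] * p u z"
  using p_append_right[of u "[b]" z] by simp

lemma serre_right:
  assumes "1 \<le> i" "i + 1 < n"
  shows "br (q * p [i] [i+1]) (x i) (br (p [i] [i+1]) (x i) (x (i+1))) = 0"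
proof -
  have "quot (sbr chi gg [i] (gen i) [i, i+1] (sbr chi gg [i] (gen i) [i+1] (gen (i+1)))) = 0"
    using assms by (intro quot_rel) (auto simp: rels_def)
  then show ?thesis
    using assms by (simp add: quot_sbr inA_gen inA_sbr p_cons_right[of "[i]" i] p_self)
qed

lemma serre_left:
  assumes "1 \<le> i" "i + 1 < n"
  shows "br (q * p [i] [i+1]) (br (p [i] [i+1]) (x i) (x (i+1))) (x (i+1)) = 0"
proof -
  have "quot (sbr chi gg [i, i+1] (sbr chi gg [i] (gen i) [i+1] (gen (i+1))) [i+1] (gen (i+1))) = 0"
    using assms by (intro quot_rel) (auto simp: rels_def)
  then show ?thesis
    using assms by (simp add: quot_sbr inA_gen inA_sbr p_cons_left[of i "[Suc i]"] p_self mult.commute)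
qed

lemma pp_adj: "1 \<le> i \<Longrightarrow> i + 1 < n \<Longrightarrow> q * p [i] [i+1] * p [i+1] [i] = 1"
  using pp_letters[of i "i+1"] q_nz by (simp add: mult.assoc)

lemma serre_right':
  assumes "1 \<le> i" "i + 1 < n"
  shows "br (q * p [i+1] [i]) (x (i+1)) (br (p [i+1] [i]) (x (i+1)) (x i)) = 0"
  by (rule endo.serre_flip[OF serre_left[OF assms] pp_adj[OF assms]])

lemma serre_left':
  assumes "1 \<le> i" "i + 1 < n"
  shows "br (q * p [i+1] [i]) (br (p [i+1] [i]) (x (i+1)) (x i)) (x i) = 0"
  by (rule endo.serre_flip'[OF serre_right[OF assms]]) (use pp_adj[OF assms] in \<open>simp add: mult_ac\<close>)

text \<open>The case k = j - 1 is a Serre relation; letters further to the left are not neighbours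
  of x_j and can be put in front.\<close>

lemma V_x_last:
  assumes "1 \<le> k" "k < j" "j < n"
  shows "br (p (w k j) [j]) (V k j) (x j) = 0"
  using assms
proof (induction "j - k" arbitrary: k rule: less_induct)
  case less
  show ?case
  proof (cases "j = k + 1")
    case True
    then have "V k j = br (p [k] [k+1]) (x k) (x (k+1))"
      using less.prems V_left[of k j] by (simp add: vw_single V_single idx_def)
    moreover have "w k j = [k, k+1]"
      using True less.prems by (simp add: vw_pair idx_def)
    ultimately show ?thesis
      using True less.prems serre_left[of k] by (simp add: p_cons_left[of k "[Suc k]"] p_self mult.commute)
  next
    case False
    have 1: "V k j = br (p [idx n k] (w (Suc k) j)) (x (idx n k)) (V (Suc k) j)"
      using less.prems False by (intro V_Cons) auto
    have 2: "w k j = [idx n k] @ w (Suc k) j" using less.prems by (intro vw_Cons) auto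
    have 3: "br (p (w (Suc k) j) [j]) (V (Suc k) j) (x j) = 0"
      using less.prems False by (intro less.hyps) auto
    have 4: "br (p [idx n k] [j]) (x (idx n k)) (x j) = 0"
      using less.prems False by (intro x_far idx_range) (auto simp: idx_def)
    show ?thesis unfolding 1 2 p_append_left by (rule endo.br_commute_left[OF 4 3])
  qed
qed

text \<open>The core is the word x_{j-1} x_j x_{j+1}, settled by \<open>serre_chain_left\<close>.
  Letters added at either end are not neighbours of x_j; the last hypothesis keeps the word short of
  the second occurrence of x_{j+1}.\<close>

lemma V_x_inner:
  assumes "1 \<le> k" "k < j" "j < i" "i + j + 1 < 2 * n"
  shows "br (p (w k i) [j]) (V k i) (x j) = 0"
  using assms(3,4)
proof (induction i)
  case (Suc i)
  have j: "j + 1 < n" using Suc.prems by linarith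
  show ?case
  proof (cases "i = j")
    case True
    have "br (p (w k (Suc j)) [j]) (V k (Suc j)) (x j) = 0"
      using assms(1,2)
    proof (induction "j - k" arbitrary: k rule: less_induct)
      case less
      show ?case
      proof (cases "j = k + 1")
        case True
        have "V k j = br (p [k] [j]) (x k) (x j)"
          using True less.prems V_left[of k j] j by (simp add: vw_single V_single idx_def)
        moreover have wkj: "w k j = [k, j]"
          using True less.prems j by (simp add: vw_pair idx_def)
        ultimately have V: "V k (Suc j) = br (p [k] [Suc j] * p [j] [Suc j]) (br (p [k] [j]) (x k) (x j)) (x (Suc j))"
          using True less.prems j V_left[of k "Suc j"] by (simp add: idx_def p_cons_left[of k "[Suc k]"])
        have wk: "w k (Suc j) = [k, j, Suc j]"
          using wkj less.prems vw_snoc[of k "Suc j" n] j by (simp add: idx_def)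
        have "br (p [k] [j] * q * p [Suc j] [j])
            (br (p [k] [Suc j] * p [j] [Suc j]) (br (p [k] [j]) (x k) (x j)) (x (Suc j))) (x j) = 0"
          by (rule endo.serre_chain_left)
            (use True less.prems j qm1 serre_left[of k] serre_right[of j] pp_adj[of j] x_far[of k "Suc j"] in auto)
        then show ?thesis
          unfolding V wk using True less.prems j
          by (simp add: p_cons_left[of k "[Suc k, Suc (Suc k)]"] p_cons_left[of "Suc k" "[Suc (Suc k)]"] p_self mult.assoc)
      next
        case False
        have 1: "V k (Suc j) = br (p [idx n k] (w (Suc k) (Suc j))) (x (idx n k)) (V (Suc k) (Suc j))"
          using less.prems False j by (intro V_Cons) auto
        have 2: "w k (Suc j) = [idx n k] @ w (Suc k) (Suc j)" using less.prems by (intro vw_Cons) auto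
        have 3: "br (p (w (Suc k) (Suc j)) [j]) (V (Suc k) (Suc j)) (x j) = 0"
          using less.prems False by (intro less.hyps) auto
        have 4: "br (p [idx n k] [j]) (x (idx n k)) (x j) = 0"
          using less.prems False j by (intro x_far idx_range) (auto simp: idx_def)
        show ?thesis unfolding 1 2 p_append_left by (rule endo.br_commute_left[OF 4 3])
      qed
    qed
    with True show ?thesis by simp
  next
    case False
    have 1: "V k (Suc i) = br (p (w k i) [idx n (Suc i)]) (V k i) (x (idx n (Suc i)))"
      using Suc.prems assms V_left[of k "Suc i"] by simp
    have 2: "w k (Suc i) = w k i @ [idx n (Suc i)]" using Suc.prems assms vw_snoc[of k "Suc i"] by simp
    have 3: "br (p (w k i) [j]) (V k i) (x j) = 0" using Suc False by simp
    have 4: "br (p [idx n (Suc i)] [j]) (x (idx n (Suc i))) (x j) = 0"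
      using Suc.prems assms False by (intro x_far idx_range) (auto simp: idx_def)
    show ?thesis unfolding 1 2 p_append_left by (rule endo.br_commute_left[OF 3 4])
  qed
qed simp

text \<open>The Serre relation for x_k, x_k, x_{k+1}, extended by letters which x_k passes; the word
  has to end before x_{k+1} occurs a second time, at position 2n - k - 1.\<close>

lemma x_V_first:
  assumes "1 \<le> k" "k < i" "i + k + 2 \<le> 2 * n"
  shows "br (p [k] (w k i)) (x k) (V k i) = 0"
  using assms(2,3)
proof (induction i)
  case (Suc i)
  have k: "k + 1 < n" using Suc.prems by linarith
  show ?case
  proof (cases "i = k")
    case True
    have "V k (Suc k) = br (p [k] [k+1]) (x k) (x (k+1))"
      using assms(1) k V_left[of k "Suc k"] by (simp add: vw_single V_single idx_def)
    moreover have "w k (Suc k) = [k, k+1]"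
      using k by (simp add: vw_pair idx_def)
    ultimately show ?thesis
      using True assms(1) k serre_right[of k] by (simp add: p_cons_right[of "[k]" k] p_self)
  next
    case False
    have 1: "V k (Suc i) = br (p (w k i) [idx n (Suc i)]) (V k i) (x (idx n (Suc i)))"
      using Suc.prems assms(1) V_left[of k "Suc i"] by simp
    have 2: "w k (Suc i) = w k i @ [idx n (Suc i)]" using Suc.prems assms vw_snoc[of k "Suc i"] by simp
    have 3: "br (p [k] (w k i)) (x k) (V k i) = 0" using Suc False by simp
    have 4: "br (p [k] [idx n (Suc i)]) (x k) (x (idx n (Suc i))) = 0"
      using Suc.prems assms(1) False by (intro x_far idx_range) (auto simp: idx_def)
    have 5: "p [k] (w k i @ [idx n (Suc i)]) = p [k] (w k i) * p [k] [idx n (Suc i)]"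
      using assms(1) k by (intro p_append_right) auto
    show ?thesis unfolding 1 2 5 by (rule endo.br_commute_right[OF 3 4])
  qed
qed simp

text \<open>Position 2n - k carries x_k again, so this is the analogue of \<open>x_V_first\<close>
  for the descending half, where the neighbour in question is x_{k-1}.\<close>

lemma x_V_fold:
  assumes "1 \<le> k" "k < n" "2 * n - k < m" "m < 2 * n"
  shows "br (p [k] (w (2 * n - k) m)) (x k) (V (2 * n - k) m) = 0"
  using assms(3,4)
proof (induction m)
  case (Suc m)
  have k: "k - 1 + 1 = k" "1 \<le> k - 1" using Suc.prems assms by auto
  have ik: "idx n (2 * n - k) = k" using assms by (auto simp: idx_def)
  have m: "idx n (Suc m) = 2 * n - Suc m" using Suc.prems assms by (auto simp: idx_def)
  show ?case
  proof (cases "m = 2 * n - k")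
    case True
    then have im: "idx n (Suc m) = k - 1" unfolding m using True assms by linarith
    have "V (2 * n - k) (Suc m) = br (p [k] [k - 1]) (x k) (x (k - 1))"
      using True Suc.prems assms im ik V_right[of "2 * n - k" "Suc m"] by (simp add: vw_single V_single)
    moreover have "w (2 * n - k) (Suc m) = [k, k - 1]"
      using True im ik by (simp add: vw_pair)
    ultimately show ?thesis
      using True assms k serre_right'[of "k - 1"] by (simp add: p_cons_right[of "[k]" k] p_self)
  next
    case False
    have 1: "V (2 * n - k) (Suc m) = br (p (w (2 * n - k) m) [idx n (Suc m)]) (V (2 * n - k) m) (x (idx n (Suc m)))"
      using Suc.prems assms False V_snoc[of "2 * n - k" "Suc m"] by simp
    have 2: "w (2 * n - k) (Suc m) = w (2 * n - k) m @ [idx n (Suc m)]"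
      using Suc.prems assms vw_snoc[of "2 * n - k" "Suc m"] by simp
    have 3: "br (p [k] (w (2 * n - k) m)) (x k) (V (2 * n - k) m) = 0" using Suc False by simp
    have 4: "br (p [k] [idx n (Suc m)]) (x k) (x (idx n (Suc m))) = 0"
      using Suc.prems assms False by (intro x_far) (auto simp: m)
    have 5: "p [k] (w (2 * n - k) m @ [idx n (Suc m)]) = p [k] (w (2 * n - k) m) * p [k] [idx n (Suc m)]"
      using assms by (intro p_append_right) auto
    show ?thesis unfolding 1 2 5 by (rule endo.br_commute_right[OF 3 4])
  qed
qed simp

lemma x_V_inner:
  assumes "1 \<le> k" "k + 2 \<le> i" "i + k + 1 \<le> 2 * n" "2 * n - k < m" "m < 2 * n"
  shows "br (p [k] (w i m)) (x k) (V i m) = 0"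
proof -
  have kn: "k + 1 < n" using assms by linarith
  have k: "1 \<le> k - 1" "k - 1 + 1 = k" "Suc (k - 1) = k" "k - Suc 0 + 1 = k" "Suc (k - Suc 0) = k" using assms by auto
  \<comment> \<open>Positions \<open>i0\<close> and \<open>i0 + 1\<close> carry x_{k+1} and x_k. The
    shortest words with this x_k in their interior start at \<open>i0\<close>; they rest on
    \<open>serre_chain_right\<close>, and longer ones arise by prepending letters that x_k
    passes.\<close>
  define i0 where "i0 = 2 * n - k - 1"
  have ii: "idx n i0 = k + 1" "idx n (Suc i0) = k" using kn by (auto simp: i0_def idx_def)
  have base: "br (p [k] (w i0 m)) (x k) (V i0 m) = 0"
    using assms(4,5)
  proof (induction m)
    case (Suc m)
    show ?case
    proof (cases "m = 2 * n - k")
      case True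
      then have im: "idx n (Suc m) = k - 1" using kn by (auto simp: idx_def)
      have m: "m = Suc i0" using True kn by (simp add: i0_def)
      have c: "2 * n - Suc i0 < Suc m" "Suc m < 2 * n" "2 * n - i0 < Suc m" "1 \<le> i0"
        using m Suc.prems kn by (auto simp: i0_def)
      have "V (Suc i0) (Suc m) = br (p [k] [k-1]) (x k) (x (k-1))"
        using m im ii c V_right[of "Suc i0" "Suc m"] by (simp add: vw_single V_single)
      moreover have w1: "w (Suc i0) (Suc m) = [k, k - 1]"
        using m im ii by (simp add: vw_pair)
      ultimately have V: "V i0 (Suc m) = br (p [k+1] [k-1] * p [k+1] [k]) (x (k+1)) (br (p [k] [k-1]) (x k) (x (k-1)))"
        using m c ii kn w1 V_right[of "i0" "Suc m"] p_cons_right[of "[k+1]" k "[k-1]"]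
        by (simp add: mult.commute)
      have wk: "w i0 (Suc m) = [k+1, k, k-1]"
        using m w1 vw_Cons[of i0 "Suc m" n] by (simp add: ii)
      have "br (p [k] [k-1] * q * p [k] [k+1]) (x k)
          (br (p [k+1] [k-1] * p [k+1] [k]) (x (k+1)) (br (p [k] [k-1]) (x k) (x (k-1)))) = 0"
        by (rule endo.serre_chain_right)
          (use kn k qm1 serre_right'[of "k-1"] serre_left'[of k] pp_adj[of k] x_far[of "k+1" "k-1"] assms(1)
            in \<open>auto simp: mult_ac\<close>)
      moreover have "p [k] (w i0 (Suc m)) = p [k] [k-1] * q * p [k] [k+1]"
        unfolding wk using kn assms(1)
        by (simp add: p_cons_right[of "[k]" "Suc k" "[k, k - Suc 0]"] p_cons_right[of "[k]" k "[k - Suc 0]"] p_self mult_ac)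
      ultimately show ?thesis unfolding V by simp
    next
      case False
      have 1: "V i0 (Suc m) = br (p (w i0 m) [idx n (Suc m)]) (V i0 m) (x (idx n (Suc m)))"
      proof -
        have "1 \<le> i0" "i0 < Suc m" "2 * n - i0 + 1 < Suc m"
          using Suc.prems kn False unfolding i0_def by linarith+
        then show ?thesis using V_snoc[of i0 "Suc m"] Suc.prems by simp
      qed
      have 2: "w i0 (Suc m) = w i0 m @ [idx n (Suc m)]"
        using Suc.prems kn vw_snoc[of i0 "Suc m"] by (simp add: i0_def)
      have 3: "br (p [k] (w i0 m)) (x k) (V i0 m) = 0" using Suc False by simp
      have 4: "br (p [k] [idx n (Suc m)]) (x k) (x (idx n (Suc m))) = 0"
        using Suc.prems kn assms(1) False by (intro x_far) (auto simp: idx_def)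
      have 5: "p [k] (w i0 m @ [idx n (Suc m)]) = p [k] (w i0 m) * p [k] [idx n (Suc m)]"
        using assms(1) kn by (intro p_append_right) auto
      show ?thesis unfolding 1 2 5 by (rule endo.br_commute_right[OF 3 4])
    qed
  qed simp
  have "i \<le> i0" using assms by (simp add: i0_def)
  then show ?thesis using assms(2)
  proof (induction i rule: inc_induct)
    case base
    then show ?case using \<open>br (p [k] (w i0 m)) (x k) (V i0 m) = 0\<close> by simp
  next
    case (step i)
    have i: "i < i0" "i0 = 2 * n - k - 1" using step i0_def by auto
    have 1: "V i m = br (p [idx n i] (w (Suc i) m)) (x (idx n i)) (V (Suc i) m)"
      using assms i step.prems by (intro V_right) auto
    have 2: "w i m = [idx n i] @ w (Suc i) m" using assms i by (intro vw_Cons) auto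
    have 3: "br (p [k] (w (Suc i) m)) (x k) (V (Suc i) m) = 0" using step by simp
    have 4: "br (p [k] [idx n i]) (x k) (x (idx n i)) = 0"
      using step.prems i assms kn by (intro x_far idx_range) (auto simp: idx_def)
    have 5: "p [k] ([idx n i] @ w (Suc i) m) = p [k] [idx n i] * p [k] (w (Suc i) m)"
      using assms(1) kn by (intro p_append_right) auto
    show ?case unfolding 1 2 5 by (rule endo.br_commute_right[OF 4 3])
  qed
qed


section \<open>The fold identity\<close>

definition N where "N k = p (w (k + 1) (2 * n - k - 1)) [k]"
definition N' where "N' k = p [k] (w (k + 1) (2 * n - k - 1))"
abbreviation U where "U k \<equiv> V k (2 * n - k)"
abbreviation L where "L k \<equiv> V k (2 * n - k - 1)"
abbreviation R where "R k \<equiv> V (k + 1) (2 * n - k)"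

text \<open>The word of u_{k+1} contains x_{k+1} twice, each occurrence contributing 1/q; for k = n
  - 1 it is the single letter x_n, contributing 1/q^2.\<close>

lemma NN':
  assumes "1 \<le> k" "k < n"
  shows "q * q * N k * N' k = 1"
proof -
  have "N k * N' k = F k (2 * n - k - 1) / F k k"
    unfolding N_def N'_def using pp'[of "k + 1" "2 * n - k - 1" k] assms by simp
  moreover have "F k (2 * n - k - 1) = inverse q" "F k k = q"
    using assms by (auto simp: F_def)
  ultimately have "N k * N' k = inverse q / q" by simp
  then show ?thesis using q_nz by (simp add: mult.assoc)
qed

text \<open>For k = n - 1 both sides are expanded. For k = n - 2 no induction hypothesis enters,
  since L_{k+1} and R_{k+1} are brackets of x_{n-1} with x_n; the identity for k + 1 is used only
  when k + 2 < n, where its kappa is 1.\<close>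

lemma fold_identity:
  assumes "1 \<le> k" "k < n"
  shows "R k - (q * N k) \<cdot> L k = (if k + 1 = n then 1 + inverse q else 1) \<cdot>
    (U (k + 1) * x k - (q * N k) \<cdot> (x k * U (k + 1)))"
  using assms
proof (induction "n - k" arbitrary: k rule: less_induct)
  case less
  show ?case
  proof (cases "k + 1 = n")
    case True
    have 1: "2 * n - k - 1 = n" "2 * n - k = Suc n" "2 * n - (k + 1) = n" "k + 1 = n" "Suc k = n"
      using True by auto
    have idx: "idx n (Suc n) = k" "idx n n = n" "idx n k = k" using True less.prems by (auto simp: idx_def)
    have L: "L k = br (p [k] [n]) (x k) (x n)"
    proof -
      have "n - 1 = k" "n < 2 * n - k" "k < n" using True less.prems by auto
      then show ?thesis unfolding 1 using V_left[of k n] less.prems idx by (simp add: V_single vw_single)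
    qed
    have R: "R k = br (p [n] [k]) (x n) (x k)"
      unfolding 1 using V_right[of n "Suc n"] n2 idx by (simp add: V_single vw_single)
    have N: "N k = p [n] [k]" "N' k = p [k] [n]" unfolding N_def N'_def 1 using idx by (simp_all add: vw_single)
    have U: "U (k + 1) = x n" unfolding 1 using idx by (simp add: V_single)
    have qq: "q * N k * N' k = inverse q"
      using NN'[OF less.prems] q_nz by (simp add: field_simps)
    have "R k - (q * N k) \<cdot> L k - (1 + inverse q) \<cdot> (U (k + 1) * x k - (q * N k) \<cdot> (x k * U (k + 1)))
       = (q * N k * N' k - inverse q) \<cdot> (x n * x k) + (N k * (inverse q * q - 1)) \<cdot> (x k * x n)"
      unfolding L R U endo.br_def N[symmetric] by (simp add: endo.sc_simps)
    also have "\<dots> = 0" using qq q_nz by simp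
    finally show ?thesis using True by simp
  next
    case False
    then have k: "k + 1 < n" "1 \<le> k" using less.prems by auto
    \<comment> \<open>\<open>Y\<close> is the word of \<open>y\<close> = u_{k+2}, which is x_n
      itself when k + 2 = n. Below, \<open>t\<close> and \<open>s\<close> are the scalars of
      \<open>a\<close> and \<open>b\<close>, \<open>r\<close> and \<open>r'\<close> those of
      \<open>y\<close> and \<open>a\<close>, \<open>Py\<close> and \<open>c\<close> those of
      \<open>y\<close> and \<open>b\<close>. They satisfy q s t = 1, r r' = 1 and q q Py c =
      1.\<close>
    define a b y Y where "a = x k" and "b = x (k + 1)" and "y = U (k + 2)" and "Y = w (k + 2) (2 * n - k - 2)"
    define t s r r' Py c where "t = p [k+1] [k]" and "s = p [k] [k+1]" and "r = p Y [k]" and "r' = p [k] Y"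
      and "Py = p Y [k+1]" and "c = p [k+1] Y"
    have sets: "set Y \<subseteq> {1..n}" unfolding Y_def using k by (intro set_vw) auto
    have e1: "2 * n - (k + 1) = 2 * n - k - 1" "2 * n - (k + 1) - 1 = 2 * n - k - 2"
      "2 * n - (k + 2) = 2 * n - k - 2" "k + 1 + 1 = k + 2" "2 * n - k - 1 - 1 = 2 * n - k - 2" by auto
    have idx: "idx n (k + 1) = k + 1" "idx n k = k" "idx n (2 * n - k - 1) = k + 1" "idx n (2 * n - k) = k"
      using k by (auto simp: idx_def)
    have W1: "w (k + 1) (2 * n - k - 2) = [k+1] @ Y"
      using k vw_Cons[of "k + 1" "2 * n - k - 2" n] unfolding Y_def idx by simp
    have W2: "w (k + 2) (2 * n - k - 1) = Y @ [k+1]"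
      using k vw_snoc[of "k + 2" "2 * n - k - 1" n] unfolding Y_def idx e1 by simp
    have W3: "w (k + 1) (2 * n - k - 1) = [k+1] @ Y @ [k+1]"
      using k vw_Cons[of "k + 1" "2 * n - k - 1" n] W2 unfolding idx by simp
    have W4: "w (k + 2) (2 * n - k) = Y @ [k+1, k]"
      using k vw_snoc[of "k + 2" "2 * n - k" n] W2 unfolding idx by simp
    have W5: "w k (2 * n - k - 2) = [k, k+1] @ Y"
      using k vw_Cons[of k "2 * n - k - 2" n] W1 unfolding idx by simp
    have qst: "q * s * t = 1" unfolding s_def t_def using k by (intro pp_adj) auto
    have rr: "r * r' = 1"
    proof -
      have "r * r' = F k (2 * n - k - 2) / F k (k + 1)"
        unfolding r_def r'_def Y_def using pp'[of "k + 2" "2 * n - k - 2" k] k by simp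
      moreover have "F k (2 * n - k - 2) = 1" "F k (k + 1) = 1" using k by (auto simp: F_def)
      ultimately show ?thesis by simp
    qed
    have Pc: "q * q * Py * c = 1"
    proof -
      have "N (k + 1) = Py" "N' (k + 1) = c" unfolding N_def N'_def e1 Py_def c_def Y_def by simp_all
      then show ?thesis using NN'[of "k + 1"] k by simp
    qed
    have Nk: "N k = t * r * t"
      unfolding N_def W3 t_def r_def by (simp add: p_append_left p_cons_left[of "Suc k" "Y @ [Suc k]"] mult_ac)
    have L: "L k = br (s * q * Py) (br (s * r') a (L (k + 1))) b"
    proof -
      have "L k = br (p (w k (2 * n - k - 2)) [k+1]) (V k (2 * n - k - 2)) b"
        using V_left[of k "2 * n - k - 1"] k unfolding idx b_def e1 by simp
      also have "V k (2 * n - k - 2) = br (p [k] (w (k + 1) (2 * n - k - 2))) a (L (k + 1))"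
        using V_Cons[of k "2 * n - k - 2"] k unfolding idx a_def e1 by simp
      also have "p [k] (w (k + 1) (2 * n - k - 2)) = s * r'"
        unfolding W1 s_def r'_def using k by (subst p_append_right) auto
      also have "p (w k (2 * n - k - 2)) [k+1] = s * q * Py"
        unfolding W5 s_def Py_def using k p_self[of "k+1"]
        by (simp add: p_append_left p_cons_left[of k "[Suc k]"] p_cons_left[of k "Suc k # Y"] p_cons_left[of "Suc k" Y] mult_ac)
      finally show ?thesis .
    qed
    have R: "R k = br (c * q * t) b (br (r * t) (R (k + 1)) a)"
    proof -
      have "R k = br (p [k+1] (w (k + 2) (2 * n - k))) b (V (k + 2) (2 * n - k))"
        using V_right[of "k + 1" "2 * n - k"] k unfolding idx b_def by simp
      also have "V (k + 2) (2 * n - k) = br (p (w (k + 2) (2 * n - k - 1)) [k]) (R (k + 1)) a"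
      proof -
        have "k + 2 < 2 * n - k" "2 * n - (k + 2) + 1 < 2 * n - k" "2 * n - k < 2 * n" using k by linarith+
        then show ?thesis using V_snoc[of "k + 2" "2 * n - k"] unfolding idx a_def e1 by simp
      qed
      also have "p (w (k + 2) (2 * n - k - 1)) [k] = r * t"
        unfolding W2 r_def t_def by (simp add: p_append_left)
      also have "p [k+1] (w (k + 2) (2 * n - k)) = c * q * t"
        unfolding W4 c_def t_def using k p_self[of "k+1"]
        by (simp add: p_append_right[of "[Suc k]"] p_cons_right[of "[Suc k]" "Suc k" "[k]"] mult_ac)
      finally show ?thesis .
    qed
    have U: "U (k + 1) = L (k + 1) * b - Py \<cdot> (b * L (k + 1))"
    proof -
      have "U (k + 1) = br (inverse q * p (w (k + 1) (2 * n - k - 2)) [k+1]) (L (k + 1)) b"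
        using V_middle[of "k + 1" "2 * n - k - 1"] k unfolding idx b_def e1 by simp
      also have "inverse q * p (w (k + 1) (2 * n - k - 2)) [k+1] = Py"
        unfolding W1 Py_def using k p_self[of "k+1"] q_nz by (simp add: p_append_left p_cons_left[of "Suc k" Y])
      finally show ?thesis by (simp add: endo.br_def)
    qed
    define \<theta> where "\<theta> = q * t * r * Py"
    have red: "U (k + 1) * a - (q * N k) \<cdot> (a * U (k + 1)) + (q * N k) \<cdot> L k
       = L (k + 1) * br t b a - \<theta> \<cdot> (br t b a * L (k + 1))"
      unfolding U L
    proof (rule endo.fold_reduction)
      have "q * N k * (s * r') = (q * s * t) * (r * r') * t" unfolding Nk by (simp add: mult_ac)
      then show 1: "q * N k * (s * r') = t" using qst rr by simp
      have "q * N k * (s * r' * (s * q * Py)) = (q * N k * (s * r')) * (s * q * Py)" by (simp add: mult_ac)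
      also have "\<dots> = (q * s * t) * Py" unfolding 1 by (simp add: mult_ac)
      finally show "q * N k * (s * r' * (s * q * Py)) = Py" using qst by simp
      have "q * N k * (s * q * Py) = (q * s * t) * (q * t * r * Py)" unfolding Nk by (simp add: mult_ac)
      then show "q * N k * (s * q * Py) = \<theta>" using qst by (simp add: \<theta>_def)
      show "q * N k * Py = \<theta> * t" unfolding Nk \<theta>_def by (simp add: mult_ac)
    qed
    have bd: "br (q * t) b (br t b a) = 0"
      unfolding a_def b_def t_def using serre_right'[of k] k by simp
    \<comment> \<open>What remains of the fold identity: the right side is R_k with its first letter
      x_{k+1} and its last letter x_k split off from R_{k+1}.\<close>
    have core: "L (k + 1) * br t b a - \<theta> \<cdot> (br t b a * L (k + 1)) = br (c * q * t) b (br (r * t) (R (k + 1)) a)"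
    proof (cases "k + 2 = n")
      case True
      have n': "2 * n - k - 2 = n" "2 * n - (k + 1) - 1 = n" "k + 1 + 1 = n" "2 * n - (k + 1) = Suc n" "Suc (Suc k) = n"
        using True by auto
      have Y: "Y = [n]" unfolding Y_def n' True using n2 by (simp add: vw_single idx_def)
      have idn: "idx n n = n" "idx n (Suc n) = k + 1" using n' n2 by (auto simp: idx_def)
      have nk: "n - Suc 0 = Suc k" using True by simp
      have L1: "L (k + 1) = br c b (x n)"
        using V_left[of "k + 1" n] k nk n' idx idn unfolding n' b_def c_def Y by (simp add: V_single vw_single)
      have R1: "R (k + 1) = br Py (x n) b"
        using V_right[of n "Suc n"] n2 k n' idn unfolding n' b_def Py_def Y by (simp add: V_single vw_single)
      have ya: "x n * a = r \<cdot> (a * x n)"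
        using x_far[of n k] k unfolding a_def r_def Y endo.br_zero_iff by simp
      show ?thesis
        unfolding L1 R1 using endo.fold_core_base[OF ya bd refl \<theta>_def, of c] by (simp add: mult_ac)
    next
      case False
      then have k2: "k + 2 < n" using k by simp
      \<comment> \<open>Here \<open>z\<close> is L_{k+2} and \<open>d\<close> is x_{k+2}, so that
        u_{k+2} is their bracket; \<open>x_k\<close> passes both, which is why [x_{k+1}, x_k] skew
        commutes with the brackets of x_{k+1} with either of them.\<close>
      define z d Z where "z = V (k + 2) (2 * n - k - 3)" and "d = x (k + 2)" and "Z = w (k + 2) (2 * n - k - 3)"
      define r1 r2 \<beta>z \<beta>c \<nu> where "r1 = p Z [k]" and "r2 = p [k+2] [k]" and "\<beta>z = p [k+1] Z"
        and "\<beta>c = p [k+1] [k+2]" and "\<nu> = inverse q * p Z [k+2]"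
      have idx2: "idx n (2 * n - k - 2) = k + 2" "idx n (k + 2) = k + 2" using k2 by (auto simp: idx_def)
      have e2: "2 * n - k - 2 - 1 = 2 * n - k - 3" "Suc (k + 1) = k + 2" by auto
      have Y: "Y = Z @ [k+2]"
        using k2 vw_snoc[of "k + 2" "2 * n - k - 2" n] unfolding Y_def Z_def idx2 e2 by simp
      have r: "r = r1 * r2" unfolding r_def Y r1_def r2_def by (simp add: p_append_left)
      have c: "c = \<beta>z * \<beta>c" unfolding c_def Y \<beta>z_def \<beta>c_def using k by (subst p_append_right) auto
      have h: "V (k + 1) (2 * n - k - 3) = br \<beta>z b z"
        using V_Cons[of "k + 1" "2 * n - k - 3"] k2 unfolding idx \<beta>z_def Z_def z_def b_def e2 by simp
      have wh: "w (k + 1) (2 * n - k - 3) = [k+1] @ Z"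
        using vw_Cons[of "k + 1" "2 * n - k - 3" n] k2 unfolding idx Z_def e2 by simp
      have L1: "L (k + 1) = br (\<beta>c * (q * \<nu>)) (br \<beta>z b z) d"
      proof -
        have "L (k + 1) = br (p (w (k + 1) (2 * n - k - 3)) [k+2]) (V (k + 1) (2 * n - k - 3)) d"
          using V_left[of "k + 1" "2 * n - k - 2"] k2 unfolding idx2 d_def e1 e2 by simp
        also have "p (w (k + 1) (2 * n - k - 3)) [k+2] = \<beta>c * (q * \<nu>)"
          unfolding wh p_append_left \<beta>c_def \<nu>_def using q_nz by simp
        finally show ?thesis unfolding h .
      qed
      have y: "y = z * d - \<nu> \<cdot> (d * z)"
        using V_middle[of "k + 2" "2 * n - k - 2"] k2
        unfolding idx2 y_def z_def d_def \<nu>_def e1 e2 Z_def endo.br_def by simp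
      have za: "z * a = r1 \<cdot> (a * z)" and az: "br (p [k] Z) a z = 0"
      proof -
        have "far k (k + 2) (2 * n - k - 3)" using k2 by (auto simp: far_def idx_def)
        then have *: "br r1 z a = 0 \<and> br (p [k] Z) a z = 0"
          unfolding z_def a_def r1_def Z_def using k2 k by (intro V_far) auto
        from *[THEN conjunct1] show "z * a = r1 \<cdot> (a * z)" unfolding endo.br_zero_iff .
        from *[THEN conjunct2] show "br (p [k] Z) a z = 0" .
      qed
      have da: "d * a = r2 \<cdot> (a * d)"
        using x_far[of "k + 2" k] k2 k unfolding d_def a_def r2_def endo.br_zero_iff by simp
      have ad: "br (p [k] [k+2]) a d = 0"
        using x_far[of k "k + 2"] k2 k unfolding d_def a_def by simp
      have rz: "r1 * p [k] Z = 1"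
      proof -
        have "r1 * p [k] Z = F k (2 * n - k - 3) / F k (k + 1)"
          unfolding r1_def Z_def using pp'[of "k + 2" "2 * n - k - 3" k] k k2 by simp
        moreover have "F k (2 * n - k - 3) = 1" "F k (k + 1) = 1" using k k2 by (auto simp: F_def)
        ultimately show ?thesis by simp
      qed
      have rd: "r2 * p [k] [k+2] = 1"
        unfolding r2_def using pp_letters[of "k + 2" k] k k2 by simp
      have bz: "br (q * \<beta>z) b (br \<beta>z b z) = 0"
        using x_V_first[of "k + 1" "2 * n - k - 3"] k k2 p_self[of "k + 1"] unfolding h wh b_def \<beta>z_def
        by (simp add: p_cons_right[of "[Suc k]" "Suc k" Z])
      have bc: "br (q * \<beta>c) b (br \<beta>c b d) = 0"
        using serre_right[of "k + 1"] k k2 unfolding b_def d_def \<beta>c_def by simp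
      have "r2 \<cdot> (t \<cdot> (br t b a * br \<beta>c b d)) = r2 \<cdot> ((\<beta>c * p [k] [k+2]) \<cdot> (br \<beta>c b d * br t b a))"
        by (simp only: endo.serre_brackets_commute[OF bd bc ad qm1])
      moreover have "r2 * (\<beta>c * p [k] [k+2]) = \<beta>c" using rd by (simp add: mult_ac)
      ultimately have dg: "(r2 * t) \<cdot> (br t b a * br \<beta>c b d) = \<beta>c \<cdot> (br \<beta>c b d * br t b a)"
        by (simp only: endo.sc_sc)
      have "r1 \<cdot> (t \<cdot> (br t b a * br \<beta>z b z)) = r1 \<cdot> ((\<beta>z * p [k] Z) \<cdot> (br \<beta>z b z * br t b a))"
        by (simp only: endo.serre_brackets_commute[OF bd bz az qm1])
      moreover have "r1 * (\<beta>z * p [k] Z) = \<beta>z" using rz by (simp add: mult_ac)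
      ultimately have dh: "(r1 * t) \<cdot> (br t b a * br \<beta>z b z) = \<beta>z \<cdot> (br \<beta>z b z * br t b a)"
        by (simp only: endo.sc_sc)
      \<comment> \<open>\<open>e\<close> is the inverse of q N(k + 1). Multiplying the induction
        hypothesis by it makes the coefficient of L_{k+1} equal to 1, the form required by
        \<open>fold_core_step\<close>.\<close>
      define e where "e = q * \<beta>z * \<beta>c"
      have e: "e * (q * Py) = 1" using Pc unfolding e_def c by (simp add: mult_ac)
      have w': "e \<cdot> R (k + 1) = L (k + 1) + e \<cdot> (y * b) - b * y"
      proof -
        have N1: "N (k + 1) = Py" unfolding N_def e1 Py_def Y_def by simp
        have "R (k + 1) - (q * Py) \<cdot> L (k + 1) = 1 \<cdot> (y * b - (q * Py) \<cdot> (b * y))"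
          using less.hyps[of "k + 1"] k k2 unfolding N1 y_def b_def by (simp add: add.assoc)
        then have "R (k + 1) = (q * Py) \<cdot> L (k + 1) + (y * b - (q * Py) \<cdot> (b * y))"
          unfolding endo.sc_one by (simp only: diff_eq_eq add.commute)
        then have "e \<cdot> R (k + 1) = (e * (q * Py)) \<cdot> L (k + 1) + e \<cdot> (y * b) - (e * (q * Py)) \<cdot> (b * y)"
          by (simp only: endo.sc_add_right endo.sc_diff_right endo.sc_sc add_diff_eq)
        then show ?thesis by (simp only: e endo.sc_one)
      qed
      have e0: "e \<noteq> 0" using e by auto
      have "e \<cdot> (L (k + 1) * br t b a) - (t * (r1 * r2)) \<cdot> (br t b a * L (k + 1))
          = br (e * t) b (br (t * (r1 * r2)) (e \<cdot> R (k + 1)) a)"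
        by (rule endo.fold_core_step[OF za da bd dg dh e_def y L1 w'])
      moreover have "t * (r1 * r2) = e * \<theta>"
      proof -
        have "e * \<theta> = (e * (q * Py)) * (t * r)" unfolding \<theta>_def by (simp add: mult_ac)
        then show ?thesis using e r by simp
      qed
      moreover have "br (e * t) b (br (t * (r1 * r2)) (e \<cdot> R (k + 1)) a)
          = e \<cdot> br (c * q * t) b (br (r * t) (R (k + 1)) a)"
        unfolding endo.br_def e_def c r by (simp add: endo.sc_simps)
      ultimately have "e \<cdot> (L (k + 1) * br t b a - \<theta> \<cdot> (br t b a * L (k + 1))
          - br (c * q * t) b (br (r * t) (R (k + 1)) a)) = 0"
        by (simp add: endo.sc_diff_right endo.sc_sc)
      from endo.sc_cancel[OF e0 this] show ?thesis by simp
    qed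
    have "R k = U (k + 1) * a - (q * N k) \<cdot> (a * U (k + 1)) + (q * N k) \<cdot> L k"
      unfolding red core R ..
    then show ?thesis using False by (simp add: endo.sc_one a_def)
  qed
qed

text \<open>The factor 1/q in the definition of the middle element cancels p_kk = q, contributed by
  the first letter of L_k.\<close>

lemma U_left:
  assumes "1 \<le> k" "k < n"
  shows "U k = br (N k) (L k) (x k)"
proof -
  have idx: "idx n (2 * n - k) = k" "idx n k = k" using assms by (auto simp: idx_def)
  have "U k = br (inverse q * p (w k (2 * n - k - 1)) [k]) (L k) (x k)"
    using V_middle[of k "2 * n - k"] assms unfolding idx by simp
  also have "inverse q * p (w k (2 * n - k - 1)) [k] = N k"
    unfolding N_def using assms vw_Cons[of k "2 * n - k - 1" n] p_self[of k] q_nz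
    unfolding idx by (simp add: p_cons_left[of k "w (Suc k) (2 * n - Suc k)"])
  finally show ?thesis .
qed

text \<open>Opens u_k at its first letter although it is defined through its last one. For k = n - 1
  both forms expand to the same words; otherwise the fold identity supplies the hypothesis of
  \<open>middle_step\<close>.\<close>

lemma U_right:
  assumes "1 \<le> k" "k < n"
  shows "U k = br (N' k) (x k) (R k)"
proof (cases "k + 1 = n")
  case True
  have 1: "2 * n - k - 1 = n" "2 * n - k = Suc n" "k + 1 = n" using True by auto
  have idx: "idx n (Suc n) = k" "idx n n = n" "idx n k = k" using True assms by (auto simp: idx_def)
  have "n - 1 = k" "n < 2 * n - k" "k < n" using True assms by auto
  then have L: "L k = br (p [k] [n]) (x k) (x n)"
    unfolding 1 using V_left[of k n] assms idx by (simp add: V_single vw_single)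
  have R: "R k = br (p [n] [k]) (x n) (x k)"
    unfolding 1 using V_right[of n "Suc n"] n2 idx by (simp add: V_single vw_single)
  have N: "N k = p [n] [k]" "N' k = p [k] [n]" unfolding N_def N'_def 1 using idx by (simp_all add: vw_single)
  show ?thesis unfolding U_left[OF assms] L R N endo.br_def by (simp add: endo.sc_simps)
next
  case False
  then have k: "k + 1 < n" "1 \<le> k" using assms by auto
  define c1 c2 s where "c1 = p [k] (w (k + 1) (2 * n - k - 2))" and "c2 = p (w k (2 * n - k - 2)) [k + 1]"
    and "s = p [k] [k + 1]"
  have e1: "2 * n - (k + 1) = 2 * n - k - 1" "2 * n - k - 1 - 1 = 2 * n - k - 2" by auto
  have idx: "idx n (k + 1) = k + 1" "idx n k = k" "idx n (2 * n - k - 1) = k + 1" "idx n (2 * n - k) = k"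
    using k by (auto simp: idx_def)
  have W1: "w (k + 1) (2 * n - k - 1) = w (k + 1) (2 * n - k - 2) @ [k + 1]"
    using k vw_snoc[of "k + 1" "2 * n - k - 1" n] unfolding idx e1 by simp
  have W2: "w k (2 * n - k - 2) = [k] @ w (k + 1) (2 * n - k - 2)"
    using k vw_Cons[of k "2 * n - k - 2" n] unfolding idx by simp
  have W3: "w (k + 1) (2 * n - k - 2) = [k + 1] @ w (k + 2) (2 * n - k - 2)"
    using k vw_Cons[of "k + 1" "2 * n - k - 2" n] unfolding idx by simp
  have P: "N (k + 1) = p (w (k + 2) (2 * n - k - 2)) [k + 1]" unfolding N_def by simp
  have V: "V k (2 * n - k - 2) = br c1 (x k) (L (k + 1))"
    using V_Cons[of k "2 * n - k - 2"] k unfolding idx c1_def e1 by simp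
  have L: "L k = br c2 (br c1 (x k) (L (k + 1))) (x (k + 1))"
    using V_left[of k "2 * n - k - 1"] k unfolding idx c2_def e1 V by simp
  have "L k * x k - N k \<cdot> (x k * L k) = x k * R k - N' k \<cdot> (R k * x k)"
    unfolding L
  proof (rule endo.middle_step[where q = q and s = s and P = "N (k + 1)" and q' = "inverse q"])
    show "br (q * s) (x k) (br s (x k) (x (k + 1))) = 0"
      unfolding s_def using k by (intro serre_right) auto
    have "p [k] (w k (2 * n - k - 2)) = q * c1"
      unfolding W2 c1_def using k p_self[of k] by (subst p_append_right) auto
    then show "br (q * c1) (x k) (br c1 (x k) (L (k + 1))) = 0"
      using x_V_first[of k "2 * n - k - 2"] k unfolding V by simp
    show "N' k = c1 * s"
      unfolding N'_def W1 c1_def s_def using k by (subst p_append_right) auto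
    show "c2 = s * q * N (k + 1)"
      unfolding c2_def W2 W3 P p_append_left s_def using k p_self[of "k + 1"] by (simp add: mult_ac)
    show "q * q * N k * N' k = 1" using NN' assms by blast
    show "q * inverse q = 1" using q_nz by simp
    have U: "L (k + 1) * x (k + 1) - N (k + 1) \<cdot> (x (k + 1) * L (k + 1)) = U (k + 1)"
      using U_left[of "k + 1"] k unfolding endo.br_def by simp
    have "R k - (q * N k) \<cdot> L k = U (k + 1) * x k - (q * N k) \<cdot> (x k * U (k + 1))"
      using fold_identity[of k] assms False by (simp add: endo.sc_one)
    then show "R k = (q * N k) \<cdot> br c2 (br c1 (x k) (L (k + 1))) (x (k + 1)) +
        (L (k + 1) * x (k + 1) - N (k + 1) \<cdot> (x (k + 1) * L (k + 1))) * x k -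
        (q * N k) \<cdot> (x k * (L (k + 1) * x (k + 1) - N (k + 1) \<cdot> (x (k + 1) * L (k + 1))))"
      unfolding U L[symmetric] by (simp only: diff_eq_eq) (simp add: algebra_simps)
  qed
  then show ?thesis unfolding U_left[OF assms] endo.br_def .
qed

end

section \<open>The coproduct\<close>

text \<open>Homogeneity is recorded only through the character by which \<open>f\<close> passes
  group elements, since this is what products in the tensor square involve.\<close>

definition hdeg :: "(nat \<Rightarrow> 'g::ab_group_add \<Rightarrow> 'k::field) \<Rightarrow> nat list \<Rightarrow> ('g, 'k) alg \<Rightarrow> bool" where
  "hdeg chi u f \<longleftrightarrow> (\<forall>g. amul chi f (grp g) = smult (chiw chi u g) (amul chi (grp g) f))"

context uq_sp
begin

abbreviation D where "D i \<equiv> tens (gen i) one + tens (grp (gg i)) (gen i)"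
abbreviation G where "G \<equiv> gkm gg n"
abbreviation \<Delta> where "\<Delta> \<equiv> Delta chi gg"
abbreviation \<tau> where "\<tau> \<equiv> tau n q"
abbreviation tt where "tt g a b \<equiv> tens (grp g \<star> a) b"

lemma hdeg_gen: "hdeg chi [i] (gen i)"
  by (simp add: hdeg_def gen_def grp_def product_single smult_single)

lemma hdeg_one: "hdeg chi [] one"
  by (simp add: hdeg_def one_def grp_def product_single smult_single)

lemma hdeg_amul:
  assumes "hdeg chi u f" "hdeg chi u' f'" "inA n f" "inA n f'"
  shows "hdeg chi (u @ u') (f \<star> f')"
  unfolding hdeg_def
proof
  fix g
  have "f \<star> f' \<star> grp g = f \<star> (f' \<star> grp g)" using assms by (simp add: amul_assoc)
  also have "\<dots> = smult (chiw chi u' g) (f \<star> grp g \<star> f')"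
    by (simp only: assms(2)[unfolded hdeg_def, rule_format] product_smult amul_assoc[OF assms(3)])
  also have "f \<star> grp g = smult (chiw chi u g) (grp g \<star> f)"
    using assms by (simp add: hdeg_def)
  also have "smult (chiw chi u' g) (smult (chiw chi u g) (grp g \<star> f) \<star> f')
      = smult (chiw chi (u @ u') g) (grp g \<star> (f \<star> f'))"
    by (simp add: product_smult amul_assoc smult_smult chiw_append mult.commute)
  finally show "f \<star> f' \<star> grp g = smult (chiw chi (u @ u') g) (grp g \<star> (f \<star> f'))" .
qed

lemma hdeg_smult: "hdeg chi u f \<Longrightarrow> hdeg chi u (smult c f)"
  by (simp add: hdeg_def product_smult smult_smult mult.commute)

lemma hdeg_diff: "hdeg chi u f \<Longrightarrow> hdeg chi u f' \<Longrightarrow> hdeg chi u (f - f')"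
  by (simp add: hdeg_def product_diff smult.scale_right_diff_distrib)

lemma hdeg_swap: "hdeg chi (u @ u') f \<Longrightarrow> hdeg chi (u' @ u) f"
  by (simp add: hdeg_def chiw_append mult.commute)

lemma hdeg_bracket:
  assumes "hdeg chi u f" "hdeg chi u' f'" "inA n f" "inA n f'"
  shows "hdeg chi (u @ u') (f \<star> f' - smult c (f' \<star> f))"
  using assms by (intro hdeg_diff hdeg_smult hdeg_amul hdeg_swap[of u' u])

lemma hdeg_v:
  assumes "1 \<le> k" "k \<le> m" "m < 2 * n"
  shows "hdeg chi (w k m) (v k m)"
  using assms
proof (induction "m - k" arbitrary: k m rule: less_induct)
  case less
  consider "k = m" | "k < m" "m < 2 * n - k" | "k < m" "m = 2 * n - k" | "k < m" "2 * n - k < m"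
    using less.prems by linarith
  then show ?case
  proof cases
    case 1
    then show ?thesis by (simp add: vb_single vw_single hdeg_gen)
  next
    case 2
    have IH: "hdeg chi (w k (m - 1)) (v k (m - 1))" using less 2 by auto
    have w: "w k m = w k (m - 1) @ [idx n m]" using less.prems 2 by (intro vw_snoc) auto
    show ?thesis unfolding w vb_left[OF 2] sbr_def
      using less.prems 2 by (intro hdeg_bracket IH hdeg_gen inA_v inA_gen idx_range) auto
  next
    case 3
    have IH: "hdeg chi (w k (m - 1)) (v k (m - 1))" using less 3 by auto
    have w: "w k m = w k (m - 1) @ [idx n m]" using less.prems 3 by (intro vw_snoc) auto
    show ?thesis unfolding w vb_middle[OF 3]
      using less.prems 3 by (intro hdeg_bracket IH hdeg_gen inA_v inA_gen idx_range) auto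
  next
    case 4
    have IH: "hdeg chi (w (Suc k) m) (v (Suc k) m)" using less 4 by auto
    have w: "w k m = [idx n k] @ w (Suc k) m" using less.prems by (intro vw_Cons) auto
    show ?thesis unfolding w vb_right[OF 4] sbr_def
      using less.prems 4 by (intro hdeg_bracket IH hdeg_gen inA_v inA_gen idx_range) auto
  qed
qed

section \<open>Brackets with the coproduct of a letter\<close>

lemma tmul_assoc_tens:
  assumes "inA n a" "inA n b"
  shows "tmul chi (tmul chi (tens a b) X) Y = tmul chi (tens a b) (tmul chi X Y)"
proof -
  have "set (snd (fst z)) \<subseteq> {1..n} \<and> set (snd (snd z)) \<subseteq> {1..n}" if z: "z \<in> Poly_Mapping.keys (tens a b)" for z
  proof -
    obtain y y' where "z = (y, y')" "y \<in> Poly_Mapping.keys a" "y' \<in> Poly_Mapping.keys b"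
      using z keys_bilin[of Pair "\<lambda>_ _. 1" a b] unfolding tens_bilin by blast
    then show ?thesis using assms by (auto simp: inA_def)
  qed
  then show ?thesis
    unfolding tmul_bilin
    by (intro bilin_assoc) (auto simp: chiw_append chiw_add add.assoc mult_ac)
qed

lemma tmul_D_assoc:
  assumes "i \<in> {1..n}"
  shows "tmul chi (tmul chi (D i) X) Y = tmul chi (D i) (tmul chi X Y)"
  using assms by (simp add: product_add tmul_assoc_tens inA_gen)

lemma delta_basis_snoc: "delta_basis chi gg (g, u @ [i]) = tmul chi (delta_basis chi gg (g, u)) (D i)"
  by (simp add: delta_basis_def)

lemma delta_basis_gen: "i \<in> {1..n} \<Longrightarrow> delta_basis chi gg (0, [i]) = D i"
  by (simp add: delta_basis_def product_add tmul_tens flip: one_def)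

text \<open>\<open>delta_basis\<close> multiplies from the left end of the word to the right, so a
  letter in front has to be pulled out by associativity.\<close>

lemma delta_basis_Cons:
  assumes "i \<in> {1..n}"
  shows "delta_basis chi gg (0, i # u) = tmul chi (D i) (delta_basis chi gg (0, u))"
proof (induction u rule: rev_induct)
  case Nil
  have "delta_basis chi gg (0, []) = tens one one" by (simp add: delta_basis_def one_def)
  then show ?case
    using assms by (simp add: delta_basis_gen product_add tmul_tens amul_one_right inA_gen)
next
  case (snoc j u)
  then show ?case
    using assms delta_basis_snoc[of 0 "i # u" j] by (simp add: delta_basis_snoc tmul_D_assoc)
qed

lemma Delta_gen: "i \<in> {1..n} \<Longrightarrow> \<Delta> (gen i) = D i"
  unfolding gen_def Delta_single by (simp add: delta_basis_gen smult_one flip: gen_def)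

lemma Delta_amul_gen:
  assumes "inA n f" "i \<in> {1..n}"
  shows "\<Delta> (f \<star> gen i) = tmul chi (\<Delta> f) (D i)"
proof (induction f rule: poly_mapping_additive_induct)
  case (2 a c)
  then have "set (snd a) \<subseteq> {1..n}" using assms by (auto simp: inA_def)
  then show ?case
    using delta_basis_snoc[of "fst a" "snd a" i]
    by (simp add: gen_def[of i] product_single Delta_single chiw_zero product_smult)
qed (simp_all add: product_add Delta_add)

lemma Delta_gen_amul:
  assumes "wordy n f" "i \<in> {1..n}"
  shows "\<Delta> (gen i \<star> f) = tmul chi (D i) (\<Delta> f)"
proof (induction f rule: poly_mapping_additive_induct)
  case (2 a c)
  then have "fst a = 0" using assms by (auto simp: wordy_def)
  then show ?case
    using delta_basis_Cons[of i "snd a"] assms(2)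
    by (cases a) (simp add: gen_def[of i] product_single Delta_single chi_zero product_smult)
qed (simp_all add: product_add Delta_add)

definition lstep where "lstep c j X = tmul chi X (D j) - smult c (tmul chi (D j) X)"
definition rstep where "rstep c j X = tmul chi (D j) X - smult c (tmul chi X (D j))"

lemma Delta_lstep:
  assumes "wordy n f" "j \<in> {1..n}"
  shows "\<Delta> (f \<star> gen j - smult c (gen j \<star> f)) = lstep c j (\<Delta> f)"
  using assms by (simp add: lstep_def Delta_diff Delta_smult Delta_amul_gen Delta_gen_amul wordy_inA)

lemma Delta_rstep:
  assumes "wordy n f" "j \<in> {1..n}"
  shows "\<Delta> (gen j \<star> f - smult c (f \<star> gen j)) = rstep c j (\<Delta> f)"
  using assms by (simp add: rstep_def Delta_diff Delta_smult Delta_amul_gen Delta_gen_amul wordy_inA)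

lemma teq_tmul_D:
  assumes "X \<approx> Y" "j \<in> {1..n}"
  shows "tmul chi X (D j) \<approx> tmul chi Y (D j)" "tmul chi (D j) X \<approx> tmul chi (D j) Y"
  unfolding product_add using assms by (auto intro!: teq_add teq_tmul simp: inA_gen)

lemma teq_lstep: "X \<approx> Y \<Longrightarrow> j \<in> {1..n} \<Longrightarrow> lstep c j X \<approx> lstep c j Y"
  unfolding lstep_def by (intro teq_diff teq_smult teq_tmul_D)

lemma teq_rstep: "X \<approx> Y \<Longrightarrow> j \<in> {1..n} \<Longrightarrow> rstep c j X \<approx> rstep c j Y"
  unfolding rstep_def by (intro teq_diff teq_smult teq_tmul_D)

lemma step_add: "lstep c j (X + Y) = lstep c j X + lstep c j Y" "rstep c j (X + Y) = rstep c j X + rstep c j Y"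
  by (simp_all add: lstep_def rstep_def product_add smult_add_right)

lemma step_smult: "lstep c j (smult d X) = smult d (lstep c j X)" "rstep c j (smult d X) = smult d (rstep c j X)"
  by (simp_all add: lstep_def rstep_def product_smult smult.scale_right_diff_distrib smult_smult mult.commute)

lemma step_sum: "lstep c j (sum X S) = (\<Sum>i\<in>S. lstep c j (X i))" "rstep c j (sum X S) = (\<Sum>i\<in>S. rstep c j (X i))"
  by (simp_all add: lstep_def rstep_def tmul_sum smult_sum sum_subtractf)

lemma gen_grp: "gen j \<star> grp g = smult (chi j g) (grp g \<star> gen j)"
  using hdeg_gen[of j] by (simp add: hdeg_def)

lemma grp_grp: "grp g \<star> grp h = grp (g + h)"
  by (simp add: grp_def product_single)

lemma term_right:
  assumes "inA n a" "hdeg chi u a"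
  shows "tmul chi (tt g a b) (tens (gen j) one) = tt g (a \<star> gen j) (b \<star> one)"
    "tmul chi (tt g a b) (tens (grp (gg j)) (gen j)) = smult (p u [j]) (tt (g + gg j) a (b \<star> gen j))"
proof -
  show "tmul chi (tt g a b) (tens (gen j) one) = tt g (a \<star> gen j) (b \<star> one)"
    using assms by (simp add: tmul_tens amul_assoc)
  have "grp g \<star> a \<star> grp (gg j) = grp g \<star> (a \<star> grp (gg j))" by (simp add: amul_assoc)
  also have "\<dots> = smult (p u [j]) (grp g \<star> (grp (gg j) \<star> a))"
    using assms(2) by (simp add: hdeg_def product_smult pw_def)
  also have "grp g \<star> (grp (gg j) \<star> a) = grp (g + gg j) \<star> a"
    by (simp add: grp_grp flip: amul_assoc[OF inA_grp])
  finally show "tmul chi (tt g a b) (tens (grp (gg j)) (gen j)) = smult (p u [j]) (tt (g + gg j) a (b \<star> gen j))"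
    by (simp add: tmul_tens product_smult)
qed

lemma term_left:
  assumes "j \<in> {1..n}"
  shows "tmul chi (tens (gen j) one) (tt g a b) = smult (chi j g) (tt g (gen j \<star> a) b)"
    "tmul chi (tens (grp (gg j)) (gen j)) (tt g a b) = tt (g + gg j) a (gen j \<star> b)"
proof -
  have "gen j \<star> (grp g \<star> a) = (gen j \<star> grp g) \<star> a" using assms by (simp add: amul_assoc inA_gen)
  also have "\<dots> = smult (chi j g) (grp g \<star> (gen j \<star> a))" by (simp add: gen_grp product_smult amul_assoc)
  finally show "tmul chi (tens (gen j) one) (tt g a b) = smult (chi j g) (tt g (gen j \<star> a) b)"
    by (simp add: tmul_tens product_smult)
  have "grp (gg j) \<star> (grp g \<star> a) = grp (g + gg j) \<star> a"
    by (simp add: grp_grp add.commute flip: amul_assoc[OF inA_grp])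
  then show "tmul chi (tens (grp (gg j)) (gen j)) (tt g a b) = tt (g + gg j) a (gen j \<star> b)"
    by (simp add: tmul_tens)
qed

lemma lstep_term:
  assumes "inA n a" "hdeg chi u a" "inA n b" "j \<in> {1..n}"
  shows "lstep c j (tt g a b) = tt g (a \<star> gen j - smult (c * chi j g) (gen j \<star> a)) b
    + tt (g + gg j) a (smult (p u [j]) (b \<star> gen j) - smult c (gen j \<star> b))"
  using assms
  by (simp add: lstep_def product_add term_right term_left product_diff product_smult smult_add_right
      smult_smult amul_one_right algebra_simps)

lemma rstep_term:
  assumes "inA n a" "hdeg chi u a" "inA n b" "j \<in> {1..n}"
  shows "rstep c j (tt g a b) = tt g (smult (chi j g) (gen j \<star> a) - smult c (a \<star> gen j)) b
    + tt (g + gg j) a (gen j \<star> b - smult (c * p u [j]) (b \<star> gen j))"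
  using assms
  by (simp add: rstep_def product_add term_right term_left product_diff product_smult smult_add_right
      smult_smult amul_one_right algebra_simps)

text \<open>The right side of the coproduct formula. The two outer terms are written with
  \<open>tt\<close> as well, so that the rules for a single tensor apply to every term.\<close>

definition cop :: "nat \<Rightarrow> nat \<Rightarrow> ('g, 'k) talg" where
  "cop k m = tt 0 (v k m) one + tt (G k m) one (v k m)
     + (\<Sum>i\<in>{k..<m}. smult (\<tau> k m i * (1 - inverse q)) (tt (G k i) (v (i + 1) m) (v k i)))"

lemma tt_cong:
  assumes "quot a = quot a'" "quot b = quot b'" "inA n a" "inA n a'" "inA n b" "inA n b'"
  shows "tt g a b \<approx> tt g a' b'"
  using assms by (intro teq_tens) (simp_all add: quot_amul inA_amul)

lemma quot_zero: "quot 0 = 0"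
  using quot_smult[of 0 0] by simp

lemma tt_zero_left: "quot a = 0 \<Longrightarrow> inA n a \<Longrightarrow> inA n b \<Longrightarrow> tt g a b \<approx> 0"
  using tt_cong[of a 0 b b g] by (simp add: quot_zero)

lemma tt_zero_right: "quot b = 0 \<Longrightarrow> inA n a \<Longrightarrow> inA n b \<Longrightarrow> tt g a b \<approx> 0"
  using tt_cong[of a a b 0 g] by (simp add: quot_zero)

lemma chi_G: "chi j (G k m) = p [j] (w k m)"
  by (simp add: gkm_def pw_def)

text \<open>The term with x_j in the left factor becomes the new summand i = m. The one with x_j in
  the right factor disappears for c = p(v[k,m], x_j) and survives for the smaller scalar of the
  middle element.\<close>

lemma lstep_cop:
  assumes "1 \<le> k" "k \<le> m" "m < 2 * n" "j \<in> {1..n}"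
  shows "lstep c j (cop k m) = tt 0 (v k m \<star> gen j - smult c (gen j \<star> v k m)) one
    + tt (G k m + gg j) one (v k m \<star> gen j - smult c (gen j \<star> v k m))
    + smult (1 - c * p [j] (w k m)) (tt (G k m) (gen j) (v k m))
    + smult (p (w k m) [j] - c) (tt (gg j) (v k m) (gen j))
    + (\<Sum>i\<in>{k..<m}. smult (\<tau> k m i * (1 - inverse q))
        (tt (G k i) (v (i + 1) m \<star> gen j - smult (c * p [j] (w k i)) (gen j \<star> v (i + 1) m)) (v k i)
       + tt (G k i + gg j) (v (i + 1) m) (smult (p (w (i + 1) m) [j]) (v k i \<star> gen j) - smult c (gen j \<star> v k i))))"
proof -
  have 1: "lstep c j (tt 0 (v k m) one) = tt 0 (v k m \<star> gen j - smult c (gen j \<star> v k m)) one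
      + smult (p (w k m) [j] - c) (tt (gg j) (v k m) (gen j))"
    using assms by (subst lstep_term[OF inA_v hdeg_v])
      (auto simp: chi_zero amul_one_right inA_gen product_diff product_smult smult.scale_left_diff_distrib)
  have 2: "lstep c j (tt (G k m) one (v k m)) = smult (1 - c * p [j] (w k m)) (tt (G k m) (gen j) (v k m))
      + tt (G k m + gg j) one (v k m \<star> gen j - smult c (gen j \<star> v k m))"
    using assms by (subst lstep_term[OF inA_one hdeg_one inA_v])
      (auto simp: chi_G amul_one_right inA_gen product_diff product_smult smult.scale_left_diff_distrib
        smult_one pw_def[of _ _ "[]"])
  have 3: "lstep c j (\<Sum>i\<in>{k..<m}. smult (\<tau> k m i * (1 - inverse q)) (tt (G k i) (v (i + 1) m) (v k i)))
    = (\<Sum>i\<in>{k..<m}. smult (\<tau> k m i * (1 - inverse q))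
        (tt (G k i) (v (i + 1) m \<star> gen j - smult (c * p [j] (w k i)) (gen j \<star> v (i + 1) m)) (v k i)
       + tt (G k i + gg j) (v (i + 1) m) (smult (p (w (i + 1) m) [j]) (v k i \<star> gen j) - smult c (gen j \<star> v k i))))"
    unfolding step_sum step_smult using assms
    by (intro sum.cong refl arg_cong[where f = "smult _"])
      (subst lstep_term[OF inA_v hdeg_v inA_v], auto simp: chi_G)
  show ?thesis unfolding cop_def step_add 1 2 3 by (simp add: algebra_simps)
qed

text \<open>With this scalar the boundary term having x_j in the left factor cancels; the other one
  becomes the first summand once the word has been extended to the left.\<close>

lemma rstep_cop:
  assumes "1 \<le> k" "k \<le> m" "m < 2 * n" "j \<in> {1..n}"
  shows "rstep (p [j] (w k m)) j (cop k m) = tt 0 (gen j \<star> v k m - smult (p [j] (w k m)) (v k m \<star> gen j)) one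
    + tt (G k m + gg j) one (gen j \<star> v k m - smult (p [j] (w k m)) (v k m \<star> gen j))
    + smult (1 - p [j] (w k m) * p (w k m) [j]) (tt (gg j) (v k m) (gen j))
    + (\<Sum>i\<in>{k..<m}. smult (\<tau> k m i * (1 - inverse q))
        (tt (G k i) (smult (p [j] (w k i)) (gen j \<star> v (i + 1) m) - smult (p [j] (w k m)) (v (i + 1) m \<star> gen j)) (v k i)
       + tt (G k i + gg j) (v (i + 1) m)
           (gen j \<star> v k i - smult (p [j] (w k m) * p (w (i + 1) m) [j]) (v k i \<star> gen j))))"
proof -
  let ?c = "p [j] (w k m)"
  have 1: "rstep ?c j (tt 0 (v k m) one) = tt 0 (gen j \<star> v k m - smult ?c (v k m \<star> gen j)) one
      + smult (1 - ?c * p (w k m) [j]) (tt (gg j) (v k m) (gen j))"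
    using assms by (subst rstep_term[OF inA_v hdeg_v])
      (auto simp: chi_zero amul_one_right inA_gen product_diff product_smult smult.scale_left_diff_distrib smult_one)
  have 2: "rstep ?c j (tt (G k m) one (v k m)) = tt (G k m + gg j) one (gen j \<star> v k m - smult ?c (v k m \<star> gen j))"
    using assms by (subst rstep_term[OF inA_one hdeg_one inA_v])
      (auto simp: chi_G amul_one_right inA_gen product_diff product_smult smult_one pw_def[of _ _ "[]"])
  have 3: "rstep ?c j (\<Sum>i\<in>{k..<m}. smult (\<tau> k m i * (1 - inverse q)) (tt (G k i) (v (i + 1) m) (v k i)))
    = (\<Sum>i\<in>{k..<m}. smult (\<tau> k m i * (1 - inverse q))
        (tt (G k i) (smult (p [j] (w k i)) (gen j \<star> v (i + 1) m) - smult ?c (v (i + 1) m \<star> gen j)) (v k i)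
       + tt (G k i + gg j) (v (i + 1) m)
           (gen j \<star> v k i - smult (?c * p (w (i + 1) m) [j]) (v k i \<star> gen j))))"
    unfolding step_sum step_smult using assms
    by (intro sum.cong refl arg_cong[where f = "smult _"])
      (subst rstep_term[OF inA_v hdeg_v inA_v], auto simp: chi_G)
  show ?thesis unfolding cop_def step_add 1 2 3 by (simp add: algebra_simps)
qed


text \<open>\<open>lstep\<close> (\<open>rstep\<close>) turns the \<open>i\<close>-th summand \<open>a \<otimes> b\<close> of \<open>cop k m\<close> into one summand with \<open>a\<close>
  replaced by \<open>lA\<close> (\<open>rA\<close>) and one with \<open>b\<close> replaced by \<open>lB\<close> (\<open>rB\<close>).\<close>

definition lA where "lA c k m j i = v (i + 1) m \<star> gen j - smult (c * p [j] (w k i)) (gen j \<star> v (i + 1) m)"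
definition lB where "lB c k m j i = smult (p (w (i + 1) m) [j]) (v k i \<star> gen j) - smult c (gen j \<star> v k i)"
definition rA where "rA k m j i = smult (p [j] (w k i)) (gen j \<star> v (i + 1) m) - smult (p [j] (w k m)) (v (i + 1) m \<star> gen j)"
definition rB where "rB k m j i = gen j \<star> v k i - smult (p [j] (w k m) * p (w (i + 1) m) [j]) (v k i \<star> gen j)"

context
  fixes k m i j :: nat
  assumes b: "1 \<le> k" "k \<le> i" "i < m" "m < 2 * n" "j \<in> {1..n}"
begin

lemma inA_pieces: "inA n (lA c k m j i)" "inA n (lB c k m j i)" "inA n (rA k m j i)" "inA n (rB k m j i)"
  unfolding lA_def lB_def rA_def rB_def
  using b by (auto intro!: inA_diff inA_smult inA_amul inA_v inA_gen)

lemma quot_lA: "quot (lA c k m j i) = br (c * p [j] (w k i)) (V (i + 1) m) (x j)"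
  unfolding lA_def endo.br_def
  using b inA_v[of "i + 1" m] by (simp add: inA_gen quot_diff quot_smult quot_amul)

lemma quot_lB: "quot (lB c k m j i) = p (w (i + 1) m) [j] \<cdot> (V k i * x j) - c \<cdot> (x j * V k i)"
  unfolding lB_def
  using b inA_v[of k i] by (simp add: inA_gen quot_diff quot_smult quot_amul)

lemma quot_rA:
  "quot (rA k m j i) = p [j] (w k i) \<cdot> br (p [j] (w (i + 1) m)) (x j) (V (i + 1) m)"
proof -
  have "p [j] (w k m) = p [j] (w k i) * p [j] (w (i + 1) m)"
    using b vw_append[of k i m n] by (simp add: p_append_right)
  then show ?thesis
    unfolding rA_def endo.br_def
    using b inA_v[of "i + 1" m]
    by (simp add: inA_gen quot_diff quot_smult quot_amul endo.sc_diff_right endo.sc_sc)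
qed

lemma quot_rB: "quot (rB k m j i) = br (p [j] (w k m) * p (w (i + 1) m) [j]) (x j) (V k i)"
  unfolding rB_def endo.br_def
  using b inA_v[of k i] by (simp add: inA_gen quot_diff quot_smult quot_amul)

text \<open>For c = p(v[k,m], x_j) the bracket in \<open>lA\<close> has the scalar expected for
  v[i+1,m] and x_j up to the ratio of values of \<open>F\<close>. Only near x_j or its mirror image
  can that ratio vary with \<open>i\<close>.\<close>

lemma coeff_left: "p (w k m) [j] * p [j] (w k i) = F j i / F j (k - 1) * p (w (i + 1) m) [j]"
proof -
  have "p (w k m) [j] = p (w k i) [j] * p (w (i + 1) m) [j]"
    using b vw_append[of k i m n] by (simp add: p_append_left)
  then have "p (w k m) [j] * p [j] (w k i) = p (w k i) [j] * p [j] (w k i) * p (w (i + 1) m) [j]"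
    by (simp only: mult_ac)
  also have "p (w k i) [j] * p [j] (w k i) = F j i / F j (k - 1)" using b by (intro pp') auto
  finally show ?thesis .
qed

text \<open>The analogue for \<open>rB\<close>: the expected scalar p(x_j, v[k,i]) is corrected by
  the ratio of \<open>F\<close> at \<open>m\<close> and at \<open>i\<close>.\<close>

lemma coeff_right: "p [j] (w k m) * p (w (i + 1) m) [j] = F j m / F j i * p [j] (w k i)"
proof -
  have "p [j] (w k m) = p [j] (w k i) * p [j] (w (i + 1) m)"
    using b vw_append[of k i m n] by (simp add: p_append_right)
  then have "p [j] (w k m) * p (w (i + 1) m) [j] = p (w (i + 1) m) [j] * p [j] (w (i + 1) m) * p [j] (w k i)"
    by (simp only: mult_ac)
  also have "p (w (i + 1) m) [j] * p [j] (w (i + 1) m) = F j m / F j i"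
    using b pp'[of "i + 1" m j] by simp
  finally show ?thesis .
qed

lemma quot_lB_zero:
  assumes "br (p (w k i) [j]) (V k i) (x j) = 0"
  shows "quot (lB (p (w k m) [j]) k m j i) = 0"
proof -
  have "p (w k m) [j] = p (w (i + 1) m) [j] * p (w k i) [j]"
    using b vw_append[of k i m n] by (simp add: p_append_left)
  then show ?thesis
    using assms unfolding quot_lB endo.br_zero_iff by (simp add: endo.sc_sc)
qed

end

lemma G_snoc: "k \<le> m \<Longrightarrow> G k (m + 1) = G k m + gg (idx n (m + 1))"
  using vw_snoc[of k "m + 1" n] by (simp add: gkm_def gw_append)

lemma G_Cons: "k \<le> m \<Longrightarrow> G k m = gg (idx n k) + G (k + 1) m"
  using vw_Cons[of k m n] gw_append[of gg "[idx n k]"] by (simp add: gkm_def)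

lemma G_single: "G k k = gg (idx n k)"
  by (simp add: gkm_def vw_single)

section \<open>Inductive steps for the coproduct\<close>

lemma left_combine:
  assumes k: "1 \<le> k" "k \<le> m" "m + 1 < 2 * n" and j: "j = idx n (m + 1)"
    and IH: "\<Delta> (v k m) \<approx> cop k m"
    and v: "v k (m + 1) = v k m \<star> gen j - smult c (gen j \<star> v k m)"
    and bnd: "1 - c * p [j] (w k m) = \<tau> k (m + 1) m * (1 - inverse q)"
    and S: "smult (p (w k m) [j] - c) (tt (gg j) (v k m) (gen j))
      + (\<Sum>i\<in>{k..<m}. smult (\<tau> k m i * (1 - inverse q))
          (tt (G k i) (lA c k m j i) (v k i) + tt (G k i + gg j) (v (i + 1) m) (lB c k m j i)))
      \<approx> (\<Sum>i\<in>{k..<m}. smult (\<tau> k (m + 1) i * (1 - inverse q)) (tt (G k i) (v (i + 1) (m + 1)) (v k i)))"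
  shows "\<Delta> (v k (m + 1)) \<approx> cop k (m + 1)"
proof -
  have jn: "j \<in> {1..n}" unfolding j using k by (intro idx_range) auto
  have "\<Delta> (v k (m + 1)) = lstep c j (\<Delta> (v k m))"
    unfolding v using k jn by (intro Delta_lstep wordy_vb) auto
  also have "\<dots> \<approx> lstep c j (cop k m)" by (rule teq_lstep[OF IH jn])
  also have "lstep c j (cop k m) = tt 0 (v k (m + 1)) one + tt (G k (m + 1)) one (v k (m + 1))
    + smult (\<tau> k (m + 1) m * (1 - inverse q)) (tt (G k m) (v (m + 1) (m + 1)) (v k m))
    + (smult (p (w k m) [j] - c) (tt (gg j) (v k m) (gen j))
    + (\<Sum>i\<in>{k..<m}. smult (\<tau> k m i * (1 - inverse q))
          (tt (G k i) (lA c k m j i) (v k i) + tt (G k i + gg j) (v (i + 1) m) (lB c k m j i))))"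
    using k jn unfolding lA_def lB_def bnd[symmetric] G_snoc[OF k(2)] vb_single j[symmetric]
    by (subst lstep_cop) (simp_all add: v[simplified] add.assoc)
  also have "\<dots> \<approx> tt 0 (v k (m + 1)) one + tt (G k (m + 1)) one (v k (m + 1))
    + smult (\<tau> k (m + 1) m * (1 - inverse q)) (tt (G k m) (v (m + 1) (m + 1)) (v k m))
    + (\<Sum>i\<in>{k..<m}. smult (\<tau> k (m + 1) i * (1 - inverse q)) (tt (G k i) (v (i + 1) (m + 1)) (v k i)))"
    by (intro teq_add S teq_refl)
  also have "\<dots> = cop k (m + 1)"
    using k by (simp add: cop_def add.assoc add.left_commute add.commute)
  finally show ?thesis .
qed

lemma right_combine:
  assumes k: "1 \<le> k" "k < m" "m < 2 * n" "2 * n - k < m" and j: "j = idx n k"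
    and IH: "\<Delta> (v (k + 1) m) \<approx> cop (k + 1) m"
    and bnd: "1 - p [j] (w (k + 1) m) * p (w (k + 1) m) [j] = \<tau> k m k * (1 - inverse q)"
    and S: "(\<Sum>i\<in>{k + 1..<m}. smult (\<tau> (k + 1) m i * (1 - inverse q))
          (tt (G (k + 1) i) (rA (k + 1) m j i) (v (k + 1) i) + tt (G (k + 1) i + gg j) (v (i + 1) m) (rB (k + 1) m j i)))
      \<approx> (\<Sum>i\<in>{k + 1..<m}. smult (\<tau> k m i * (1 - inverse q)) (tt (G k i) (v (i + 1) m) (v k i)))"
  shows "\<Delta> (v k m) \<approx> cop k m"
proof -
  have jn: "j \<in> {1..n}" unfolding j using k by (intro idx_range) auto
  let ?c = "p [j] (w (k + 1) m)"
  have v: "v k m = gen j \<star> v (k + 1) m - smult ?c (v (k + 1) m \<star> gen j)"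
    using vb_right[OF k(2,4), of chi gg q] unfolding j sbr_def by simp
  have "\<Delta> (v k m) = rstep ?c j (\<Delta> (v (k + 1) m))"
    unfolding v using k jn by (intro Delta_rstep wordy_vb) auto
  also have "\<dots> \<approx> rstep ?c j (cop (k + 1) m)" by (rule teq_rstep[OF IH jn])
  also have "rstep ?c j (cop (k + 1) m) = tt 0 (v k m) one + tt (G k m) one (v k m)
    + smult (\<tau> k m k * (1 - inverse q)) (tt (G k k) (v (k + 1) m) (v k k))
    + (\<Sum>i\<in>{k + 1..<m}. smult (\<tau> (k + 1) m i * (1 - inverse q))
          (tt (G (k + 1) i) (rA (k + 1) m j i) (v (k + 1) i) + tt (G (k + 1) i + gg j) (v (i + 1) m) (rB (k + 1) m j i)))"
  proof -
    have "G k m = G (k + 1) m + gg j" using G_Cons[of k m] k unfolding j by (simp add: add.commute)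
    then show ?thesis
      using k jn unfolding rA_def rB_def bnd[symmetric] G_single vb_single j[symmetric]
      by (subst rstep_cop) (simp_all add: v add.assoc)
  qed
  also have "\<dots> \<approx> tt 0 (v k m) one + tt (G k m) one (v k m)
    + smult (\<tau> k m k * (1 - inverse q)) (tt (G k k) (v (k + 1) m) (v k k))
    + (\<Sum>i\<in>{k + 1..<m}. smult (\<tau> k m i * (1 - inverse q)) (tt (G k i) (v (i + 1) m) (v k i)))"
    by (intro teq_add S teq_refl)
  also have "\<dots> = cop k m"
    using k by (simp add: cop_def add.assoc sum.atLeast_Suc_lessThan[of k m])
  finally show ?thesis .
qed

lemma tt_split: "quot a = quot a' \<Longrightarrow> quot b = 0 \<Longrightarrow> inA n a \<Longrightarrow> inA n a' \<Longrightarrow> inA n b \<Longrightarrow> inA n y \<Longrightarrow> inA n z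
  \<Longrightarrow> tt g a z + tt h y b \<approx> tt g a' z"
  using teq_add[OF tt_cong[of a a' z z g] tt_zero_right[of b y h]] by simp

lemma tt_split': "quot b = quot b' \<Longrightarrow> quot a = 0 \<Longrightarrow> inA n a \<Longrightarrow> inA n b' \<Longrightarrow> inA n b \<Longrightarrow> inA n y \<Longrightarrow> inA n z
  \<Longrightarrow> tt g a z + tt h y b \<approx> tt h y b'"
  using teq_add[OF tt_zero_left[of a z g] tt_cong[of y y b b' h]] by simp

lemma Delta_left_short:
  assumes k: "1 \<le> k" "k \<le> m" "m + 1 \<le> n" and IH: "\<Delta> (v k m) \<approx> cop k m"
  shows "\<Delta> (v k (m + 1)) \<approx> cop k (m + 1)"
proof -
  define j where "j = m + 1"
  have j: "j = idx n (m + 1)" "j \<in> {1..n}" using k n2 by (auto simp: idx_def j_def)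
  have F0: "F j (k - 1) = 1" using k by (auto simp: F_def j_def)
  show ?thesis
  proof (rule left_combine[where j = j and c = "p (w k m) [j]"])
    show "v k (m + 1) = v k m \<star> gen j - smult (p (w k m) [j]) (gen j \<star> v k m)"
      using k n2 vb_left[of k "m + 1" n chi gg q] unfolding j(1)[symmetric] sbr_def by simp
    have "p (w k m) [j] * p [j] (w k m) = F j m" using pp[of k m j] k j n2 F0 by simp
    \<comment> \<open>For m + 1 = n the value of \<open>F\<close> is 1/q^2, and 1 - 1/q^2 = (1 +
      1/q)(1 - 1/q) produces the exceptional coefficient at i = n - 1.\<close>
    moreover have "1 - F j m = \<tau> k (m + 1) m * (1 - inverse q)"
      using k n2 by (auto simp: F_def j_def tau_def power2_eq_square algebra_simps)
    ultimately show "1 - p (w k m) [j] * p [j] (w k m) = \<tau> k (m + 1) m * (1 - inverse q)" by simp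
    have "smult (\<tau> k m i * (1 - inverse q)) (tt (G k i) (lA (p (w k m) [j]) k m j i) (v k i)
          + tt (G k i + gg j) (v (i + 1) m) (lB (p (w k m) [j]) k m j i))
        \<approx> smult (\<tau> k (m + 1) i * (1 - inverse q)) (tt (G k i) (v (i + 1) (m + 1)) (v k i))"
      if "i \<in> {k..<m}" for i
    proof -
      have i: "1 \<le> k" "k \<le> i" "i < m" "m < 2 * n" "j \<in> {1..n}" using that k j n2 by auto
      have \<tau>: "\<tau> k m i = 1" "\<tau> k (m + 1) i = 1" using i k by (auto simp: tau_def)
      have "F j i = 1" using i k by (auto simp: F_def j_def)
      then have "quot (lA (p (w k m) [j]) k m j i) = V (i + 1) (m + 1)"
        unfolding quot_lA[OF i] coeff_left[OF i] F0 using V_left[of "i + 1" "m + 1"] i k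
        unfolding j(1)[symmetric] by simp
      moreover have "far j k i" using i k by (auto simp: far_def idx_def j_def)
      then have "quot (lB (p (w k m) [j]) k m j i) = 0"
        using i k by (intro quot_lB_zero[OF i] V_far[THEN conjunct1]) auto
      ultimately show ?thesis
        unfolding \<tau> using i k n2 by (intro teq_smult tt_split inA_pieces inA_v) auto
    qed
    then show "smult (p (w k m) [j] - p (w k m) [j]) (tt (gg j) (v k m) (gen j))
      + (\<Sum>i\<in>{k..<m}. smult (\<tau> k m i * (1 - inverse q))
          (tt (G k i) (lA (p (w k m) [j]) k m j i) (v k i) + tt (G k i + gg j) (v (i + 1) m) (lB (p (w k m) [j]) k m j i)))
      \<approx> (\<Sum>i\<in>{k..<m}. smult (\<tau> k (m + 1) i * (1 - inverse q)) (tt (G k i) (v (i + 1) (m + 1)) (v k i)))"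
      unfolding diff_self smult_zero_left add_0_left by (rule teq_sum)
  qed (use k n2 j IH in auto)
qed

lemma teq_sum_absorb:
  assumes "finite S" "b \<in> S" "f b \<approx> h b - X" "\<And>i. i \<in> S \<Longrightarrow> i \<noteq> b \<Longrightarrow> f i \<approx> h i"
  shows "X + sum f S \<approx> sum h S"
proof -
  have "sum f (S - {b}) \<approx> sum h (S - {b})" using assms by (intro teq_sum) auto
  then have "X + (f b + sum f (S - {b})) \<approx> X + ((h b - X) + sum h (S - {b}))"
    using assms by (intro teq_add teq_refl)
  then show ?thesis using assms by (simp add: sum.remove[of S b])
qed

text \<open>Used where two neighbouring summands each differ from the expected value, by the same
  tensor with opposite signs.\<close>

lemma teq_sum_shift:
  assumes "finite S" "a \<in> S" "b \<in> S" "a \<noteq> b" "f a \<approx> h a + X" "f b \<approx> h b - X"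
    "\<And>i. i \<in> S \<Longrightarrow> i \<noteq> a \<Longrightarrow> i \<noteq> b \<Longrightarrow> f i \<approx> h i"
  shows "sum f S \<approx> sum h S"
proof -
  have 1: "X + sum f (S - {a}) \<approx> sum h (S - {a})"
    using assms by (intro teq_sum_absorb[where b = b]) auto
  have "f a + sum f (S - {a}) \<approx> h a + X + sum f (S - {a})"
    using assms by (intro teq_add teq_refl)
  also have "\<dots> = h a + (X + sum f (S - {a}))" by (simp add: add.assoc)
  also have "\<dots> \<approx> h a + sum h (S - {a})" by (intro teq_add teq_refl 1)
  finally show ?thesis using assms by (simp add: sum.remove[of S a])
qed

lemma p_L: "1 \<le> j \<Longrightarrow> j < n \<Longrightarrow> p (w j (2 * n - j - 1)) [j] = q * N j"
  using vw_Cons[of j "2 * n - j - 1" n] p_self[of j]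
  by (simp add: N_def p_append_left p_cons_left[of j "w (Suc j) (2 * n - Suc j)"] idx_def)

lemma p_R:
  assumes "1 \<le> j" "j < n"
  shows "p [j] (w (j + 1) (2 * n - j)) = q * N' j"
proof -
  have idx: "idx n (2 * n - j) = j" using assms by (auto simp: idx_def)
  have "w (j + 1) (2 * n - j) = w (j + 1) (2 * n - j - 1) @ [j]"
    using vw_snoc[of "j + 1" "2 * n - j" n] assms unfolding idx by simp
  then show ?thesis
    using p_self[of j] assms by (simp add: N'_def p_append_right mult.commute)
qed

abbreviation \<kappa> where "\<kappa> j \<equiv> if j + 1 = n then 1 + inverse q else 1 :: 'k"

text \<open>In this summand the left factor is u_{j+1}, and x_j is bracketed with it using the
  scalar q N(j). The coefficient \<open>\<tau>\<close> supplies exactly the kappa of the fold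
  identity, which turns the bracket into R_j - q N(j) L_j.\<close>

lemma fold_term_left:
  assumes "1 \<le> k" "k \<le> j" "j < n" "m + j + 1 = 2 * n" "\<tau> k m j = \<kappa> j" "c * p [j] (w k j) = q * N j"
    and lB: "quot (lB c k m j j) = 0"
  shows "smult (\<tau> k m j * (1 - inverse q)) (tt (G k j) (lA c k m j j) (v k j) + tt (G k j + gg j) (v (j + 1) m) (lB c k m j j))
    \<approx> smult (1 - inverse q) (tt (G k j) (v (j + 1) (m + 1)) (v k j))
      - smult (1 - inverse q) (smult (q * N j) (tt (G k j) (v j m) (v k j)))"
proof -
  have i: "1 \<le> k" "k \<le> j" "j < m" "m < 2 * n" "j \<in> {1..n}" using assms by auto
  have m: "m = 2 * n - j - 1" "m = 2 * n - (j + 1)" "m + 1 = 2 * n - j" using assms by auto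
  have "\<kappa> j \<cdot> quot (lA c k m j j) = \<kappa> j \<cdot> (V (j + 1) m * x j - (q * N j) \<cdot> (x j * V (j + 1) m))"
    unfolding quot_lA[OF i] assms(6) endo.br_def ..
  also have "\<dots> = V (j + 1) (m + 1) - (q * N j) \<cdot> V j m"
    using fold_identity[of j] assms(1-3) unfolding m(3) m(1)[symmetric] m(2)[symmetric] by simp
  finally have A: "quot (smult (\<kappa> j) (lA c k m j j)) = quot (v (j + 1) (m + 1) - smult (q * N j) (v j m))"
    by (simp only: quot_diff quot_smult)
  have "tt (G k j) (smult (\<kappa> j) (lA c k m j j)) (v k j) + tt (G k j + gg j) (v (j + 1) m) (smult (\<kappa> j) (lB c k m j j))
      \<approx> tt (G k j) (v (j + 1) (m + 1) - smult (q * N j) (v j m)) (v k j)"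
    using i assms by (intro tt_split A inA_diff inA_smult inA_pieces inA_v) (auto simp: quot_smult lB)
  from teq_smult[OF this, of "1 - inverse q"] show ?thesis
    unfolding assms(5) by (simp only: product_smult product_diff smult_smult smult_add_right
        smult.scale_right_diff_distrib mult.commute mult.left_commute)
qed

lemma Delta_left_long:
  assumes k: "1 \<le> k" "n \<le> m" "m + 1 < 2 * n - k" and IH: "\<Delta> (v k m) \<approx> cop k m"
  shows "\<Delta> (v k (m + 1)) \<approx> cop k (m + 1)"
proof -
  define j where "j = 2 * n - m - 1"
  have jk: "k < j" "j < n" "m + j + 1 = 2 * n" using k by (auto simp: j_def)
  have j: "j = idx n (m + 1)" "j \<in> {1..n}" using k jk by (auto simp: idx_def)
  have m: "m = 2 * n - j - 1" "m + 1 = 2 * n - j" using jk by auto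
  define c where "c = p (w k m) [j]"
  have F0: "F j (k - 1) = 1" using k jk by (auto simp: F_def)
  show ?thesis
  proof (rule left_combine[where j = j and c = c])
    show "v k (m + 1) = v k m \<star> gen j - smult c (gen j \<star> v k m)"
      using k vb_left[of k "m + 1" n chi gg q] unfolding j(1)[symmetric] sbr_def c_def by simp
    have "c * p [j] (w k m) = F j m" using pp[of k m j] k j F0 by (simp add: c_def)
    moreover have "F j m = inverse q" "\<tau> k (m + 1) m = 1" using k jk by (auto simp: F_def tau_def)
    ultimately show "1 - c * p [j] (w k m) = \<tau> k (m + 1) m * (1 - inverse q)" by simp
    define X where "X = smult (1 - inverse q) (smult (q * N j) (tt (G k j) (v j m) (v k j)))"
    define f where "f = (\<lambda>i. smult (\<tau> k m i * (1 - inverse q)) (tt (G k i) (lA c k m j i) (v k i)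
          + tt (G k i + gg j) (v (i + 1) m) (lB c k m j i)))"
    define h where "h = (\<lambda>i. smult (\<tau> k (m + 1) i * (1 - inverse q)) (tt (G k i) (v (i + 1) (m + 1)) (v k i)))"
    have \<tau>': "\<tau> k (m + 1) i = 1" if "i < m" for i using that k by (auto simp: tau_def)
    have \<tau>: "\<tau> k m i = 1" if "i < m" "i \<noteq> j" for i using that k jk by (auto simp: tau_def)
    have \<tau>j: "\<tau> k m j = \<kappa> j" using k jk by (auto simp: tau_def)
    \<comment> \<open>The defective summands are i = j - 1 and i = j, on either side of the first
      x_j in the word. All others have the right scalar.\<close>
    have "sum f {k..<m} \<approx> sum h {k..<m}"
    proof (rule teq_sum_shift[where a = "j - 1" and b = j and X = X])
      show "finite {k..<m}" "j - 1 \<in> {k..<m}" "j \<in> {k..<m}" "j - 1 \<noteq> j" using k jk by auto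
      have "c * p [j] (w k j) = q * N j"
        using coeff_left[of k j m j] k jk F0 unfolding c_def by (simp add: F_def N_def m(1))
      moreover have "quot (lB c k m j j) = 0"
        unfolding c_def using k jk by (intro quot_lB_zero V_x_last) auto
      ultimately show "f j \<approx> h j - X"
        unfolding f_def h_def X_def using fold_term_left[of k j m c] k jk \<tau>' \<tau>j by simp
      have i: "1 \<le> k" "k \<le> j - 1" "j - 1 < m" "m < 2 * n" "j \<in> {1..n}" using k jk by auto
      have jj: "j - 1 + 1 = j" using jk by simp
      \<comment> \<open>The correction 1/q is precisely the one in the definition of the middle
        element, so the left factor becomes u_j. The right factor ends just before x_j and therefore
        does not pass it: the bracket there yields q N(j) v[k,j].\<close>
      have "F j (j - 1) = inverse q" using jk by (auto simp: F_def)
      then have "quot (lA c k m j (j - 1)) = br (inverse q * p (w j m) [j]) (V j m) (x j)"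
        unfolding quot_lA[OF i] unfolding c_def coeff_left[OF i] F0 jj by simp
      also have "\<dots> = V j (m + 1)"
        using V_middle[of j "m + 1"] jk k m(2) unfolding j(1)[symmetric] by simp
      finally have A: "quot (lA c k m j (j - 1)) = V j (m + 1)" .
      have wk: "p (w k m) [j] = p (w j m) [j] * p (w k (j - 1)) [j]"
        using vw_append[of k "j - 1" m n] i jk by (simp add: p_append_left)
      have "V k j = br (p (w k (j - 1)) [j]) (V k (j - 1)) (x j)"
        using V_left[of k j] k jk by (simp add: idx_def)
      then have B: "quot (lB c k m j (j - 1)) = quot (smult (q * N j) (v k j))"
        unfolding quot_lB[OF i] c_def jj wk quot_smult p_L[of j, folded m(1)]
        using p_L[of j, folded m(1)] jk k by (simp add: endo.br_def endo.sc_diff_right endo.sc_sc)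
      have G: "G k (j - 1) + gg j = G k j"
        using G_snoc[of k "j - 1"] i jk by (simp add: idx_def)
      have "tt (G k (j - 1)) (lA c k m j (j - 1)) (v k (j - 1)) + tt (G k (j - 1) + gg j) (v j m) (lB c k m j (j - 1))
         \<approx> tt (G k (j - 1)) (v j (m + 1)) (v k (j - 1)) + tt (G k (j - 1) + gg j) (v j m) (smult (q * N j) (v k j))"
        using i jk k by (intro teq_add tt_cong A B inA_pieces inA_smult inA_v) auto
      from teq_smult[OF this, of "1 - inverse q"] show "f (j - 1) \<approx> h (j - 1) + X"
        unfolding f_def h_def X_def jj G
        using \<tau>[of "j - 1"] \<tau>'[of "j - 1"] i jk
        by (simp add: product_smult smult_add_right smult_smult)
    next
      fix i assume i': "i \<in> {k..<m}" "i \<noteq> j - 1" "i \<noteq> j"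
      then have i: "1 \<le> k" "k \<le> i" "i < m" "m < 2 * n" "j \<in> {1..n}" using k j by auto
      have "F j i = 1" using i' jk by (auto simp: F_def)
      then have A1: "quot (lA c k m j i) = br (p (w (i + 1) m) [j]) (V (i + 1) m) (x j)"
        unfolding quot_lA[OF i] unfolding c_def coeff_left[OF i] F0 by simp
      \<comment> \<open>For i < j - 1 the extended left factor is still left-normed by definition.
        For i > j its word starts after the first x_j, so m + 1 lies beyond its mirror point and the
        last letter is attached by \<open>V_snoc\<close>.\<close>
      have "quot (lA c k m j i) = V (i + 1) (m + 1) \<and> br (p (w k i) [j]) (V k i) (x j) = 0"
      proof (cases "i < j")
        case True
        then have ij: "i + 1 < j" using i' by auto
        have "far j k i" using ij jk by (auto simp: far_def idx_def)
        then have "br (p (w k i) [j]) (V k i) (x j) = 0" using i by (intro V_far[THEN conjunct1]) auto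
        moreover have "V (i + 1) (m + 1) = br (p (w (i + 1) m) [j]) (V (i + 1) m) (x j)"
          using V_left[of "i + 1" "m + 1"] ij jk i unfolding j(1)[symmetric] by simp
        ultimately show ?thesis using A1 by simp
      next
        case False
        then have ij: "j < i" using i' by auto
        have "br (p (w k i) [j]) (V k i) (x j) = 0" using ij i jk by (intro V_x_inner) auto
        moreover have "2 * n - (i + 1) + 1 < m + 1" using ij i jk by linarith
        then have "V (i + 1) (m + 1) = br (p (w (i + 1) m) [j]) (V (i + 1) m) (x j)"
          using V_snoc[of "i + 1" "m + 1"] ij jk i k unfolding j(1)[symmetric] by simp
        ultimately show ?thesis using A1 by simp
      qed
      then have "quot (lA c k m j i) = V (i + 1) (m + 1)" "quot (lB c k m j i) = 0"
        unfolding c_def using quot_lB_zero[OF i] by auto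
      then show "f i \<approx> h i"
        unfolding f_def h_def \<tau>[OF i(3) i'(3)] \<tau>'[OF i(3)]
        using i k by (intro teq_smult tt_split inA_pieces inA_v) auto
    qed
    then show "smult (p (w k m) [j] - c) (tt (gg j) (v k m) (gen j))
      + (\<Sum>i\<in>{k..<m}. smult (\<tau> k m i * (1 - inverse q))
          (tt (G k i) (lA c k m j i) (v k i) + tt (G k i + gg j) (v (i + 1) m) (lB c k m j i)))
      \<approx> (\<Sum>i\<in>{k..<m}. smult (\<tau> k (m + 1) i * (1 - inverse q)) (tt (G k i) (v (i + 1) (m + 1)) (v k i)))"
      unfolding c_def[symmetric] diff_self smult_zero_left add_0_left f_def h_def .
  qed (use k j IH in auto)
qed


lemma Delta_middle:
  assumes k: "1 \<le> k" "k < n" and m: "m + 1 = 2 * n - k" and IH: "\<Delta> (v k m) \<approx> cop k m"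
  shows "\<Delta> (v k (m + 1)) \<approx> cop k (m + 1)"
proof -
  have j: "idx n (m + 1) = k" "k \<in> {1..n}" "idx n k = k" using k m by (auto simp: idx_def)
  have m': "m = 2 * n - k - 1" "k < m" "m < 2 * n" "n \<le> m" using m k by auto
  have c: "inverse q * p (w k m) [k] = N k" using p_L[of k] k q_nz by (simp add: m'(1))
  \<comment> \<open>The word now starts with x_k itself, so the reference value of \<open>F\<close>
    is 1/q and the generic ratio is q; this is cancelled by the 1/q contained in
    \<open>N k\<close>.\<close>
  have F0: "F k (k - 1) = inverse q" using k by (auto simp: F_def)
  have Fm: "F k m = inverse q" using k m by (auto simp: F_def)
  show ?thesis
  proof (rule left_combine[where j = k and c = "N k"])
    show "v k (m + 1) = v k m \<star> gen k - smult (N k) (gen k \<star> v k m)"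
      using k m m' vb_middle[of k "m + 1" n chi gg q] unfolding j(1) c[symmetric] by simp
    have "N k * p [k] (w k m) = p (w k m) [k] * p [k] (w k m) * F k (k - 1)"
      unfolding c[symmetric] F0 by simp
    also have "\<dots> = inverse q" using pp[of k m k] k m' j Fm by simp
    finally show "1 - N k * p [k] (w k m) = \<tau> k (m + 1) m * (1 - inverse q)"
      using k m' by (auto simp: tau_def)
    define X where "X = smult (1 - inverse q) (smult (q * N k) (tt (G k k) (v k m) (v k k)))"
    define f where "f = (\<lambda>i. smult (\<tau> k m i * (1 - inverse q)) (tt (G k i) (lA (N k) k m k i) (v k i)
          + tt (G k i + gg k) (v (i + 1) m) (lB (N k) k m k i)))"
    define h where "h = (\<lambda>i. smult (\<tau> k (m + 1) i * (1 - inverse q)) (tt (G k i) (v (i + 1) (m + 1)) (v k i)))"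
    have \<tau>': "\<tau> k (m + 1) i = 1" if "i < m" for i using that k m m' by (auto simp: tau_def)
    have \<tau>: "\<tau> k m i = 1" if "i < m" "i \<noteq> k" for i using that k m m' by (auto simp: tau_def)
    have \<tau>j: "\<tau> k m k = \<kappa> k" using k m m' by (auto simp: tau_def)
    have "X + sum f {k..<m} \<approx> sum h {k..<m}"
    proof (rule teq_sum_absorb[where b = k])
      show "finite {k..<m}" "k \<in> {k..<m}" using m' by auto
      have i: "1 \<le> k" "k \<le> k" "k < m" "m < 2 * n" "k \<in> {1..n}" using k m' by auto
      have pk: "p (w (k + 1) m) [k] = N k" unfolding N_def m'(1) ..
      have "quot (lB (N k) k m k k) = 0"
        unfolding quot_lB[OF i] pk V_single j(3) by simp
      then show "f k \<approx> h k - X"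
        unfolding f_def h_def X_def
        using fold_term_left[of k k m "N k"] k m m' \<tau>' \<tau>j j(3) p_self[of k]
        by (simp add: vw_single mult.commute)
    next
      fix i assume i': "i \<in> {k..<m}" "i \<noteq> k"
      then have i: "1 \<le> k" "k \<le> i" "i < m" "m < 2 * n" "k \<in> {1..n}" and ki: "k < i" using k m' j by auto
      have "F k i = 1" using i' m k by (auto simp: F_def)
      then have e: "N k * p [k] (w k i) = p (w (i + 1) m) [k]"
        unfolding c[symmetric] using coeff_left[OF i] F0 q_nz by (simp add: mult.assoc)
      have "2 * n - (i + 1) + 1 < m + 1" using ki i m k by linarith
      then have A: "quot (lA (N k) k m k i) = V (i + 1) (m + 1)"
        unfolding quot_lA[OF i] e
        using V_snoc[of "i + 1" "m + 1"] i k m unfolding j(1) by simp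
      have "x k * V k i = p [k] (w k i) \<cdot> (V k i * x k)"
        using x_V_first[of k i] ki i m unfolding endo.br_zero_iff by simp
      then have "quot (lB (N k) k m k i) = 0"
        unfolding quot_lB[OF i] by (simp add: endo.sc_sc e)
      with A show "f i \<approx> h i"
        unfolding f_def h_def \<tau>[OF i(3) i'(2)] \<tau>'[OF i(3)]
        using i k m by (intro teq_smult tt_split inA_pieces inA_v) auto
    qed
    moreover have "smult (p (w k m) [k] - N k) (tt (gg k) (v k m) (gen k)) = X"
    proof -
      \<comment> \<open>The scalar is smaller than p(v[k,m], x_k) by the factor q, so one boundary
        term survives. It is exactly what the fold identity takes away from the summand i =
        k.\<close>
      have "p (w k m) [k] - N k = (1 - inverse q) * (q * N k)"
        using q_nz p_L[OF k] unfolding m'(1)[symmetric] by (simp add: field_simps)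
      then show ?thesis unfolding X_def G_single vb_single j(3) by (simp add: smult_smult)
    qed
    ultimately show "smult (p (w k m) [k] - N k) (tt (gg k) (v k m) (gen k))
      + (\<Sum>i\<in>{k..<m}. smult (\<tau> k m i * (1 - inverse q))
          (tt (G k i) (lA (N k) k m k i) (v k i) + tt (G k i + gg k) (v (i + 1) m) (lB (N k) k m k i)))
      \<approx> (\<Sum>i\<in>{k..<m}. smult (\<tau> k (m + 1) i * (1 - inverse q)) (tt (G k i) (v (i + 1) (m + 1)) (v k i)))"
      unfolding f_def h_def by simp
  qed (use k m m' j IH in auto)
qed

lemma Delta_right_high:
  assumes k: "n \<le> k" "k < m" "m < 2 * n" and IH: "\<Delta> (v (k + 1) m) \<approx> cop (k + 1) m"
  shows "\<Delta> (v k m) \<approx> cop k m"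
proof -
  define j where "j = 2 * n - k"
  have j: "j = idx n k" "j \<in> {1..n}" "k + j = 2 * n" using k n2 by (auto simp: idx_def j_def)
  show ?thesis
  proof (rule right_combine[where j = j])
    have "p [j] (w (k + 1) m) * p (w (k + 1) m) [j] = F j m / F j k"
      using pp'[of "k + 1" m j] k j n2 by (simp add: mult.commute)
    moreover have "F j m = 1" using k j by (auto simp: F_def)
    \<comment> \<open>For k = n the value q^2 gives 1 - 1/q^2 for the first summand, which is the
      exceptional coefficient at i = n.\<close>
    moreover have "F j k = (if k = n then q ^ 2 else q)" using k j by (auto simp: F_def)
    ultimately show "1 - p [j] (w (k + 1) m) * p (w (k + 1) m) [j] = \<tau> k m k * (1 - inverse q)"
      using k by (auto simp: tau_def power2_eq_square algebra_simps divide_inverse)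
    have "smult (\<tau> (k + 1) m i * (1 - inverse q))
          (tt (G (k + 1) i) (rA (k + 1) m j i) (v (k + 1) i) + tt (G (k + 1) i + gg j) (v (i + 1) m) (rB (k + 1) m j i))
      \<approx> smult (\<tau> k m i * (1 - inverse q)) (tt (G k i) (v (i + 1) m) (v k i))"
      if "i \<in> {k + 1..<m}" for i
    proof -
      have i: "1 \<le> k + 1" "k + 1 \<le> i" "i < m" "m < 2 * n" "j \<in> {1..n}" using that k j by auto
      have \<tau>: "\<tau> (k + 1) m i = 1" "\<tau> k m i = 1" using i k by (auto simp: tau_def)
      have "F j m = 1" "F j i = 1" using i k j by (auto simp: F_def)
      then have "quot (rB (k + 1) m j i) = V k i"
        unfolding quot_rB[OF i] coeff_right[OF i] using V_right[of k i] i k n2 unfolding j(1)[symmetric] by simp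
      moreover have "far j (i + 1) m" using i k j by (auto simp: far_def idx_def)
      then have "quot (rA (k + 1) m j i) = 0"
        unfolding quot_rA[OF i] using i k V_far[of "i + 1" m j] by simp
      moreover have "G (k + 1) i + gg j = G k i" using G_Cons[of k i] i by (simp add: j(1) add.commute)
      ultimately show ?thesis
        unfolding \<tau> using i k n2 by (intro teq_smult) (auto intro!: tt_split' inA_pieces inA_v simp flip: One_nat_def)
    qed
    then show "(\<Sum>i\<in>{k + 1..<m}. smult (\<tau> (k + 1) m i * (1 - inverse q))
          (tt (G (k + 1) i) (rA (k + 1) m j i) (v (k + 1) i) + tt (G (k + 1) i + gg j) (v (i + 1) m) (rB (k + 1) m j i)))
      \<approx> (\<Sum>i\<in>{k + 1..<m}. smult (\<tau> k m i * (1 - inverse q)) (tt (G k i) (v (i + 1) m) (v k i)))"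
      by (rule teq_sum)
  qed (use k n2 j IH in auto)
qed

text \<open>The fold identity multiplied by - q N'(k), which is minus the inverse of q N(k); this is
  the form needed when x_k is attached on the left.\<close>

lemma fold_identity_right:
  assumes "1 \<le> k" "k < n"
  shows "\<kappa> k \<cdot> br (q * N' k) (x k) (U (k + 1)) = L k - (q * N' k) \<cdot> R k"
proof -
  have NN: "q * N' k * (q * N k) = 1" using NN'[OF assms] by (simp add: mult_ac)
  have "L k - (q * N' k) \<cdot> R k = - ((q * N' k) \<cdot> (R k - (q * N k) \<cdot> L k))"
    by (simp add: endo.sc_diff_right endo.sc_sc endo.sc_one NN)
  also have "\<dots> = - ((q * N' k) \<cdot> (\<kappa> k \<cdot> (U (k + 1) * x k - (q * N k) \<cdot> (x k * U (k + 1)))))"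
    unfolding fold_identity[OF assms] ..
  also have "\<dots> = \<kappa> k \<cdot> (- ((q * N' k) \<cdot> (U (k + 1) * x k)) + (q * N' k * (q * N k)) \<cdot> (x k * U (k + 1)))"
    by (simp add: endo.sc_diff_right endo.sc_minus_right endo.sc_add_right endo.sc_sc mult_ac)
  finally show ?thesis unfolding NN by (simp add: endo.br_def endo.sc_one)
qed

lemma Delta_right_low:
  assumes k: "1 \<le> k" "k < n" "2 * n - k < m" "m < 2 * n" and IH: "\<Delta> (v (k + 1) m) \<approx> cop (k + 1) m"
  shows "\<Delta> (v k m) \<approx> cop k m"
proof -
  have j: "idx n k = k" "k \<in> {1..n}" using k by (auto simp: idx_def)
  define l where "l = 2 * n - k - 1"
  have l: "l + 1 = 2 * n - k" "k + 1 \<le> l" "l + 1 < m" "l + k + 1 = 2 * n" "n \<le> l" "l = 2 * n - (k + 1)"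
    using k by (auto simp: l_def)
  have idl: "idx n (l + 1) = k" using l k by (auto simp: idx_def)
  have Fm: "F k m = 1" using k l by (auto simp: F_def)
  show ?thesis
  proof (rule right_combine[where j = k])
    have "p [k] (w (k + 1) m) * p (w (k + 1) m) [k] = F k m / F k k"
      using pp'[of "k + 1" m k] k j by (simp add: mult.commute)
    moreover have "F k k = q" using k by (auto simp: F_def)
    ultimately show "1 - p [k] (w (k + 1) m) * p (w (k + 1) m) [k] = \<tau> k m k * (1 - inverse q)"
      using k Fm by (auto simp: tau_def divide_inverse)
    define X where "X = smult (1 - inverse q) (smult (q * N' k) (tt (G k l) (v (l + 1) m) (v (k + 1) (l + 1))))"
    define f where "f = (\<lambda>i. smult (\<tau> (k + 1) m i * (1 - inverse q))
          (tt (G (k + 1) i) (rA (k + 1) m k i) (v (k + 1) i) + tt (G (k + 1) i + gg k) (v (i + 1) m) (rB (k + 1) m k i)))"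
    define h where "h = (\<lambda>i. smult (\<tau> k m i * (1 - inverse q)) (tt (G k i) (v (i + 1) m) (v k i)))"
    have \<tau>': "\<tau> k m i = 1" if "i < m" for i using that k by (auto simp: tau_def)
    have \<tau>: "\<tau> (k + 1) m i = 1" if "i < m" "i \<noteq> l" for i using that k l by (auto simp: tau_def)
    have \<tau>l: "\<tau> (k + 1) m l = \<kappa> k" using k l by (auto simp: tau_def)
    have GG: "G (k + 1) i + gg k = G k i" if "k + 1 \<le> i" for i
      using G_Cons[of k i] that by (simp add: add.commute j(1))
    have Gl: "G (k + 1) (l + 1) = G k l"
      using G_snoc[of "k + 1" l] GG[of l] l idl by simp
    \<comment> \<open>The defective summands are those at \<open>l\<close> and \<open>l + 1\<close>,
      on either side of the second x_k, which stands at position l + 1 = 2n - k.\<close>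
    have "sum f {k + 1..<m} \<approx> sum h {k + 1..<m}"
    proof (rule teq_sum_shift[where a = "l + 1" and b = l and X = X])
      show "finite {k + 1..<m}" "l + 1 \<in> {k + 1..<m}" "l \<in> {k + 1..<m}" "l + 1 \<noteq> l" using l by auto
      have i: "1 \<le> k + 1" "k + 1 \<le> l" "l < m" "m < 2 * n" "k \<in> {1..n}" using l k by auto
      have "F k l = inverse q" using l k by (auto simp: F_def)
      then have e: "p [k] (w (k + 1) m) * p (w (l + 1) m) [k] = q * N' k"
        unfolding coeff_right[OF i] Fm N'_def by (simp add: l_def divide_inverse mult.commute)
      have UL: "U (k + 1) = V (k + 1) l" "L k = V k l" "R k = V (k + 1) (l + 1)"
        unfolding l(1) by (simp_all add: l_def)
      have "\<kappa> k \<cdot> quot (rB (k + 1) m k l) = V k l - (q * N' k) \<cdot> V (k + 1) (l + 1)"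
        unfolding quot_rB[OF i] e using fold_identity_right[OF k(1,2)] unfolding UL .
      then have B: "quot (smult (\<kappa> k) (rB (k + 1) m k l)) = quot (v k l - smult (q * N' k) (v (k + 1) (l + 1)))"
        by (simp only: quot_diff quot_smult)
      have "quot (rA (k + 1) m k l) = 0"
        unfolding quot_rA[OF i] using x_V_fold[of k m] k l(1) by simp
      then have A: "quot (smult (\<kappa> k) (rA (k + 1) m k l)) = 0" unfolding quot_smult by simp
      have "tt (G (k + 1) l) (smult (\<kappa> k) (rA (k + 1) m k l)) (v (k + 1) l)
          + tt (G k l) (v (l + 1) m) (smult (\<kappa> k) (rB (k + 1) m k l))
          \<approx> tt (G k l) (v (l + 1) m) (v k l - smult (q * N' k) (v (k + 1) (l + 1)))"
        using i l k by (intro tt_split' B A inA_diff inA_smult inA_pieces inA_v) auto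
      from teq_smult[OF this, of "1 - inverse q"] show "f l \<approx> h l - X"
        unfolding f_def h_def X_def \<tau>l \<tau>'[OF i(3)] GG[OF i(2)]
        by (simp only: product_smult product_diff smult_smult smult_add_right mult_1
            smult.scale_right_diff_distrib mult.commute mult.left_commute)
    next
      have i: "1 \<le> k + 1" "k + 1 \<le> l + 1" "l + 1 < m" "m < 2 * n" "k \<in> {1..n}" using l k by auto
      \<comment> \<open>The ratio of values of \<open>F\<close> lowers q N'(k) to N'(k), the scalar
        with which \<open>U_right\<close> yields u_k. The left factor starts just after x_k, so its
        bracket with x_k is a multiple of v[l+1,m].\<close>
      have "F k (l + 1) = q" using l k by (auto simp: F_def)
      moreover have "p [k] (w (k + 1) (l + 1)) = q * N' k" using p_R[OF k(1,2)] unfolding l(1) .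
      ultimately have e: "p [k] (w (k + 1) m) * p (w (l + 1 + 1) m) [k] = N' k"
        unfolding coeff_right[OF i] Fm using q_nz by simp
      have B: "quot (rB (k + 1) m k (l + 1)) = V k (l + 1)"
        unfolding quot_rB[OF i] e using U_right[OF k(1,2)] unfolding l(1) by simp
      have "quot (rA (k + 1) m k (l + 1)) = (q * N' k) \<cdot> V (l + 1) m"
        unfolding quot_rA[OF i] using V_right[of "l + 1" m] p_R[OF k(1,2)] l k idl by simp
      then have A: "quot (rA (k + 1) m k (l + 1)) = quot (smult (q * N' k) (v (l + 1) m))"
        unfolding quot_smult .
      have "tt (G k l) (rA (k + 1) m k (l + 1)) (v (k + 1) (l + 1)) + tt (G k (l + 1)) (v (l + 1 + 1) m) (rB (k + 1) m k (l + 1))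
         \<approx> tt (G k l) (smult (q * N' k) (v (l + 1) m)) (v (k + 1) (l + 1)) + tt (G k (l + 1)) (v (l + 1 + 1) m) (v k (l + 1))"
        using i l k by (intro teq_add tt_cong A B inA_pieces inA_smult inA_v) auto
      from teq_smult[OF this, of "1 - inverse q"] show "f (l + 1) \<approx> h (l + 1) + X"
        unfolding f_def h_def X_def GG[OF i(2)] unfolding Gl
        using \<tau>[of "l + 1"] \<tau>'[of "l + 1"] i
        by (simp add: product_smult smult_add_right smult_smult add.commute)
    next
      fix i assume i': "i \<in> {k + 1..<m}" "i \<noteq> l + 1" "i \<noteq> l"
      then have i: "1 \<le> k + 1" "k + 1 \<le> i" "i < m" "m < 2 * n" "k \<in> {1..n}" using k j by auto
      have "F k i = 1" using i' l k by (auto simp: F_def)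
      then have B1: "quot (rB (k + 1) m k i) = br (p [k] (w (k + 1) i)) (x k) (V (k + 1) i)"
        unfolding quot_rB[OF i] coeff_right[OF i] Fm by simp
      have "quot (rB (k + 1) m k i) = V k i \<and> quot (rA (k + 1) m k i) = 0"
      proof (cases "i < l")
        case True
        have "br (p [k] (w (i + 1) m)) (x k) (V (i + 1) m) = 0"
          using True i l k by (intro x_V_inner) auto
        moreover have "V k i = br (p [k] (w (k + 1) i)) (x k) (V (k + 1) i)"
          using V_Cons[of k i] True i l k j(1) by simp
        ultimately show ?thesis using B1 quot_rA[OF i] by simp
      next
        case False
        then have il: "l + 1 < i" using i' by auto
        have "far k (i + 1) m" using il l k by (auto simp: far_def idx_def)
        then have "br (p [k] (w (i + 1) m)) (x k) (V (i + 1) m) = 0"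
          using i k V_far[of "i + 1" m k] by simp
        moreover have "V k i = br (p [k] (w (k + 1) i)) (x k) (V (k + 1) i)"
          using V_right[of k i] il i l k j(1) by simp
        ultimately show ?thesis using B1 quot_rA[OF i] by simp
      qed
      then show "f i \<approx> h i"
        unfolding f_def h_def \<tau>[OF i(3) i'(3)] \<tau>'[OF i(3)] GG[OF i(2)]
        using i k by (intro teq_smult tt_split' inA_pieces inA_v) auto
    qed
    then show "(\<Sum>i\<in>{k + 1..<m}. smult (\<tau> (k + 1) m i * (1 - inverse q))
          (tt (G (k + 1) i) (rA (k + 1) m k i) (v (k + 1) i) + tt (G (k + 1) i + gg k) (v (i + 1) m) (rB (k + 1) m k i)))
      \<approx> (\<Sum>i\<in>{k + 1..<m}. smult (\<tau> k m i * (1 - inverse q)) (tt (G k i) (v (i + 1) m) (v k i)))"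
      unfolding f_def h_def .
  qed (use k j IH in auto)
qed

lemma Delta_v:
  assumes "1 \<le> k" "k \<le> m" "m < 2 * n"
  shows "\<Delta> (v k m) \<approx> cop k m"
  using assms
proof (induction "m - k" arbitrary: k m rule: less_induct)
  case less
  have IHl: "\<Delta> (v k (m - 1)) \<approx> cop k (m - 1)" if "k < m" using less.prems that by (intro less.hyps) auto
  have IHr: "\<Delta> (v (k + 1) m) \<approx> cop (k + 1) m" if "k < m" using less.prems that by (intro less.hyps) auto
  \<comment> \<open>A letter is removed on the side at which v[k,m] is defined by a bracket; for n
    <= k this is the left end for every m > k.\<close>
  consider "k = m" | "k < m" "m \<le> n" "k < n" | "k < m" "n < m" "m < 2 * n - k" | "k < m" "m = 2 * n - k" "k < n"
    | "k < m" "n \<le> k" | "2 * n - k < m" "k < n"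
    using less.prems by linarith
  then show ?case
  proof cases
    case 1
    have "idx n k \<in> {1..n}" using less.prems 1 by (intro idx_range) auto
    then show ?thesis
      using 1 by (simp add: cop_def vb_single Delta_gen G_single amul_one_right flip: one_def)
  next
    case 2
    then show ?thesis using Delta_left_short[of k "m - 1"] IHl less.prems by simp
  next
    case 3
    then show ?thesis using Delta_left_long[of k "m - 1"] IHl less.prems by simp
  next
    case 4
    then show ?thesis using Delta_middle[of k "m - 1"] IHl less.prems by simp
  next
    case 5
    then show ?thesis using Delta_right_high[of k m] IHr less.prems by simp
  next
    case 6
    then show ?thesis using Delta_right_low[of k m] IHr less.prems by simp
  qed
qed

end

theorem theorem5p1:
  fixes chi :: "nat \<Rightarrow> 'g::ab_group_add \<Rightarrow> 'k::field"
    and gg :: "nat \<Rightarrow> 'g"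
    and n k m :: nat
    and q :: 'k
  assumes n2: "n \<ge> 2"
    and chi_hom: "\<forall>i\<in>{1..n}. \<forall>a b. chi i (a + b) = chi i a * chi i b"
    and chi_nz: "\<forall>i\<in>{1..n}. \<forall>a. chi i a \<noteq> 0"
    and q_nz: "q \<noteq> 0" and q3: "q ^ 3 \<noteq> 1" and qm1: "q \<noteq> - 1"
    and p_ii: "\<forall>i. 1 \<le> i \<and> i < n \<longrightarrow> chi i (gg i) = q"
    and p_nn: "chi n (gg n) = q ^ 2"
    and p_adj: "\<forall>i. 1 < i \<and> i < n \<longrightarrow> chi i (gg (i - 1)) * chi (i - 1) (gg i) = inverse q"
    and p_last: "chi (n - 1) (gg n) * chi n (gg (n - 1)) = inverse (q ^ 2)"
    and p_far: "\<forall>i j. 1 \<le> i \<and> i + 1 < j \<and> j \<le> n \<longrightarrow> chi i (gg j) * chi j (gg i) = 1"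
    and km: "1 \<le> k" "k \<le> m" "m < 2 * n"
  shows "Delta chi gg (vb chi gg n q k m)
         - (tens (vb chi gg n q k m) one
            + tens (grp (gkm gg n k m)) (vb chi gg n q k m)
            + (\<Sum>i\<in>{k..<m}. smult (tau n q k m i * (1 - inverse q))
                 (tens (amul chi (grp (gkm gg n k i)) (vb chi gg n q (i + 1) m)) (vb chi gg n q k i))))
         \<in> tideal n (Iq chi gg n)"
proof -
  interpret uq_sp chi gg n q
    using assms by unfold_locales
  have "grp 0 = (one :: ('g, 'k) alg)" by (simp add: one_def)
  moreover have "grp g \<star> one = grp g" for g by (simp add: amul_one_right)
  ultimately show ?thesis
    using Delta_v[OF km] by (simp add: teq_def cop_def)
qed

end
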